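(* There exists a unique family of polynomials $\{\psi_T(t)\in\mathbb{Q}[t]\}_{T\in\mathbb{T}}$ indexed by the (isomorphism classes of) rooted trees such that, for every integer $n\ge1$ and every system $F=z+H\in\mathbb{C}[[z_1,\ldots,z_n]]^n$ of the form identity plus higher, the formal flow $F_t$ generated by $F$ is $$F_t=z+\sum_{T\in\mathbb{T}}\psi_T(t)\,\mathcal{P}_T .$$ These polynomials are given by the formula $$\psi_T(t)=\sum_{k=1}^{v(T)}\frac{t^k}{k!}\sum_{\substack{\vec e=(e_1,\ldots,e_{k-1})\in E(T)^{k-1}\\ e_1\succ\cdots\succ e_{k-1}}}\phi_{T_{\vec e,1}}\phi_{T_{\vec e,2}}\cdots\phi_{T_{\vec e,k}},$$ where the inner sum for $k=1$ is interpreted as $\phi_T$.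
   Context: Trees. A rooted tree is a finite connected acyclic graph with a designated root $\mathrm{rt}_T$; isomorphisms preserve roots. $\mathbb{T}$ is the set of isomorphism classes of rooted trees. $V(T),E(T)$ are the vertex and edge sets, $v(T)=|V(T)|$, $\alpha_T=|\mathrm{Aut}(T)|$, and $v^+$ is the set of children of a vertex $v$. Cutting edges. For $e\in E(T)$ let $T_e$ be the component of $T$ minus the edge $e$ containing $\mathrm{rt}_T$ (rooted at $\mathrm{rt}_T$), and $T'_e$ the other component, rooted at the endpoint of $e$ farther from $\mathrm{rt}_T$. Write $e\succ f$ if $f\in E(T_e)$; $e_1\succ\cdots\succ e_r$ means $e_i\succ e_j$ for all $i<j$. Such a sequence $\vec e$ determines rooted trees $T_{\vec e,1},\ldots,T_{\vec e,r+1}$: put $S_1=T$ and, for $i=1,\ldots,r$, $T_{\vec e,i}=(S_i)'_{e_i}$, $S_{i+1}=(S_i)_{e_i}$; finally $T_{\vec e,r+1}=S_{r+1}$. The numbers $\phi_T\in\mathbb{Q}$ are defined recursively by $\phi_T=1$ if $v(T)=1$ and, for $v(T)\ge2$, $\phi_T=-\sum_{k=2}^{v(T)}\frac{1}{k!}\sum_{\vec e\in E(T)^{k-1},\,e_1\succ\cdots\succ e_{k-1}}\phi_{T_{\vec e,1}}\cdots\phi_{T_{\vec e,k}}$. Power series of a tree. Let $\mathbb{C}[[z]]=\mathbb{C}[[z_1,\ldots,z_n]]$, $D_i=\partial/\partial z_i$, $H\in\mathbb{C}[[z]]^n$. For $f:V(T)\to\{1,\ldots,n\}$ put $P_{T,f}=\prod_{v\in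 V(T)}\big(\prod_{w\in v^+}D_{f(w)}\big)H_{f(v)}$; $P_{T,i}=\sum_{f:\,f(\mathrm{rt}_T)=i}P_{T,f}$, $P_T=(P_{T,1},\ldots,P_{T,n})$, $\mathcal{P}_T=\frac{1}{\alpha_T}P_T$. Flow. $F=z+H$, $z=(z_1,\dots,z_n)$, is of the form identity plus higher if each $H_i$ involves only monomials of degree $\ge2$ (then infinite sums over $\mathbb{T}$ as in the claim make sense). The D-Log of $F$ is the (known to exist) unique $a=(a_1,\ldots,a_n)\in\mathbb{C}[[z]]^n$ involving only monomials of degree $\ge2$ with $\exp(A)\cdot z=F$, where $A=\sum_i a_iD_i$ and $\exp(A)=\sum_{k\ge0}A^k/k!$ acts coordinatewise. For an indeterminate $t$, the formal flow generated by $F$ is $F_t=\exp(tA)\cdot z\in\mathbb{C}[t][[z]]^n$. *)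

theory Defs
  imports Complex_Main
    "HOL-Library.FuncSet"
    "HOL-Library.Poly_Mapping"
    "HOL-Combinatorics.Permutations"
    "HOL-Computational_Algebra.Polynomial"
begin

section \<open>Rooted trees\<close>

datatype 'v rgraph = RGraph (verts: "'v set") (edges: "'v set set") (rt: 'v)

definition adj :: "'v set set \<Rightarrow> ('v \<times> 'v) set" where
  "adj E = {(u, v). {u, v} \<in> E}"

definition has_cycle :: "'v set set \<Rightarrow> bool" where
  "has_cycle E \<longleftrightarrow> (\<exists>c. 3 \<le> length c \<and> distinct c \<and>
     (\<forall>i < length c. {c ! i, c ! ((i + 1) mod length c)} \<in> E))"

definition rooted_tree :: "'v rgraph \<Rightarrow> bool" where
  "rooted_tree T \<longleftrightarrow> finite (verts T) \<and> rt T \<in> verts T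
     \<and> (\<forall>e\<in>edges T. e \<subseteq> verts T \<and> card e = 2)
     \<and> (\<forall>u\<in>verts T. \<forall>v\<in>verts T. (u, v) \<in> (adj (edges T))\<^sup>*)
     \<and> \<not> has_cycle (edges T)"

definition tree_iso :: "'v rgraph \<Rightarrow> 'w rgraph \<Rightarrow> bool" where
  "tree_iso T T' \<longleftrightarrow> rooted_tree T \<and> rooted_tree T' \<and>
     (\<exists>g. bij_betw g (verts T) (verts T') \<and> (`) g ` edges T = edges T' \<and> g (rt T) = rt T')"

lemma rooted_tree_singleton: "rooted_tree (RGraph {x} {} x)"
proof -
  have "\<not> has_cycle {}"
    unfolding has_cycle_def by (metis empty_iff less_le_trans zero_less_numeral)
  then show ?thesis by (simp add: rooted_tree_def)
qed

lemma tree_iso_refl: "rooted_tree T \<Longrightarrow> tree_iso T T"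
  unfolding tree_iso_def by (intro conjI exI[of _ id]) auto

lemma tree_iso_sym: assumes "tree_iso T T'" shows "tree_iso T' T"
proof -
  from assms obtain g where T: "rooted_tree T" "rooted_tree T'"
    and g: "bij_betw g (verts T) (verts T')" "(`) g ` edges T = edges T'" "g (rt T) = rt T'"
    unfolding tree_iso_def by blast
  define h where "h = inv_into (verts T) g"
  have inj: "inj_on g (verts T)" using g(1) by (rule bij_betw_imp_inj_on)
  have sub: "e \<subseteq> verts T" if "e \<in> edges T" for e using T(1) that by (auto simp: rooted_tree_def)
  have r: "rt T \<in> verts T" using T(1) by (auto simp: rooted_tree_def)
  have he: "h ` g ` e = e" if "e \<in> edges T" for e
    unfolding h_def using inj sub[OF that] by (rule inv_into_image_cancel)
  have "(`) h ` edges T' = (\<lambda>e. h ` g ` e) ` edges T"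
    unfolding g(2)[symmetric] by (rule image_image)
  also have "\<dots> = (\<lambda>e. e) ` edges T" using he by (rule image_cong[OF refl])
  also have "\<dots> = edges T" by (rule image_ident)
  finally have "(`) h ` edges T' = edges T" .
  moreover have "h (rt T') = rt T"
    unfolding g(3)[symmetric] h_def using inj r by simp
  moreover have "bij_betw h (verts T') (verts T)"
    unfolding h_def using g(1) by (rule bij_betw_inv_into)
  ultimately show ?thesis using T unfolding tree_iso_def by blast
qed

lemma tree_iso_trans: assumes "tree_iso T T'" "tree_iso T' T''" shows "tree_iso T T''"
proof -
  from assms(1) obtain g where T: "rooted_tree T"
    and g: "bij_betw g (verts T) (verts T')" "(`) g ` edges T = edges T'" "g (rt T) = rt T'"
    unfolding tree_iso_def by blast
  from assms(2) obtain h where T'': "rooted_tree T''"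
    and h: "bij_betw h (verts T') (verts T'')" "(`) h ` edges T' = edges T''" "h (rt T') = rt T''"
    unfolding tree_iso_def by blast
  have "bij_betw (h \<circ> g) (verts T) (verts T'')" using g(1) h(1) by (rule bij_betw_trans)
  moreover have "(`) (h \<circ> g) ` edges T = edges T''"
    unfolding h(2)[symmetric] g(2)[symmetric] image_comp comp_def by (simp only:)
  moreover have "(h \<circ> g) (rt T) = rt T''" using g(3) h(3) by simp
  ultimately show ?thesis using T T'' unfolding tree_iso_def by blast
qed

text \<open>The set of isomorphism classes of rooted trees; every finite rooted tree is isomorphic to
  one whose vertices are natural numbers.\<close>

quotient_type rtree = "nat rgraph" / partial: "tree_iso :: nat rgraph \<Rightarrow> nat rgraph \<Rightarrow> bool"
proof (rule part_equivpI)
  show "\<exists>T::nat rgraph. tree_iso T T"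
    by (rule exI) (rule tree_iso_refl[OF rooted_tree_singleton])
  show "symp (tree_iso :: nat rgraph \<Rightarrow> nat rgraph \<Rightarrow> bool)"
    by (rule sympI) (rule tree_iso_sym)
  show "transp (tree_iso :: nat rgraph \<Rightarrow> nat rgraph \<Rightarrow> bool)"
    by (rule transpI) (rule tree_iso_trans)
qed

lemma abs_rtree_eq_iff:
  "rooted_tree T \<Longrightarrow> rooted_tree T' \<Longrightarrow> abs_rtree T = abs_rtree T' \<longleftrightarrow> tree_iso T T'"
  using Quotient3_rel[OF Quotient3_rtree, of T T'] tree_iso_refl by blast

lemma rooted_tree_rep_rtree: "rooted_tree (rep_rtree c)"
  using Quotient3_rep_reflp[OF Quotient3_rtree, of c] by (simp add: tree_iso_def)

lemma abs_rep_rtree: "abs_rtree (rep_rtree c) = c"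
  using Quotient3_abs_rep[OF Quotient3_rtree] .

definition depth :: "'v rgraph \<Rightarrow> 'v \<Rightarrow> nat" where
  "depth T v = (LEAST k. (rt T, v) \<in> adj (edges T) ^^ k)"

definition children :: "'v rgraph \<Rightarrow> 'v \<Rightarrow> 'v set" where
  "children T v = {w \<in> verts T. {v, w} \<in> edges T \<and> depth T v < depth T w}"

definition num_auts :: "'v rgraph \<Rightarrow> nat" where
  "num_auts T = card {p. p permutes verts T \<and> (`) p ` edges T = edges T \<and> p (rt T) = rt T}"


section \<open>Cutting edges\<close>

definition component :: "'v set set \<Rightarrow> 'v \<Rightarrow> 'v rgraph" where
  "component E x = (let C = {y. (x, y) \<in> (adj E)\<^sup>*} in RGraph C {d \<in> E. d \<subseteq> C} x)"

definition far_end :: "'v rgraph \<Rightarrow> 'v set \<Rightarrow> 'v" where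
  "far_end T e = arg_max (depth T) (\<lambda>x. x \<in> e)"

text \<open>The trees $T_e$ and $T'_e$.\<close>

definition root_part :: "'v rgraph \<Rightarrow> 'v set \<Rightarrow> 'v rgraph" where
  "root_part T e = component (edges T - {e}) (rt T)"

definition branch_part :: "'v rgraph \<Rightarrow> 'v set \<Rightarrow> 'v rgraph" where
  "branch_part T e = component (edges T - {e}) (far_end T e)"

text \<open>The sequences $e_1 \succ \cdots \succ e_r$ in $E(T)^r$, and for such a sequence the list
  of trees $T_{\vec e,1}, \ldots, T_{\vec e,r+1}$.\<close>

definition cut_seqs :: "'v rgraph \<Rightarrow> nat \<Rightarrow> 'v set list set" where
  "cut_seqs T r = {es. length es = r \<and> set es \<subseteq> edges T \<and>
     sorted_wrt (\<lambda>e f. f \<in> edges (root_part T e)) es}"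

fun pieces :: "'v rgraph \<Rightarrow> 'v set list \<Rightarrow> 'v rgraph list" where
  "pieces S [] = [S]"
| "pieces S (e # es) = branch_part S e # pieces (root_part S e) es"

lemma edges_component: "edges (component E x) \<subseteq> E"
  by (auto simp: component_def Let_def)

lemma edges_pieces: "S \<in> set (pieces T es) \<Longrightarrow> edges S \<subseteq> edges T"
proof (induction T es rule: pieces.induct)
  case (2 T e es)
  have "edges (branch_part T e) \<subseteq> edges T" "edges (root_part T e) \<subseteq> edges T"
    using edges_component[of "edges T - {e}"] by (auto simp: branch_part_def root_part_def)
  with 2 show ?case by auto
qed auto

lemma edges_pieces_psubset:
  assumes "es \<in> cut_seqs T r" "0 < r" "S \<in> set (pieces T es)"
  shows "edges S \<subset> edges T"
proof -
  from assms obtain e es' where es: "es = e # es'" "e \<in> edges T"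
    by (cases es) (auto simp: cut_seqs_def)
  have "edges (branch_part T e) \<subseteq> edges T - {e}" "edges (root_part T e) \<subseteq> edges T - {e}"
    using edges_component[of "edges T - {e}"] by (auto simp: branch_part_def root_part_def)
  moreover have "S = branch_part T e \<or> edges S \<subseteq> edges (root_part T e)"
    using assms(3) es edges_pieces[of S "root_part T e" es'] by auto
  ultimately show ?thesis using es(2) by auto
qed

text \<open>The value 1 at arguments that are not rooted trees is irrelevant; the test in the equation
  serves to make the recursion well-founded.\<close>

function phi :: "'v rgraph \<Rightarrow> rat" where
  "phi T = (if rooted_tree T \<and> 2 \<le> card (verts T)
    then - (\<Sum>k = 2..card (verts T). 1 / fact k *
              (\<Sum>es \<in> cut_seqs T (k - 1). prod_list (map phi (pieces T es))))
    else 1)"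
  by pat_completeness auto
termination
proof (relation "measure (\<lambda>T. card (edges T))")
  fix T :: "'v rgraph" and k es S
  assume *: "rooted_tree T \<and> 2 \<le> card (verts T)" "k \<in> {2..card (verts T)}"
    "es \<in> cut_seqs T (k - 1)" "S \<in> set (pieces T es)"
  have "edges T \<subseteq> Pow (verts T)" "finite (verts T)"
    using * by (auto simp: rooted_tree_def)
  then have "finite (edges T)" by (meson finite_Pow_iff finite_subset)
  moreover have "edges S \<subset> edges T"
    using * by (intro edges_pieces_psubset[of es T "k - 1"]) auto
  ultimately show "(S, T) \<in> measure (\<lambda>T. card (edges T))"
    by (simp add: psubset_card_mono)
qed simp

declare phi.simps [simp del]


section \<open>Formal power series in several variables\<close>

text \<open>A monomial is a finitely supported exponent function, the indeterminates being
  $z_0, z_1, z_2, \ldots$; the ring $R[[z_1,\ldots,z_n]]$ is the subset \<open>series n\<close> below.\<close>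

typedef 'a mfps = "UNIV :: ((nat \<Rightarrow>\<^sub>0 nat) \<Rightarrow> 'a) set"
  morphisms mcoeff Abs_mfps by simp

setup_lifting type_definition_mfps

lemma mfps_eqI: "(\<And>m. mcoeff f m = mcoeff g m) \<Longrightarrow> f = g"
  by (metis ext mcoeff_inject)

lemma finite_monomial_splits: "finite {(a, b). a + b = (m :: nat \<Rightarrow>\<^sub>0 nat)}"
proof -
  let ?A = "{a. \<exists>b. a + b = m}"
  let ?F = "{f. \<forall>i. (i \<in> Poly_Mapping.keys m \<longrightarrow> f i \<in> {..Max (Poly_Mapping.lookup m ` Poly_Mapping.keys m)}) \<and> (i \<notin> Poly_Mapping.keys m \<longrightarrow> f i = (0::nat))}"
  have "Poly_Mapping.lookup ` ?A \<subseteq> ?F"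
  proof (clarify, intro conjI impI)
    fix a b i assume m: "m = a + b" and i: "i \<in> Poly_Mapping.keys (a + b)"
    have "Poly_Mapping.lookup a i \<le> Poly_Mapping.lookup m i" unfolding m by (simp add: lookup_add)
    also have "\<dots> \<le> Max (Poly_Mapping.lookup m ` Poly_Mapping.keys m)" using i m by (intro Max_ge) auto
    finally show "Poly_Mapping.lookup a i \<in> {..Max (Poly_Mapping.lookup (a + b) ` Poly_Mapping.keys (a + b))}" using m by simp
  next
    fix a b :: "nat \<Rightarrow>\<^sub>0 nat" and i assume "i \<notin> Poly_Mapping.keys (a + b)"
    then show "Poly_Mapping.lookup a i = 0" by (simp add: in_keys_iff lookup_add)
  qed
  moreover have "finite ?F" by (intro finite_set_of_finite_funs) auto
  ultimately have "finite (Poly_Mapping.lookup ` ?A)" by (rule finite_subset)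
  then have "finite ?A"
    by (rule finite_imageD) (rule inj_onI, erule lookup_inject[THEN iffD1])
  moreover have "{(a, b). a + b = m} \<subseteq> (\<lambda>a. (a, m - a)) ` ?A" by auto
  ultimately show ?thesis by (meson finite_surj)
qed

instantiation mfps :: (comm_ring_1) comm_ring_1
begin

lift_definition zero_mfps :: "'a mfps" is "\<lambda>m. 0" .
lift_definition one_mfps :: "'a mfps" is "\<lambda>m. if m = 0 then 1 else 0" .
lift_definition plus_mfps :: "'a mfps \<Rightarrow> 'a mfps \<Rightarrow> 'a mfps" is "\<lambda>f g m. f m + g m" .
lift_definition minus_mfps :: "'a mfps \<Rightarrow> 'a mfps \<Rightarrow> 'a mfps" is "\<lambda>f g m. f m - g m" .
lift_definition uminus_mfps :: "'a mfps \<Rightarrow> 'a mfps" is "\<lambda>f m. - f m" .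
lift_definition times_mfps :: "'a mfps \<Rightarrow> 'a mfps \<Rightarrow> 'a mfps"
  is "\<lambda>f g m. \<Sum>(a, b) \<in> {(a, b). a + b = m}. f a * g b" .

instance
proof
  fix f g h :: "'a mfps"
  note fin = finite_monomial_splits
  show "f * g = g * f"
  proof (rule mfps_eqI)
    fix m
    show "mcoeff (f * g) m = mcoeff (g * f) m"
      unfolding times_mfps.rep_eq
      by (rule sum.reindex_bij_witness[of _ prod.swap prod.swap])
        (auto simp: add.commute mult.commute)
  qed
  show "(f * g) * h = f * (g * h)"
  proof (rule mfps_eqI)
    fix m :: "nat \<Rightarrow>\<^sub>0 nat"
    have "mcoeff ((f * g) * h) m =
        (\<Sum>x \<in> {(a, b). a + b = m}. \<Sum>y \<in> {(c, d). c + d = fst x}.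
           mcoeff f (fst y) * mcoeff g (snd y) * mcoeff h (snd x))"
      by (simp add: times_mfps.rep_eq sum_distrib_right case_prod_unfold)
    also have "\<dots> = (\<Sum>(x, y) \<in> (SIGMA x:{(a, b). a + b = m}. {(c, d). c + d = fst x}).
           mcoeff f (fst y) * mcoeff g (snd y) * mcoeff h (snd x))"
      using fin by (subst sum.Sigma) auto
    also have "\<dots> = (\<Sum>(x, y) \<in> (SIGMA x:{(a, b). a + b = m}. {(c, d). c + d = snd x}).
           mcoeff f (fst x) * (mcoeff g (fst y) * mcoeff h (snd y)))"
      by (rule sum.reindex_bij_witness[of _
            "\<lambda>((a, b), (c, d)). ((a + c, d), (a, c))" "\<lambda>((a, b), (c, d)). ((c, d + b), (d, b))"])
        (auto simp: add.assoc mult.assoc)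
    also have "\<dots> = (\<Sum>x \<in> {(a, b). a + b = m}. \<Sum>y \<in> {(c, d). c + d = snd x}.
           mcoeff f (fst x) * (mcoeff g (fst y) * mcoeff h (snd y)))"
      using fin by (subst sum.Sigma) auto
    also have "\<dots> = mcoeff (f * (g * h)) m"
      by (simp add: times_mfps.rep_eq sum_distrib_left case_prod_unfold)
    finally show "mcoeff ((f * g) * h) m = mcoeff (f * (g * h)) m" .
  qed
  show "1 * f = f"
  proof (rule mfps_eqI)
    fix m
    have "mcoeff (1 * f) m =
        (\<Sum>x \<in> {(a, b). a + b = m}. if x = (0, m) then mcoeff f m else 0)"
      unfolding times_mfps.rep_eq one_mfps.rep_eq by (rule sum.cong) (auto split: if_splits)
    also have "\<dots> = mcoeff f m" using fin[of m] by simp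
    finally show "mcoeff (1 * f) m = mcoeff f m" .
  qed
  show "(f + g) * h = f * h + g * h"
    by (rule mfps_eqI)
      (simp add: times_mfps.rep_eq plus_mfps.rep_eq case_prod_unfold distrib_right sum.distrib)
  show "(0 :: 'a mfps) \<noteq> 1"
  proof
    assume "(0 :: 'a mfps) = 1"
    then have "mcoeff (0 :: 'a mfps) 0 = mcoeff (1 :: 'a mfps) 0" by simp
    then show False by (simp add: zero_mfps.rep_eq one_mfps.rep_eq)
  qed
qed (transfer; force simp: add.assoc add.commute)+

end

definition mvar :: "nat \<Rightarrow> 'a::comm_ring_1 mfps" where
  "mvar i = Abs_mfps (\<lambda>m. if m = Poly_Mapping.single i 1 then 1 else 0)"

definition mscale :: "'a \<Rightarrow> 'a mfps \<Rightarrow> 'a::comm_ring_1 mfps" where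
  "mscale c f = Abs_mfps (\<lambda>m. c * mcoeff f m)"

definition mderiv :: "nat \<Rightarrow> 'a mfps \<Rightarrow> 'a::comm_ring_1 mfps" where
  "mderiv i f = Abs_mfps (\<lambda>m.
     of_nat (Poly_Mapping.lookup m i + 1) * mcoeff f (m + Poly_Mapping.single i 1))"

definition mmap :: "('a \<Rightarrow> 'b) \<Rightarrow> 'a mfps \<Rightarrow> 'b mfps" where
  "mmap c f = Abs_mfps (\<lambda>m. c (mcoeff f m))"

text \<open>The coefficientwise sum of a family of power series, meaningful if for every monomial only
  finitely many members of the family have a nonzero coefficient there. Every use below is of this
  kind: if all $H_i$ and $a_i$ have only monomials of degree at least 2, then
  $\mathcal{P}_{T,i}$ and $A^k \cdot z_i$ have only monomials of degree at least $v(T) + 1$ and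
  $k + 1$, respectively.\<close>

definition msum :: "('b \<Rightarrow> 'a mfps) \<Rightarrow> 'a::comm_ring_1 mfps" where
  "msum f = Abs_mfps (\<lambda>m. Sum_any (\<lambda>x. mcoeff (f x) m))"

definition mdegree :: "(nat \<Rightarrow>\<^sub>0 nat) \<Rightarrow> nat" where
  "mdegree m = (\<Sum>i \<in> Poly_Mapping.keys m. Poly_Mapping.lookup m i)"

definition series :: "nat \<Rightarrow> 'a::comm_ring_1 mfps set" where
  "series n = {f. \<forall>m. mcoeff f m \<noteq> 0 \<longrightarrow> Poly_Mapping.keys m \<subseteq> {1..n}}"

definition higher :: "nat \<Rightarrow> 'a::comm_ring_1 mfps set" where
  "higher n = {f \<in> series n. \<forall>m. mcoeff f m \<noteq> 0 \<longrightarrow> 2 \<le> mdegree m}"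


section \<open>D-Log and formal flow\<close>

text \<open>Systems in $R[[z_1,\ldots,z_n]]^n$ are functions on the indices $1, \ldots, n$.\<close>

definition derivation :: "nat \<Rightarrow> (nat \<Rightarrow> 'a mfps) \<Rightarrow> 'a mfps \<Rightarrow> 'a::comm_ring_1 mfps" where
  "derivation n a g = (\<Sum>i = 1..n. a i * mderiv i g)"

text \<open>The operator $\exp(A)$ for $A = \sum_i a_i D_i$, used for the coefficient rings $\mathbb{C}$
  and $\mathbb{C}[t]$. In both, \<open>1 div fact k\<close> is the exact inverse of $k!$.\<close>

definition exp_derivation ::
  "nat \<Rightarrow> (nat \<Rightarrow> 'a mfps) \<Rightarrow> 'a mfps \<Rightarrow> 'a::{idom_divide, ring_char_0} mfps" where
  "exp_derivation n a g = msum (\<lambda>k. mscale (1 div fact k) ((derivation n a ^^ k) g))"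

lemma one_div_fact_complex_poly: "(1 :: complex poly) div fact k = [:1 / fact k:]"
proof -
  have "(fact k :: complex poly) = [:fact k:]" by (metis of_nat_fact of_nat_poly)
  then have "(1 :: complex poly) = fact k * [:1 / fact k:]" by simp
  then show ?thesis by (metis fact_nonzero nonzero_mult_div_cancel_left)
qed

definition D_Log :: "nat \<Rightarrow> (nat \<Rightarrow> complex mfps) \<Rightarrow> nat \<Rightarrow> complex mfps" where
  "D_Log n F = (THE a. a \<in> {1..n} \<rightarrow>\<^sub>E higher n \<and>
     (\<forall>i\<in>{1..n}. exp_derivation n a (mvar i) = F i))"

text \<open>The embedding of $\mathbb{C}[[z]]$ into $\mathbb{C}[t][[z]]$.\<close>

definition const_t :: "complex mfps \<Rightarrow> complex poly mfps" where
  "const_t = mmap (\<lambda>c. [:c:])"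

definition flow :: "nat \<Rightarrow> (nat \<Rightarrow> complex mfps) \<Rightarrow> nat \<Rightarrow> complex poly mfps" where
  "flow n F i =
     exp_derivation n (\<lambda>j. mscale [:0, 1:] (const_t (D_Log n F j))) (mvar i)"


section \<open>Power series of a tree\<close>

text \<open>The product of the commuting operators $D_{f(w)}$ over a set of vertices $w$ is their
  composition.\<close>

definition labelled_series ::
  "(nat \<Rightarrow> complex mfps) \<Rightarrow> 'v rgraph \<Rightarrow> ('v \<Rightarrow> nat) \<Rightarrow> complex mfps" where
  "labelled_series H T f =
     (\<Prod>v \<in> verts T. Finite_Set.fold (\<lambda>w. mderiv (f w)) (H (f v)) (children T v))"

definition tree_series ::
  "nat \<Rightarrow> (nat \<Rightarrow> complex mfps) \<Rightarrow> 'v rgraph \<Rightarrow> nat \<Rightarrow> complex mfps" where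
  "tree_series n H T i =
     (\<Sum>f \<in> {f \<in> verts T \<rightarrow>\<^sub>E {1..n}. f (rt T) = i}. labelled_series H T f)"

definition norm_tree_series ::
  "nat \<Rightarrow> (nat \<Rightarrow> complex mfps) \<Rightarrow> 'v rgraph \<Rightarrow> nat \<Rightarrow> complex mfps" where
  "norm_tree_series n H T i = mscale (1 / of_nat (num_auts T)) (tree_series n H T i)"

lemma mderiv_commute: "mderiv i (mderiv j f) = mderiv j (mderiv i f)"
  by (cases "i = j")
    (auto intro!: mfps_eqI simp: mderiv_def Abs_mfps_inverse lookup_add lookup_single
       when_def ac_simps)

text \<open>The property $F_t = z + \sum_T \psi_T(t) \mathcal{P}_T$ for all \<open>n\<close> and all $F = z + H$.
  The series $\mathcal{P}_T$ depends only on the isomorphism class of $T$, and is evaluated at a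
  representative.\<close>

definition flow_expansion :: "(rtree \<Rightarrow> rat poly) \<Rightarrow> bool" where
  "flow_expansion \<psi> \<longleftrightarrow>
     (\<forall>n \<ge> 1. \<forall>H \<in> {1..n} \<rightarrow> higher n. \<forall>i \<in> {1..n}.
        flow n (\<lambda>j. mvar j + H j) i =
        mvar i + msum (\<lambda>T. mscale (map_poly of_rat (\<psi> T))
                              (const_t (norm_tree_series n H (rep_rtree T) i))))"

end

theory Submission
  imports Defs
begin

text \<open>The D-Log can be written down in closed form: it is \<open>a = \<Sum>\<^sub>T \<phi>\<^sub>T \<P>\<^sub>T\<close>. The key is that derivations
  act on tree series by grafting. If \<open>A\<close> is the derivation with coefficients \<open>\<Sum>\<^sub>S w\<^sub>S \<P>\<^sub>S\<close>, the product
  rule turns \<open>A \<P>\<^sub>T\<close> into a sum over all ways of hanging a tree \<open>S\<close> below a vertex of \<open>T\<close>. Collecting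
  the result by the grafted tree \<open>U\<close>, the coefficient of \<open>\<P>\<^sub>U\<close> in \<open>A (\<Sum>\<^sub>T x\<^sub>T \<P>\<^sub>T)\<close> is the sum over the edges
  \<open>e\<close> of \<open>U\<close> of \<open>w\<close> at the branch beyond \<open>e\<close> times \<open>x\<close> at the rest (\<open>tree_sum_cut_conv\<close>). To keep the
  symmetry factors out of the way, this is proved for sums over all trees on a labelled vertex set,
  where an isomorphism class with \<open>N\<close> vertices is represented \<open>N! / \<alpha>\<^sub>T\<close> times
  (\<open>card_labelled_copies\<close>).

  Iterating, the coefficient of \<open>\<P>\<^sub>T\<close> in \<open>A\<^sup>k z\<close> is the sum over the cut sequences of length \<open>k - 1\<close> of
  the products of the values of \<open>\<phi>\<close> at the pieces (\<open>derivation_power_tree_log\<close>, \<open>sum_cut_seqs\<close>). The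
  recursion for \<open>\<phi>\<close> says precisely that these coefficients, weighted by \<open>1 / k!\<close>, add up to 1 for the
  tree with one vertex and to 0 for every other tree, so that \<open>exp A \<cdot> z = z + H\<close>
  (\<open>exp_tree_log\<close>). As a derivation of this kind is determined by its exponential
  (\<open>exp_derivation_inj\<close>), \<open>a\<close> is the D-Log, and \<open>exp (t A) \<cdot> z\<close> has the stated coefficients.

  The polynomials are unique because the tree series can be separated: for each tree there is a
  system \<open>H\<close> and a monomial at which one component of \<open>\<P>\<^sub>T\<close> has coefficient 1 for that tree and 0 for all trees not
  isomorphic to it (\<open>mcoeff_tree_series_tree_system\<close>).\<close>

section \<open>Reachability and acyclicity\<close>

abbreviation reach :: "'v set set \<Rightarrow> 'v \<Rightarrow> 'v \<Rightarrow> bool" where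
  "reach E x y \<equiv> (x, y) \<in> (adj E)\<^sup>*"

lemma adj_iff [simp]: "(x, y) \<in> adj E \<longleftrightarrow> {x, y} \<in> E"
  by (simp add: adj_def)

lemma reach_sym: "reach E x y \<Longrightarrow> reach E y x"
proof -
  have "sym (adj E)" by (simp add: sym_def insert_commute)
  then show "reach E x y \<Longrightarrow> reach E y x" by (meson sym_rtrancl symD)
qed

lemma reach_mono: "reach E x y \<Longrightarrow> E \<subseteq> F \<Longrightarrow> reach F x y"
  by (rule rtrancl_mono[THEN subsetD, of "adj E"]) auto

lemma reach_edge: "{x, y} \<in> E \<Longrightarrow> reach E x y"
  by (simp add: r_into_rtrancl)

lemma reach_step: "reach E x y \<Longrightarrow> {y, z} \<in> E \<Longrightarrow> reach E x z"
  by (meson adj_iff rtrancl.rtrancl_into_rtrancl)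

text \<open>Every edge is a bridge. Unlike the absence of cycles, this speaks of reachability alone, which is
  easy to track when edges are added or removed.\<close>

definition acyc :: "'v set set \<Rightarrow> bool" where
  "acyc E \<longleftrightarrow> (\<forall>x y. {x, y} \<in> E \<longrightarrow> \<not> reach (E - {{x, y}}) x y)"

lemma acyc_subset: "acyc E \<Longrightarrow> F \<subseteq> E \<Longrightarrow> acyc F"
  unfolding acyc_def by (meson Diff_mono order_refl reach_mono subsetD)

lemma simple_path_if_reach:
  assumes "reach E x y"
  obtains p where "p \<noteq> []" "hd p = x" "last p = y" "distinct p" "successively (\<lambda>u v. {u, v} \<in> E) p"
proof -
  have "\<exists>p. p \<noteq> [] \<and> hd p = x \<and> last p = y \<and> distinct p \<and> successively (\<lambda>u v. {u, v} \<in> E) p"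
    using assms
  proof (induction rule: converse_rtrancl_induct)
    case base
    show ?case by (rule exI[of _ "[y]"]) auto
  next
    case (step x z)
    then obtain p where p: "p \<noteq> []" "hd p = z" "last p = y" "distinct p"
      "successively (\<lambda>u v. {u, v} \<in> E) p" by blast
    show ?case
    proof (cases "x \<in> set p")
      case True
      then obtain as bs where "p = as @ x # bs" by (meson split_list)
      with p show ?thesis
        by (intro exI[of _ "x # bs"]) (auto simp: successively_append_iff)
    next
      case False
      with p step(1) show ?thesis
        by (intro exI[of _ "x # p"]) (auto simp: successively_Cons)
    qed
  qed
  then show thesis using that by blast
qed

lemma reach_if_successively:
  "successively (\<lambda>u v. {u, v} \<in> E) p \<Longrightarrow> p \<noteq> [] \<Longrightarrow> reach E (hd p) (last p)"
proof (induction p)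
  case (Cons a p)
  then show ?case
    by (cases p) (auto intro: converse_rtrancl_into_rtrancl)
qed auto

text \<open>A cycle minus its closing edge is a path between the ends of that edge. Conversely, a simple path
  between the ends of an edge that avoids the edge has at least three vertices and closes to a cycle.\<close>

lemma has_cycle_iff_not_acyc:
  assumes "\<forall>e\<in>E. card e = 2"
  shows "has_cycle E \<longleftrightarrow> \<not> acyc E"
proof
  assume "has_cycle E"
  then obtain c where c: "3 \<le> length c" "distinct c"
    "\<And>i. i < length c \<Longrightarrow> {c ! i, c ! ((i + 1) mod length c)} \<in> E"
    unfolding has_cycle_def by blast
  have ne: "c \<noteq> []" using c(1) by auto
  let ?x = "last c" and ?y = "hd c"
  have ends: "?x = c ! (length c - 1)" "?y = c ! 0"
    using ne by (auto simp: last_conv_nth hd_conv_nth)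
  have e: "{?x, ?y} \<in> E"
    using c(3)[of "length c - 1"] ne ends by simp
  have "successively (\<lambda>u v. {u, v} \<in> E - {{?x, ?y}}) c"
    unfolding successively_conv_nth
  proof (intro allI impI)
    fix i assume i: "Suc i < length c"
    have "{c ! i, c ! Suc i} \<in> E" using c(3)[of i] i by simp
    moreover have "{c ! i, c ! Suc i} \<noteq> {?x, ?y}"
    proof
      assume "{c ! i, c ! Suc i} = {?x, ?y}"
      then have "(c ! i = c ! (length c - 1) \<and> c ! Suc i = c ! 0) \<or>
        (c ! i = c ! 0 \<and> c ! Suc i = c ! (length c - 1))"
        unfolding ends doubleton_eq_iff .
      moreover have "c ! Suc i \<noteq> c ! 0"
        using c(2) i nth_eq_iff_index_eq[OF c(2), of "Suc i" 0] by fastforce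
      ultimately have "c ! i = c ! 0" "c ! Suc i = c ! (length c - 1)" by auto
      then have "i = 0" "Suc i = length c - 1"
        using c(1) ne i nth_eq_iff_index_eq[OF c(2), of i 0]
          nth_eq_iff_index_eq[OF c(2), of "Suc i" "length c - 1"] by auto
      then show False using c(1) by simp
    qed
    ultimately show "{c ! i, c ! Suc i} \<in> E - {{?x, ?y}}" by blast
  qed
  then have "reach (E - {{?x, ?y}}) ?y ?x" using ne by (rule reach_if_successively)
  then have "reach (E - {{?x, ?y}}) ?x ?y" by (rule reach_sym)
  then show "\<not> acyc E" using e unfolding acyc_def by blast
next
  assume "\<not> acyc E"
  then obtain x y where xy: "{x, y} \<in> E" "reach (E - {{x, y}}) x y"
    unfolding acyc_def by blast
  from xy(2) obtain c where c: "c \<noteq> []" "hd c = x" "last c = y" "distinct c"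
    "successively (\<lambda>u v. {u, v} \<in> E - {{x, y}}) c" by (rule simple_path_if_reach)
  have "card {x, y} = 2" using assms xy(1) by blast
  then have ne: "x \<noteq> y" by auto
  have "length c \<noteq> Suc 0"
  proof
    assume "length c = Suc 0"
    then obtain a where "c = [a]" by (auto simp: length_Suc_conv)
    then show False using c ne by auto
  qed
  moreover have "length c \<noteq> Suc (Suc 0)"
  proof
    assume "length c = Suc (Suc 0)"
    then obtain a b where "c = [a, b]" by (auto simp: length_Suc_conv)
    then show False using c by auto
  qed
  ultimately have len: "3 \<le> length c" using c(1) by (simp add: numeral_3_eq_3 Suc_le_eq nat_neq_iff)
  have "{c ! i, c ! ((i + 1) mod length c)} \<in> E" if i: "i < length c" for i
  proof (cases "Suc i < length c")
    case True
    then show ?thesis using c(5) unfolding successively_conv_nth by auto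
  next
    case False
    then have "i = length c - 1" using i by simp
    then have "c ! i = y" "(i + 1) mod length c = 0" "c ! 0 = x"
      using c(1-3) by (auto simp: last_conv_nth hd_conv_nth)
    then show ?thesis using xy(1) by (simp add: insert_commute)
  qed
  then show "has_cycle E" unfolding has_cycle_def using len c(4) by blast
qed

lemma rooted_tree_iff:
  "rooted_tree T \<longleftrightarrow> finite (verts T) \<and> rt T \<in> verts T
     \<and> (\<forall>e\<in>edges T. e \<subseteq> verts T \<and> card e = 2)
     \<and> (\<forall>v\<in>verts T. reach (edges T) (rt T) v) \<and> acyc (edges T)"
proof -
  have "(\<forall>u\<in>verts T. \<forall>v\<in>verts T. reach (edges T) u v) \<longleftrightarrow> (\<forall>v\<in>verts T. reach (edges T) (rt T) v)"
    if "rt T \<in> verts T" using that by (meson reach_sym rtrancl_trans)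
  moreover have "(\<forall>e\<in>edges T. e \<subseteq> verts T \<and> card e = 2) \<Longrightarrow> \<not> has_cycle (edges T) \<longleftrightarrow> acyc (edges T)"
    using has_cycle_iff_not_acyc[of "edges T"] by blast
  ultimately show ?thesis unfolding rooted_tree_def by meson
qed

lemma rooted_treeD:
  assumes "rooted_tree T"
  shows "finite (verts T)" "rt T \<in> verts T" "\<And>e. e \<in> edges T \<Longrightarrow> e \<subseteq> verts T"
    "\<And>e. e \<in> edges T \<Longrightarrow> card e = 2" "\<And>v. v \<in> verts T \<Longrightarrow> reach (edges T) (rt T) v"
    "acyc (edges T)" "finite (edges T)"
proof -
  show "finite (verts T)" "rt T \<in> verts T" "\<And>e. e \<in> edges T \<Longrightarrow> e \<subseteq> verts T"
    "\<And>e. e \<in> edges T \<Longrightarrow> card e = 2" "\<And>v. v \<in> verts T \<Longrightarrow> reach (edges T) (rt T) v"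
    "acyc (edges T)" using assms by (auto simp: rooted_tree_iff)
  then show "finite (edges T)" by (meson Pow_iff finite_Pow_iff finite_subset subsetI)
qed

lemma reach_in:
  assumes "reach E x y" "\<Union>E \<subseteq> A" "x \<in> A" shows "y \<in> A"
  using assms by (induction rule: rtrancl_induct) auto

section \<open>Grafting and cutting\<close>

text \<open>The inverse of cutting an edge, see \<open>graft_parts\<close> below.\<close>

definition graft :: "'v rgraph \<Rightarrow> 'v rgraph \<Rightarrow> 'v \<Rightarrow> 'v rgraph" where
  "graft T S v = RGraph (verts T \<union> verts S) (insert {v, rt S} (edges T \<union> edges S)) (rt T)"

lemma graft_simps [simp]:
  "verts (graft T S v) = verts T \<union> verts S"
  "edges (graft T S v) = insert {v, rt S} (edges T \<union> edges S)"
  "rt (graft T S v) = rt T"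
  by (simp_all add: graft_def)

text \<open>A walk that leaves \<open>A\<close> through the only bridge to \<open>B\<close> can come back only through that
  bridge, so the excursion can be dropped.\<close>

lemma reach_bridge:
  assumes "reach (insert {v, s} (F \<union> G)) x y" "x \<in> A" "\<Union>F \<subseteq> A" "\<Union>G \<subseteq> B" "A \<inter> B = {}"
    "v \<in> A" "s \<in> B"
  shows "(y \<in> A \<and> reach F x y) \<or> (y \<in> B \<and> reach F x v)"
  using assms(1)
proof (induction rule: rtrancl_induct)
  case base
  then show ?case using assms by auto
next
  case (step y z)
  from step(2) consider "{y, z} = {v, s}" | "{y, z} \<in> F" | "{y, z} \<in> G" by auto
  then show ?case
  proof cases
    case 1
    then have "(y = v \<and> z = s) \<or> (y = s \<and> z = v)" by (auto simp: doubleton_eq_iff)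
    then show ?thesis using step(3) assms by auto
  next
    case 2
    then have "y \<in> A" "z \<in> A" using assms by auto
    then show ?thesis using 2 step(3) assms(5) reach_step[of x y F z] by auto
  next
    case 3
    then have "y \<in> B" "z \<in> B" using assms by auto
    then show ?thesis using 3 step(3) assms(5) by auto
  qed
qed

lemma reach_disjoint:
  assumes "reach (F \<union> G) x y" "x \<in> A" "\<Union>F \<subseteq> A" "\<Union>G \<subseteq> B" "A \<inter> B = {}"
  shows "y \<in> A \<and> reach F x y"
  using assms(1)
proof (induction rule: rtrancl_induct)
  case base
  then show ?case using assms by auto
next
  case (step y z)
  from step(2) consider "{y, z} \<in> F" | "{y, z} \<in> G" by auto
  then show ?case using step(3) assms reach_step[of x y F z] by cases blast+
qed

locale graftable =
  fixes T S :: "'v rgraph" and v :: 'v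
  assumes T: "rooted_tree T" and S: "rooted_tree S" and disj: "verts T \<inter> verts S = {}"
    and v: "v \<in> verts T"
begin

lemma ET: "\<Union>(edges T) \<subseteq> verts T" and ES: "\<Union>(edges S) \<subseteq> verts S"
  using rooted_treeD(3)[OF T] rooted_treeD(3)[OF S] by auto

lemma rtT: "rt T \<in> verts T" and rtS: "rt S \<in> verts S"
  using T S by (auto simp: rooted_tree_iff)

lemma new_edge: "{v, rt S} \<notin> edges T" "{v, rt S} \<notin> edges S" "{v, rt S} \<notin> edges T \<union> edges S"
  using ET ES disj v rtS by auto

lemma reach_from_T:
  assumes "reach (insert {v, rt S} (F \<union> edges S)) x y" "F \<subseteq> edges T" "x \<in> verts T"
  shows "(y \<in> verts T \<and> reach F x y) \<or> (y \<in> verts S \<and> reach F x v)"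
  using assms ET ES disj v rtS
  by (intro reach_bridge[of x y v "rt S" F "edges S"]) blast+

lemma reach_from_S:
  assumes "reach (insert {v, rt S} (edges T \<union> G)) x y" "G \<subseteq> edges S" "x \<in> verts S"
  shows "(y \<in> verts S \<and> reach G x y) \<or> (y \<in> verts T \<and> reach G x (rt S))"
proof -
  have "insert {v, rt S} (edges T \<union> G) = insert {rt S, v} (G \<union> edges T)" by auto
  then have "reach (insert {rt S, v} (G \<union> edges T)) x y" using assms(1) by simp
  then show ?thesis using assms(2,3) ET ES disj v rtS
    by (intro reach_bridge[of x y "rt S" v G "edges T"]) blast+
qed

lemma rooted_tree_graft: "rooted_tree (graft T S v)"
proof -
  note TD = rooted_treeD[OF T] and SD = rooted_treeD[OF S]
  have "card {v, rt S} = 2" using v rtS disj by (auto simp: card_insert_if)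
  moreover have "reach (edges (graft T S v)) (rt T) u" if u: "u \<in> verts T \<union> verts S" for u
  proof (cases "u \<in> verts T")
    case True
    then show ?thesis using TD(5) by (auto intro: reach_mono)
  next
    case False
    then have "reach (edges S) (rt S) u" using u SD(5) by auto
    then have "reach (edges (graft T S v)) (rt S) u" by (rule reach_mono) auto
    moreover have "reach (edges (graft T S v)) (rt T) v"
      by (rule reach_mono[OF TD(5)[OF v]]) auto
    moreover have "reach (edges (graft T S v)) v (rt S)" by (rule reach_edge) auto
    ultimately show ?thesis by (meson rtrancl_trans)
  qed
  moreover have "acyc (edges (graft T S v))"
    unfolding acyc_def
  proof (intro allI impI notI)
    fix x y assume e: "{x, y} \<in> edges (graft T S v)"
      and r: "reach (edges (graft T S v) - {{x, y}}) x y"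
    from e consider "{x, y} = {v, rt S}" | "{x, y} \<in> edges T" | "{x, y} \<in> edges S" by auto
    then show False
    proof cases
      case 1
      then have "edges (graft T S v) - {{x, y}} = edges T \<union> edges S" using new_edge by auto
      then have "reach (edges T \<union> edges S) x y" using r by simp
      then have "reach (edges T \<union> edges S) v (rt S)"
        using 1 by (auto simp: doubleton_eq_iff intro: reach_sym)
      then show False using reach_disjoint[of _ _ "edges T" "edges S", OF _ v ET ES disj, of "rt S"] disj rtS by auto
    next
      case 2
      have "edges (graft T S v) - {{x, y}} \<subseteq> insert {v, rt S} ((edges T - {{x, y}}) \<union> edges S)"
        by auto
      then have r': "reach (insert {v, rt S} ((edges T - {{x, y}}) \<union> edges S)) x y"
        using r reach_mono by metis
      have "x \<in> verts T" "y \<in> verts T" using 2 ET by auto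
      then have "reach (edges T - {{x, y}}) x y"
        using reach_from_T[OF r'] disj by auto
      then show False using TD(6) 2 unfolding acyc_def by blast
    next
      case 3
      have "edges (graft T S v) - {{x, y}} \<subseteq> insert {v, rt S} (edges T \<union> (edges S - {{x, y}}))"
        by auto
      then have r': "reach (insert {v, rt S} (edges T \<union> (edges S - {{x, y}}))) x y"
        using r reach_mono by metis
      have "x \<in> verts S" "y \<in> verts S" using 3 ES by auto
      then have "reach (edges S - {{x, y}}) x y"
        using reach_from_S[OF r'] disj by auto
      then show False using SD(6) 3 unfolding acyc_def by blast
    qed
  qed
  moreover have "e \<subseteq> verts T \<union> verts S" "card e = 2" if "e \<in> edges (graft T S v)" for e
    using that TD(3,4) SD(3,4) v rtS calculation(1) by auto
  ultimately show ?thesis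
    unfolding rooted_tree_iff using TD(1,2) SD(1) by simp
qed

end

text \<open>A walk from the root to the far end of a bridge has visited the near end before.\<close>

lemma depth_less:
  assumes "reach (E - {{x, y}}) r x" "\<not> reach (E - {{x, y}}) r y" "reach E r y"
  shows "depth (RGraph V E r) x < depth (RGraph V E r) y"
proof -
  have *: "\<exists>j<k. (r, x) \<in> adj E ^^ j" if "(r, z) \<in> adj E ^^ k" "\<not> reach (E - {{x, y}}) r z" for z k
    using that
  proof (induction k arbitrary: z)
    case (Suc k)
    then obtain u where u: "(r, u) \<in> adj E ^^ k" "{u, z} \<in> E" by auto
    show ?case
    proof (cases "reach (E - {{x, y}}) r u")
      case True
      have "{u, z} = {x, y}"
      proof (rule ccontr)
        assume "{u, z} \<noteq> {x, y}"
        then have "{u, z} \<in> E - {{x, y}}" using u(2) by auto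
        then show False using reach_step[OF True] Suc.prems(2) by blast
      qed
      then have "u = x" using True assms(2) by (auto simp: doubleton_eq_iff)
      then show ?thesis using u(1) by blast
    next
      case False
      then show ?thesis using Suc.IH[OF u(1)] by (meson less_SucI)
    qed
  qed auto
  obtain k where "(r, y) \<in> adj E ^^ k" using assms(3) by (auto simp: rtrancl_power)
  then have "(r, y) \<in> adj E ^^ depth (RGraph V E r) y"
    unfolding depth_def by (simp only: rgraph.sel) (rule LeastI)
  from *[OF this assms(2)] obtain j where "j < depth (RGraph V E r) y" "(r, x) \<in> adj E ^^ j" by blast
  then show ?thesis unfolding depth_def by (auto intro: le_less_trans Least_le)
qed

lemma far_end_eq:
  assumes "depth T x < depth T y" shows "far_end T {x, y} = y"
  unfolding far_end_def arg_max_def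
  by (rule some_equality) (use assms in \<open>auto simp: is_arg_max_def\<close>)

lemma rgraph_collapse: "RGraph (verts T) (edges T) (rt T) = T"
  by (cases T) auto

context graftable
begin

lemma component_T: "component (edges T \<union> edges S) (rt T) = T"
proof -
  have "{y. reach (edges T \<union> edges S) (rt T) y} = verts T"
    using reach_disjoint[of _ _ "edges T" "edges S", OF _ rtT ET ES disj] rooted_treeD(5)[OF T]
    by (auto intro: reach_mono)
  moreover have "{d \<in> edges T \<union> edges S. d \<subseteq> verts T} = edges T"
    using rooted_treeD[OF T] rooted_treeD[OF S] disj
    by (auto; metis card.empty disjoint_iff empty_subsetI subset_antisym subset_iff zero_neq_numeral)
  ultimately show ?thesis by (simp add: component_def Let_def rgraph_collapse)
qed

lemma component_S: "component (edges T \<union> edges S) (rt S) = S"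
proof -
  have "{y. reach (edges S \<union> edges T) (rt S) y} = verts S"
    using reach_disjoint[of _ _ "edges S" "edges T", OF _ rtS ES ET] rooted_treeD(5)[OF S] disj
    by (auto intro: reach_mono)
  moreover have "{d \<in> edges S \<union> edges T. d \<subseteq> verts S} = edges S"
    using rooted_treeD[OF T] rooted_treeD[OF S] disj
    by (auto; metis card.empty disjoint_iff empty_subsetI subset_antisym subset_iff zero_neq_numeral)
  ultimately show ?thesis by (simp add: component_def Let_def rgraph_collapse Un_commute)
qed

lemma cut_graft: "edges (graft T S v) - {{v, rt S}} = edges T \<union> edges S"
  using new_edge by auto

lemma root_part_graft: "root_part (graft T S v) {v, rt S} = T"
  unfolding root_part_def cut_graft using component_T by simp

lemma branch_part_graft: "branch_part (graft T S v) {v, rt S} = S"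
proof -
  have "reach (edges T \<union> edges S) (rt T) v"
    using rooted_treeD(5)[OF T v] by (rule reach_mono) auto
  moreover have "\<not> reach (edges T \<union> edges S) (rt T) (rt S)"
    using reach_disjoint[of _ _ "edges T" "edges S", OF _ rtT ET ES disj] rtS disj by auto
  moreover have "reach (edges (graft T S v)) (rt T) (rt S)"
    using rooted_treeD(5)[OF rooted_tree_graft] rtS by simp
  ultimately have "depth (graft T S v) v < depth (graft T S v) (rt S)"
    using depth_less[of "rt T" v "edges (graft T S v)" "rt S" "verts (graft T S v)"]
    unfolding cut_graft by (simp add: graft_def)
  then show ?thesis
    unfolding branch_part_def by (simp only: far_end_eq cut_graft component_S)
qed

end

lemma rooted_tree_component:
  assumes T: "rooted_tree T" and "F \<subseteq> edges T" "x \<in> verts T"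
  shows "rooted_tree (component F x)"
proof -
  note TD = rooted_treeD[OF T]
  let ?C = "{y. reach F x y}"
  have "\<Union>F \<subseteq> verts T" using assms TD(3) by blast
  then have C: "?C \<subseteq> verts T" using reach_in[of x _ F "verts T"] assms by blast
  have "reach {d \<in> F. d \<subseteq> ?C} x y" if "reach F x y" for y
    using that
  proof (induction rule: rtrancl_induct)
    case (step y z)
    have "{y, z} \<in> {d \<in> F. d \<subseteq> ?C}" using step(1,2) reach_step[of x y F z] by auto
    then show ?case using reach_step[OF step(3)] by blast
  qed auto
  moreover have "acyc {d \<in> F. d \<subseteq> ?C}"
    by (rule acyc_subset[OF TD(6)]) (use assms in auto)
  ultimately show ?thesis
    unfolding rooted_tree_iff component_def Let_def using TD C assms
    by (auto intro: finite_subset)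
qed

text \<open>Every edge of a tree arises by grafting the branch beyond it onto the rest. All properties
  of cut trees are obtained from this.\<close>

lemma graft_parts:
  assumes T: "rooted_tree T" and e: "e \<in> edges T"
  obtains v where "graftable (root_part T e) (branch_part T e) v"
    "T = graft (root_part T e) (branch_part T e) v" "e = {v, rt (branch_part T e)}"
proof -
  note TD = rooted_treeD[OF T]
  let ?r = "rt T" and ?F = "edges T - {e}"
  obtain p q where pq: "e = {p, q}" using TD(4)[OF e] by (meson card_2_iff)
  have br: "\<not> reach ?F p q" using TD(6) e pq unfolding acyc_def by blast
  have cov: "reach ?F ?r u \<or> reach ?F p u \<or> reach ?F q u" if "reach (edges T) ?r u" for u
    using that
  proof (induction rule: rtrancl_induct)
    case (step y z)
    show ?case
    proof (cases "{y, z} = e")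
      case True
      then have "z = p \<or> z = q" by (auto simp: pq doubleton_eq_iff)
      then show ?thesis by auto
    next
      case False
      then have "{y, z} \<in> ?F" using step(2) by auto
      then show ?thesis using step(3) reach_step[of _ _ ?F] by blast
    qed
  qed auto
  have "reach ?F ?r p \<or> reach ?F ?r q"
  proof (rule ccontr)
    assume n: "\<not> (reach ?F ?r p \<or> reach ?F ?r q)"
    have "reach ?F ?r u" if "reach (edges T) ?r u" for u using that
    proof (induction rule: rtrancl_induct)
      case (step y z)
      have "{y, z} \<noteq> e" using n step(3) by (auto simp: pq doubleton_eq_iff)
      then show ?case using step reach_step[of ?r y ?F z] by auto
    qed auto
    moreover have "p \<in> verts T" using TD(3)[OF e] pq by auto
    ultimately show False using n TD(5) by blast
  qed
  \<comment> \<open>orient the edge: \<open>x\<close> is the end on the side of the root\<close>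
  then obtain x y where xy: "e = {x, y}" "reach ?F ?r x" "\<not> reach ?F x y"
  proof
    assume "reach ?F ?r p" then show thesis using that[of p q] pq br by auto
  next
    assume "reach ?F ?r q" moreover have "\<not> reach ?F q p" using br reach_sym by metis
    ultimately show thesis using that[of q p] pq by (simp add: insert_commute)
  qed
  have xV: "x \<in> verts T" and yV: "y \<in> verts T" using TD(3)[OF e] xy(1) by auto
  have ny: "\<not> reach ?F ?r y" using xy reach_sym rtrancl_trans by metis
  have "depth T x < depth T y"
    using depth_less[of ?r x "edges T" y "verts T"] xy ny TD(5)[OF yV] by (simp add: rgraph_collapse)
  then have fe: "far_end T e = y" using xy(1) far_end_eq by metis
  let ?R = "root_part T e" and ?B = "branch_part T e"
  have vR: "verts ?R = {u. reach ?F ?r u}" "rt ?R = ?r"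
    and eR: "edges ?R = {d \<in> ?F. d \<subseteq> {u. reach ?F ?r u}}"
    and vB: "verts ?B = {u. reach ?F y u}" "rt ?B = y"
    and eB: "edges ?B = {d \<in> ?F. d \<subseteq> {u. reach ?F y u}}"
    by (simp_all add: root_part_def branch_part_def component_def Let_def fe)
  have R: "rooted_tree ?R" and B: "rooted_tree ?B"
    unfolding root_part_def branch_part_def fe
    by (rule rooted_tree_component[OF T]; use TD(2) yV in auto)+
  have disj: "verts ?R \<inter> verts ?B = {}"
    unfolding vR vB using ny reach_sym[of y _ ?F] by (auto dest: rtrancl_trans)
  have pqxy: "(p = x \<and> q = y) \<or> (p = y \<and> q = x)" using pq xy(1) by (auto simp: doubleton_eq_iff)
  have cov': "reach ?F ?r u \<or> reach ?F y u" if "u \<in> verts T" for u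
    using cov[OF TD(5)[OF that]] pqxy xy(2) rtrancl_trans by metis
  have U: "\<Union>?F \<subseteq> verts T" using TD(3) by blast
  have V: "verts T = verts ?R \<union> verts ?B"
    unfolding vR vB using cov' reach_in[OF _ U TD(2)] reach_in[OF _ U yV] by blast
  have "?F \<subseteq> edges ?R \<union> edges ?B"
  proof
    fix d assume d: "d \<in> ?F"
    then obtain a b where ab: "d = {a, b}" using TD(4) by (meson DiffD1 card_2_iff)
    then have "a \<in> verts T" using d TD(3) by blast
    from cov'[OF this] show "d \<in> edges ?R \<union> edges ?B"
    proof
      assume r: "reach ?F ?r a"
      then have "reach ?F ?r b" using d ab reach_step by metis
      then show ?thesis using r d ab eR by auto
    next
      assume r: "reach ?F y a"
      then have "reach ?F y b" using d ab reach_step by metis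
      then show ?thesis using r d ab eB by auto
    qed
  qed
  then have E: "edges T = insert {x, y} (edges ?R \<union> edges ?B)"
    using e eR eB xy(1) by auto
  have gr: "T = graft ?R ?B x"
    by (rule rgraph.expand) (simp add: V[symmetric] E vR(2) vB(2))
  have "graftable ?R ?B x"
    by unfold_locales (use R B disj xy vR in auto)
  then show thesis using gr xy(1) unfolding vB(2)[symmetric] by (rule that)
qed

lemma rooted_tree_no_edges:
  assumes "rooted_tree T" "edges T = {}" shows "verts T = {rt T}"
proof -
  have "v = rt T" if "v \<in> verts T" for v
    using rooted_treeD(5)[OF assms(1) that] assms(2) by (simp add: adj_def)
  then show ?thesis using rooted_treeD(2)[OF assms(1)] by blast
qed

text \<open>Since both parts of a cut tree are trees with fewer edges, properties of trees can be proved by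
  following the construction by grafting, without any argument about walks.\<close>

lemma rooted_tree_induct [consumes 1, case_names single graft]:
  assumes "rooted_tree T"
    and single: "\<And>x. P (RGraph {x} {} x)"
    and graft: "\<And>T S v. graftable T S v \<Longrightarrow> P T \<Longrightarrow> P S \<Longrightarrow> P (graft T S v)"
  shows "P T"
  using assms(1)
proof (induction "card (edges T)" arbitrary: T rule: less_induct)
  case less
  show ?case
  proof (cases "edges T = {}")
    case True
    then have "T = RGraph {rt T} {} (rt T)"
      using rooted_tree_no_edges[OF less.prems] by (metis rgraph_collapse)
    then show ?thesis using single by metis
  next
    case False
    then obtain e where e: "e \<in> edges T" by auto
    from graft_parts[OF less.prems e] obtain v where gv: "graftable (root_part T e) (branch_part T e) v"
      "T = graft (root_part T e) (branch_part T e) v" "e = {v, rt (branch_part T e)}" .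
    interpret graftable "root_part T e" "branch_part T e" v by fact
    have "edges T = insert e (edges (root_part T e) \<union> edges (branch_part T e))"
      using arg_cong[OF gv(2), of edges] gv(3) by simp
    then have "edges (root_part T e) \<union> edges (branch_part T e) \<subset> edges T"
      using new_edge(3) gv(3) by blast
    then have "card (edges (root_part T e)) < card (edges T)" "card (edges (branch_part T e)) < card (edges T)"
      using rooted_treeD(7)[OF less.prems] by (auto intro!: psubset_card_mono)
    then have "P (root_part T e)" "P (branch_part T e)" using less.hyps T S by blast+
    then show ?thesis by (subst gv(2)) (rule graft[OF gv(1)])
  qed
qed

text \<open>The children in terms of reachability instead of depth: cutting the edge to a child leaves the
  parent on the side of the root.\<close>

lemma children_iff:
  assumes "rooted_tree T"
  shows "w \<in> children T u \<longleftrightarrow> {u, w} \<in> edges T \<and> reach (edges T - {{u, w}}) (rt T) u"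
proof (cases "{u, w} \<in> edges T")
  case True
  note TD = rooted_treeD[OF assms]
  have V: "u \<in> verts T" "w \<in> verts T" using True TD(3) by auto
  have br: "\<not> reach (edges T - {{u, w}}) u w" using True TD(6) unfolding acyc_def by blast
  show ?thesis
  proof (cases "reach (edges T - {{u, w}}) (rt T) u")
    case r: True
    have "\<not> reach (edges T - {{u, w}}) (rt T) w"
      using r br reach_sym rtrancl_trans by metis
    then have "depth T u < depth T w"
      using depth_less[of "rt T" u "edges T" w "verts T"] r TD(5)[OF V(2)] by (simp add: rgraph_collapse)
    then show ?thesis using True r V by (simp add: children_def)
  next
    case r: False
    from graft_parts[OF assms True] obtain v where v: "graftable (root_part T {u, w}) (branch_part T {u, w}) v"
      "T = graft (root_part T {u, w}) (branch_part T {u, w}) v" "{u, w} = {v, rt (branch_part T {u, w})}" .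
    have rv: "reach (edges T - {{u, w}}) (rt T) v"
      using graftable.v[OF v(1)] by (simp add: root_part_def component_def Let_def)
    then have "w = v" using r v(3) by (auto simp: doubleton_eq_iff)
    then have rw: "reach (edges T - {{w, u}}) (rt T) w" using rv by (simp add: insert_commute)
    moreover have "\<not> reach (edges T - {{w, u}}) (rt T) u" using r by (simp add: insert_commute)
    ultimately have "depth T w < depth T u"
      using depth_less[of "rt T" w "edges T" u "verts T"] TD(5)[OF V(1)] by (simp add: rgraph_collapse)
    then show ?thesis using r by (simp add: children_def)
  qed
qed (simp add: children_def)

context graftable
begin

lemma children_graft_T:
  assumes u: "u \<in> verts T"
  shows "children (graft T S v) u = (if u = v then insert (rt S) (children T u) else children T u)"
proof -
  let ?G = "graft T S v"
  have "w \<in> children ?G u \<longleftrightarrow> (u = v \<and> w = rt S) \<or> w \<in> children T u" for w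
  proof -
    have uS: "u \<notin> verts S" using u disj by auto
    have "w \<in> children ?G u \<longleftrightarrow> {u, w} \<in> edges ?G \<and> reach (edges ?G - {{u, w}}) (rt T) u"
      using children_iff[OF rooted_tree_graft] by simp
    moreover have "{u, w} \<in> edges ?G \<longleftrightarrow> {u, w} = {v, rt S} \<or> {u, w} \<in> edges T"
      using uS ES by auto
    moreover have "{u, w} = {v, rt S} \<longleftrightarrow> u = v \<and> w = rt S"
      using uS rtS by (auto simp: doubleton_eq_iff)
    moreover have "reach (edges ?G - {{u, w}}) (rt T) u" if "u = v" "w = rt S"
      unfolding that
      unfolding cut_graft using rooted_treeD(5)[OF T v] by (rule reach_mono) auto
    moreover have "reach (edges ?G - {{u, w}}) (rt T) u \<longleftrightarrow> reach (edges T - {{u, w}}) (rt T) u"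
      if "{u, w} \<in> edges T"
    proof
      assume "reach (edges ?G - {{u, w}}) (rt T) u"
      then have "reach (insert {v, rt S} ((edges T - {{u, w}}) \<union> edges S)) (rt T) u"
        by (rule reach_mono) auto
      from reach_from_T[OF this _ rtT] show "reach (edges T - {{u, w}}) (rt T) u" using uS by auto
    next
      assume "reach (edges T - {{u, w}}) (rt T) u"
      then show "reach (edges ?G - {{u, w}}) (rt T) u" by (rule reach_mono) auto
    qed
    ultimately show ?thesis unfolding children_iff[OF T, of w u] by argo
  qed
  then show ?thesis by auto
qed

lemma children_graft_S:
  assumes u: "u \<in> verts S" shows "children (graft T S v) u = children S u"
proof -
  let ?G = "graft T S v"
  have "w \<in> children ?G u \<longleftrightarrow> w \<in> children S u" for w
  proof -
    have uT: "u \<notin> verts T" using u disj by auto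
    have "w \<in> children ?G u \<longleftrightarrow> {u, w} \<in> edges ?G \<and> reach (edges ?G - {{u, w}}) (rt T) u"
      using children_iff[OF rooted_tree_graft] by simp
    moreover have "{u, w} \<in> edges ?G \<longleftrightarrow> {u, w} = {v, rt S} \<or> {u, w} \<in> edges S"
      using uT ET by auto
    moreover have False if "{u, w} = {v, rt S}" "reach (edges ?G - {{u, w}}) (rt T) u"
      using that(2) reach_disjoint[of _ _ "edges T" "edges S", OF _ rtT ET ES disj, of u] uT
      unfolding that(1) cut_graft by auto
    moreover have "reach (edges ?G - {{u, w}}) (rt T) u \<longleftrightarrow> reach (edges S - {{u, w}}) (rt S) u"
      if e: "{u, w} \<in> edges S"
    proof
      assume "reach (edges ?G - {{u, w}}) (rt T) u"
      then have "reach (insert {v, rt S} (edges T \<union> (edges S - {{u, w}}))) (rt T) u"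
        by (rule reach_mono) auto
      from reach_from_S[OF reach_sym[OF this] _ u] show "reach (edges S - {{u, w}}) (rt S) u"
        using rtT disj reach_sym[of u "rt S"] by auto
    next
      assume "reach (edges S - {{u, w}}) (rt S) u"
      then have r: "reach (edges ?G - {{u, w}}) (rt S) u" by (rule reach_mono) auto
      have "edges T \<subseteq> edges ?G - {{u, w}}" using uT ET by auto
      then have "reach (edges ?G - {{u, w}}) (rt T) v"
        using rooted_treeD(5)[OF T v] reach_mono[of "rt T" v "edges T"] by simp
      moreover have "{v, rt S} \<in> edges ?G - {{u, w}}" using e new_edge by auto
      ultimately have "reach (edges ?G - {{u, w}}) (rt T) (rt S)" by (rule reach_step)
      then show "reach (edges ?G - {{u, w}}) (rt T) u" using r by (rule rtrancl_trans)
    qed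
    ultimately show ?thesis unfolding children_iff[OF S, of w u] by argo
  qed
  then show ?thesis by auto
qed

end

section \<open>Relabelling and isomorphism\<close>

definition map_graph :: "('v \<Rightarrow> 'w) \<Rightarrow> 'v rgraph \<Rightarrow> 'w rgraph" where
  "map_graph g T = RGraph (g ` verts T) ((`) g ` edges T) (g (rt T))"

lemma map_graph_simps [simp]:
  "verts (map_graph g T) = g ` verts T"
  "edges (map_graph g T) = (`) g ` edges T"
  "rt (map_graph g T) = g (rt T)"
  by (simp_all add: map_graph_def)

lemma map_graph_graft:
  "map_graph g (graft T S v) = graft (map_graph g T) (map_graph g S) (g v)"
  by (simp add: map_graph_def graft_def image_Un)

lemma graftable_map_graph:
  assumes "graftable T S v" "inj_on g (verts T \<union> verts S)"
    "rooted_tree (map_graph g T)" "rooted_tree (map_graph g S)"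
  shows "graftable (map_graph g T) (map_graph g S) (g v)"
proof -
  interpret graftable T S v by fact
  have "g ` verts T \<inter> g ` verts S = {}"
    using inj_on_image_Int[OF assms(2), of "verts T" "verts S"] disj by simp
  then show ?thesis by unfold_locales (use assms v in auto)
qed

text \<open>Relabelling commutes with grafting, so this and the following invariance properties need no
  inspection of walks in the relabelled graph.\<close>

lemma rooted_tree_map_graph:
  "rooted_tree T \<Longrightarrow> inj_on g (verts T) \<Longrightarrow> rooted_tree (map_graph g T)"
proof (induction rule: rooted_tree_induct)
  case (single x)
  then show ?case by (simp add: map_graph_def rooted_tree_singleton)
next
  case (graft T S v)
  have "graftable (map_graph g T) (map_graph g S) (g v)"
    by (rule graftable_map_graph) (use graft in \<open>auto simp: inj_on_Un\<close>)
  then show ?case unfolding map_graph_graft by (rule graftable.rooted_tree_graft)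
qed

lemma children_subset: "children T u \<subseteq> verts T"
  by (auto simp: children_def)

lemma children_single: "children (RGraph {x} {} y) u = {}"
  by (auto simp: children_def)

lemma children_map_graph:
  "rooted_tree T \<Longrightarrow> inj_on g (verts T) \<Longrightarrow> u \<in> verts T \<Longrightarrow>
    children (map_graph g T) (g u) = g ` children T u"
proof (induction arbitrary: u rule: rooted_tree_induct)
  case (single x)
  then show ?case by (simp add: map_graph_def children_single)
next
  case (graft T S v)
  interpret graftable T S v by fact
  have inj: "inj_on g (verts T)" "inj_on g (verts S)" "inj_on g (verts T \<union> verts S)"
    using graft.prems(1) by (auto simp: inj_on_Un)
  interpret M: graftable "map_graph g T" "map_graph g S" "g v"
    by (rule graftable_map_graph[OF graft.hyps(1) inj(3)]) (use inj T S rooted_tree_map_graph in auto)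
  show ?case
  proof (cases "u \<in> verts T")
    case True
    then have "g u = g v \<longleftrightarrow> u = v" using inj(1) v by (auto simp: inj_on_def)
    then show ?thesis
      unfolding map_graph_graft using True graft.IH(1)[OF inj(1) True]
      by (auto simp add: M.children_graft_T children_graft_T)
  next
    case False
    then have "u \<in> verts S" using graft.prems by auto
    then show ?thesis
      unfolding map_graph_graft using graft.IH(2)[OF inj(2)]
      by (simp add: M.children_graft_S children_graft_S)
  qed
qed

lemma
  assumes "rooted_tree T" "inj_on g (verts T)" "e \<in> edges T"
  shows root_part_map_graph: "root_part (map_graph g T) (g ` e) = map_graph g (root_part T e)"
    and branch_part_map_graph: "branch_part (map_graph g T) (g ` e) = map_graph g (branch_part T e)"
proof -
  let ?R = "root_part T e" and ?B = "branch_part T e"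
  from graft_parts[OF assms(1,3)] obtain v where gv: "graftable ?R ?B v" "T = graft ?R ?B v"
    "e = {v, rt ?B}" .
  interpret graftable ?R ?B v by fact
  have V: "verts T = verts ?R \<union> verts ?B" using arg_cong[OF gv(2), of verts] by simp
  have inj: "inj_on g (verts ?R \<union> verts ?B)" using assms(2) unfolding V .
  interpret M: graftable "map_graph g ?R" "map_graph g ?B" "g v"
    by (rule graftable_map_graph[OF gv(1) inj])
      (use inj T S rooted_tree_map_graph in \<open>auto simp: inj_on_Un\<close>)
  have M: "map_graph g T = graft (map_graph g ?R) (map_graph g ?B) (g v)"
    using arg_cong[OF gv(2), of "map_graph g"] unfolding map_graph_graft .
  have e: "g ` e = {g v, rt (map_graph g ?B)}" using arg_cong[OF gv(3), of "(`) g"] by simp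
  show "root_part (map_graph g T) (g ` e) = map_graph g ?R"
    unfolding M e by (rule M.root_part_graft)
  show "branch_part (map_graph g T) (g ` e) = map_graph g ?B"
    unfolding M e by (rule M.branch_part_graft)
qed

lemma
  assumes "rooted_tree T" "e \<in> edges T"
  shows rooted_tree_root_part: "rooted_tree (root_part T e)"
    and rooted_tree_branch_part: "rooted_tree (branch_part T e)"
    and verts_parts: "verts T = verts (root_part T e) \<union> verts (branch_part T e)"
    and card_root_part_less: "card (verts (root_part T e)) < card (verts T)"
    and card_branch_part_less: "card (verts (branch_part T e)) < card (verts T)"
proof -
  let ?R = "root_part T e" and ?B = "branch_part T e"
  from graft_parts[OF assms] obtain v where gv: "graftable ?R ?B v" "T = graft ?R ?B v"
    "e = {v, rt ?B}" .
  interpret graftable ?R ?B v by fact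
  show V: "verts T = verts ?R \<union> verts ?B" using arg_cong[OF gv(2), of verts] by simp
  show "rooted_tree ?R" "rooted_tree ?B" by (fact T S)+
  have "verts ?R \<subset> verts T" "verts ?B \<subset> verts T" using V disj rtS rtT by auto
  then show "card (verts ?R) < card (verts T)" "card (verts ?B) < card (verts T)"
    using rooted_treeD(1)[OF assms(1)] psubset_card_mono by blast+
qed

lemma tree_iso_iff:
  "tree_iso T T' \<longleftrightarrow> rooted_tree T \<and> (\<exists>g. inj_on g (verts T) \<and> T' = map_graph g T)"
proof
  assume "tree_iso T T'"
  then obtain g where g: "rooted_tree T" "bij_betw g (verts T) (verts T')" "(`) g ` edges T = edges T'" "g (rt T) = rt T'"
    unfolding tree_iso_def by blast
  then have "T' = map_graph g T" by (intro rgraph.expand) (auto simp: bij_betw_def)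
  then show "rooted_tree T \<and> (\<exists>g. inj_on g (verts T) \<and> T' = map_graph g T)"
    using g by (auto simp: bij_betw_def)
next
  assume "rooted_tree T \<and> (\<exists>g. inj_on g (verts T) \<and> T' = map_graph g T)"
  then show "tree_iso T T'"
    unfolding tree_iso_def using rooted_tree_map_graph by (auto simp: bij_betw_def)
qed

lemma map_graph_comp: "map_graph h (map_graph g T) = map_graph (h \<circ> g) T"
  by (auto simp: map_graph_def image_image)

lemma map_graph_cong:
  assumes "rooted_tree T" "\<And>x. x \<in> verts T \<Longrightarrow> g x = h x"
  shows "map_graph g T = map_graph h T"
proof -
  have "g ` e = h ` e" if "e \<in> edges T" for e
    using rooted_treeD(3)[OF assms(1) that] assms(2) by (intro image_cong) auto
  moreover have "g ` verts T = h ` verts T" using assms(2) by (intro image_cong) auto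
  ultimately show ?thesis
    using assms(2)[OF rooted_treeD(2)[OF assms(1)]] by (simp add: map_graph_def cong: image_cong)
qed

lemma map_graph_ident:
  assumes "rooted_tree T" "\<And>x. x \<in> verts T \<Longrightarrow> g x = x" shows "map_graph g T = T"
proof -
  have "map_graph g T = map_graph (\<lambda>x. x) T" using assms by (rule map_graph_cong)
  then show ?thesis by (simp add: map_graph_def rgraph_collapse)
qed

lemma map_graph_inv_into:
  "rooted_tree T \<Longrightarrow> inj_on g (verts T) \<Longrightarrow> map_graph (inv_into (verts T) g) (map_graph g T) = T"
  unfolding map_graph_comp by (rule map_graph_ident) auto

section \<open>Sums over cut sequences\<close>

text \<open>The convolution that corresponds to applying a derivation: \<open>w\<close> weighs the grafted branch and \<open>x\<close>
  the tree that receives it.\<close>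

definition cut_conv :: "('v rgraph \<Rightarrow> 'a) \<Rightarrow> ('v rgraph \<Rightarrow> 'a) \<Rightarrow> 'v rgraph \<Rightarrow> 'a::comm_ring_1" where
  "cut_conv w x T = (\<Sum>e\<in>edges T. w (branch_part T e) * x (root_part T e))"

text \<open>The sum over the cut sequences of length \<open>r\<close> of the product of \<open>w\<close> over the pieces, see
  \<open>sum_cut_seqs\<close> below.\<close>

definition cut_sum :: "('v rgraph \<Rightarrow> 'a) \<Rightarrow> nat \<Rightarrow> 'v rgraph \<Rightarrow> 'a::comm_ring_1" where
  "cut_sum w r = (cut_conv w ^^ r) w"

lemma cut_sum_0 [simp]: "cut_sum w 0 = w"
  and cut_sum_Suc: "cut_sum w (Suc r) = cut_conv w (cut_sum w r)"
  by (simp_all add: cut_sum_def)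

lemma edges_root_part_subset: "edges (root_part T e) \<subseteq> edges T - {e}"
  unfolding root_part_def by (rule edges_component)

text \<open>Grafting \<open>S\<close> and cutting an edge of \<open>T\<close> commute: depending on the side of \<open>f\<close> on which \<open>v\<close> lies,
  \<open>S\<close> is attached to the part that is kept or to the one that is cut off. In either case the cut
  leaves the same edges of \<open>T\<close>.\<close>

lemma (in graftable) edges_root_part_graft:
  assumes f: "f \<in> edges T"
  shows "edges (root_part (graft T S v) f) \<inter> edges T = edges (root_part T f)"
proof -
  let ?R = "root_part T f" and ?B = "branch_part T f"
  from graft_parts[OF T f] obtain u where gu: "graftable ?R ?B u" "T = graft ?R ?B u"
    "f = {u, rt ?B}" .
  interpret I: graftable ?R ?B u by fact
  have V: "verts T = verts ?R \<union> verts ?B" "rt T = rt ?R"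
    "edges T = insert {u, rt ?B} (edges ?R \<union> edges ?B)"
    using arg_cong[OF gu(2), of verts] arg_cong[OF gu(2), of rt] arg_cong[OF gu(2), of edges] by simp_all
  show ?thesis
  proof (cases "v \<in> verts ?R")
    case True
    interpret J: graftable ?R S v by unfold_locales (use True disj S I.T V in auto)
    interpret K: graftable "graft ?R S v" ?B u
      by unfold_locales (use J.rooted_tree_graft I.S I.v I.disj disj V in auto)
    have "graft T S v = graft (graft ?R S v) ?B u"
      by (rule rgraph.expand) (auto simp: V)
    then have "root_part (graft T S v) f = graft ?R S v"
      using K.root_part_graft gu(3) by metis
    then have "edges (root_part (graft T S v) f) = insert {v, rt S} (edges ?R \<union> edges S)" by simp
    moreover have "edges S \<inter> edges T = {}"
    proof (rule ccontr)
      assume "edges S \<inter> edges T \<noteq> {}"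
      then obtain d where "d \<in> edges S" "d \<in> edges T" by blast
      then have "d = {}" "card d = 2" using ES ET disj rooted_treeD(4)[OF T] by blast+
      then show False by simp
    qed
    moreover have "edges ?R \<subseteq> edges T" using edges_root_part_subset[of T f] by auto
    ultimately show ?thesis using new_edge(1) by auto
  next
    case False
    then have vB: "v \<in> verts ?B" using v V by auto
    interpret J: graftable ?B S v by unfold_locales (use vB disj S I.S V in auto)
    interpret K: graftable ?R "graft ?B S v" u
      by unfold_locales (use J.rooted_tree_graft I.T I.v I.disj disj V in auto)
    have "graft T S v = graft ?R (graft ?B S v) u"
      by (rule rgraph.expand) (auto simp: V)
    then have "root_part (graft T S v) f = ?R"
      using K.root_part_graft gu(3) by (metis graft_simps(3))
    then show ?thesis using V by auto
  qed
qed

lemma edges_root_part_root_part: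
  assumes "rooted_tree T" "e \<in> edges T" "f \<in> edges (root_part T e)"
  shows "edges (root_part (root_part T e) f) = edges (root_part T f) \<inter> edges (root_part T e)"
proof -
  from graft_parts[OF assms(1,2)] obtain v where gv: "graftable (root_part T e) (branch_part T e) v"
    "T = graft (root_part T e) (branch_part T e) v" .
  show ?thesis using graftable.edges_root_part_graft[OF gv(1) assms(3)] gv(2) by metis
qed

text \<open>After the first cut, the order condition on the remaining edges may be read in the root part instead
  of the whole tree, because later cuts retain the same edges of the root part in both readings.\<close>

lemma cut_seqs_Suc:
  assumes "rooted_tree T"
  shows "cut_seqs T (Suc r) = (\<Union>e\<in>edges T. (#) e ` cut_seqs (root_part T e) r)"
proof -
  have *: "e # es \<in> cut_seqs T (Suc r) \<longleftrightarrow> e \<in> edges T \<and> es \<in> cut_seqs (root_part T e) r" for e es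
  proof (cases "e \<in> edges T \<and> set es \<subseteq> edges (root_part T e)")
    case True
    then have "sorted_wrt (\<lambda>e f. f \<in> edges (root_part T e)) es \<longleftrightarrow>
      sorted_wrt (\<lambda>f f'. f' \<in> edges (root_part (root_part T e) f)) es"
      by (intro iffI; elim sorted_wrt_mono_rel[rotated])
        (use edges_root_part_root_part[OF assms] in \<open>auto simp: subset_iff\<close>)
    then show ?thesis using True edges_root_part_subset[of T e] by (auto simp: cut_seqs_def)
  next
    case False
    then show ?thesis by (auto simp: cut_seqs_def)
  qed
  have "[] \<notin> cut_seqs T (Suc r)" by (simp add: cut_seqs_def)
  show ?thesis
  proof (rule set_eqI)
    fix es show "es \<in> cut_seqs T (Suc r) \<longleftrightarrow> es \<in> (\<Union>e\<in>edges T. (#) e ` cut_seqs (root_part T e) r)"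
      using \<open>[] \<notin> _\<close> * by (cases es) auto
  qed
qed

lemma finite_cut_seqs:
  assumes "rooted_tree T" shows "finite (cut_seqs T r)"
  by (rule finite_subset[OF _ finite_lists_length_eq[OF rooted_treeD(7)[OF assms], of r]])
    (auto simp: cut_seqs_def)

lemma sum_cut_seqs:
  "rooted_tree T \<Longrightarrow> (\<Sum>es\<in>cut_seqs T r. prod_list (map w (pieces T es))) = cut_sum w r T"
proof (induction r arbitrary: T)
  case 0
  have "cut_seqs T 0 = {[]}" by (auto simp: cut_seqs_def)
  then show ?case by simp
next
  case (Suc r)
  have "(\<Sum>es\<in>cut_seqs T (Suc r). prod_list (map w (pieces T es))) =
    (\<Sum>e\<in>edges T. \<Sum>es\<in>(#) e ` cut_seqs (root_part T e) r. prod_list (map w (pieces T es)))"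
    unfolding cut_seqs_Suc[OF Suc.prems]
    by (rule sum.UNION_disjoint)
      (use rooted_treeD(7)[OF Suc.prems] finite_cut_seqs rooted_tree_root_part[OF Suc.prems] in auto)
  also have "\<dots> = (\<Sum>e\<in>edges T. w (branch_part T e) * cut_sum w r (root_part T e))"
    by (rule sum.cong)
      (simp_all add: sum.reindex sum_distrib_left[symmetric] Suc.IH rooted_tree_root_part[OF Suc.prems])
  finally show ?case by (simp add: cut_sum_Suc cut_conv_def)
qed

text \<open>Each cut removes at least one vertex from the root part.\<close>

lemma cut_sum_eq_0:
  "rooted_tree T \<Longrightarrow> card (verts T) \<le> r \<Longrightarrow> cut_sum w r T = 0"
proof (induction r arbitrary: T)
  case 0
  then show ?case using rooted_treeD(1,2)[OF 0(1)] by auto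
next
  case (Suc r)
  have "cut_sum w r (root_part T e) = 0" if "e \<in> edges T" for e
    using Suc.IH rooted_tree_root_part[OF Suc.prems(1) that] card_root_part_less[OF Suc.prems(1) that] Suc.prems(2)
    by auto
  then show ?case by (simp add: cut_sum_Suc cut_conv_def)
qed

lemma phi_eq:
  assumes "rooted_tree T"
  shows "phi T = (if card (verts T) = 1 then 1
    else - (\<Sum>k = 2..card (verts T). 1 / fact k * cut_sum phi (k - 1) T))"
proof -
  have "card (verts T) \<noteq> 0" using rooted_treeD(1,2)[OF assms] by auto
  then show ?thesis using assms by (subst phi.simps) (auto simp: sum_cut_seqs)
qed

text \<open>The recursion for \<open>phi\<close> in the form in which it is used: the left-hand side is the coefficient
  of the tree \<open>T\<close> in \<open>exp A \<cdot> z\<close>.\<close>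

lemma sum_cut_sum_phi:
  assumes "rooted_tree T"
  shows "(\<Sum>k = 1..card (verts T). 1 / fact k * cut_sum phi (k - 1) T) = (if card (verts T) = 1 then 1 else 0)"
proof -
  have n: "card (verts T) \<ge> 1" using rooted_treeD(1,2)[OF assms] by (auto simp: Suc_le_eq card_gt_0_iff)
  have "(\<Sum>k = 1..card (verts T). 1 / fact k * cut_sum phi (k - 1) T) =
      phi T + (\<Sum>k = 2..card (verts T). 1 / fact k * cut_sum phi (k - 1) T)"
    using n by (simp add: sum.atLeast_Suc_atMost numeral_2_eq_2)
  then show ?thesis using phi_eq[OF assms] by simp
qed

lemma inj_image_on_edges:
  assumes "rooted_tree T" "inj_on g (verts T)" shows "inj_on ((`) g) (edges T)"
  using inj_on_image_Pow[OF assms(2)] by (rule inj_on_subset) (use rooted_treeD(3)[OF assms(1)] in auto)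

lemma cut_conv_map_graph:
  assumes T: "rooted_tree T" and g: "inj_on g (verts T)"
    and "\<And>S. rooted_tree S \<Longrightarrow> verts S \<subset> verts T \<Longrightarrow> w' (map_graph g S) = w S"
    and "\<And>S. rooted_tree S \<Longrightarrow> verts S \<subset> verts T \<Longrightarrow> x' (map_graph g S) = x S"
  shows "cut_conv w' x' (map_graph g T) = cut_conv w x T"
proof -
  have "cut_conv w' x' (map_graph g T) = (\<Sum>e\<in>edges T. w' (branch_part (map_graph g T) (g ` e)) * x' (root_part (map_graph g T) (g ` e)))"
    unfolding cut_conv_def by (simp add: sum.reindex[OF inj_image_on_edges[OF T g]])
  also have "\<dots> = cut_conv w x T"
    unfolding cut_conv_def
  proof (rule sum.cong)
    fix e assume e: "e \<in> edges T"
    have "verts (branch_part T e) \<subset> verts T" "verts (root_part T e) \<subset> verts T"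
      using verts_parts[OF T e] card_branch_part_less[OF T e] card_root_part_less[OF T e] by auto
    then show "w' (branch_part (map_graph g T) (g ` e)) * x' (root_part (map_graph g T) (g ` e)) =
        w (branch_part T e) * x (root_part T e)"
      using assms(3,4) rooted_tree_branch_part[OF T e] rooted_tree_root_part[OF T e]
      by (simp add: branch_part_map_graph[OF T g e] root_part_map_graph[OF T g e])
  qed simp
  finally show ?thesis .
qed

text \<open>The induction is on the number of vertices. All values of \<open>phi\<close> that enter a cut sum with at least
  one cut belong to proper parts of the tree.\<close>

lemma phi_map_graph:
  "rooted_tree T \<Longrightarrow> inj_on g (verts T) \<Longrightarrow> phi (map_graph g T) = phi T"
proof (induction "card (verts T)" arbitrary: T rule: less_induct)
  case less
  have IH: "phi (map_graph g S) = phi S" if "rooted_tree S" "verts S \<subset> verts T" for S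
    using that less.prems rooted_treeD(1)[OF less.prems(1)]
    by (intro less.hyps) (auto intro: psubset_card_mono inj_on_subset)
  have cs: "cut_sum phi (Suc r) (map_graph g S) = cut_sum phi (Suc r) S"
    if "rooted_tree S" "verts S \<subseteq> verts T" for r S
    using that
  proof (induction r arbitrary: S)
    case 0
    show ?case unfolding cut_sum_Suc cut_sum_0
      by (rule cut_conv_map_graph) (use 0 IH inj_on_subset[OF less.prems(2)] in auto)
  next
    case (Suc r)
    show ?case unfolding cut_sum_Suc[of _ "Suc r"]
      by (rule cut_conv_map_graph) (use Suc IH inj_on_subset[OF less.prems(2)] in auto)
  qed
  have "cut_sum phi (k - 1) (map_graph g T) = cut_sum phi (k - 1) T" if "k \<in> {2..card (verts T)}" for k
    using cs[OF less.prems(1) order_refl, of "k - 2"] that by (simp add: numeral_2_eq_2 Suc_diff_Suc)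
  then show ?case
    using phi_eq[OF less.prems(1)] phi_eq[OF rooted_tree_map_graph[OF less.prems]]
    by (simp add: card_image[OF less.prems(2)])
qed

definition iso_invariant :: "(nat rgraph \<Rightarrow> 'a) \<Rightarrow> bool" where
  "iso_invariant w \<longleftrightarrow> (\<forall>T g. rooted_tree T \<longrightarrow> inj_on g (verts T) \<longrightarrow> w (map_graph g T) = w T)"

lemma iso_invariantD:
  "iso_invariant w \<Longrightarrow> rooted_tree T \<Longrightarrow> inj_on g (verts T) \<Longrightarrow> w (map_graph g T) = w T"
  by (auto simp: iso_invariant_def)

lemma iso_invariant_tree_iso: "iso_invariant w \<Longrightarrow> tree_iso T T' \<Longrightarrow> w T' = w T"
  by (auto simp: tree_iso_iff iso_invariant_def)

lemma iso_invariant_cut_sum: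
  assumes "iso_invariant w" shows "iso_invariant (cut_sum w r)"
proof (induction r)
  case (Suc r)
  show ?case
    unfolding iso_invariant_def cut_sum_Suc
  proof (intro allI impI)
    fix T :: "nat rgraph" and g :: "nat \<Rightarrow> nat"
    assume T: "rooted_tree T" and g: "inj_on g (verts T)"
    have sub: "inj_on g (verts S)" if "verts S \<subset> verts T" for S
      using inj_on_subset[OF g] that by blast
    show "cut_conv w (cut_sum w r) (map_graph g T) = cut_conv w (cut_sum w r) T"
      by (rule cut_conv_map_graph[OF T g]; rule iso_invariantD[OF assms] iso_invariantD[OF Suc])
        (simp_all add: sub)
  qed
qed (simp add: assms)

section \<open>Labelled trees\<close>

definition trees :: "'v set \<Rightarrow> 'v rgraph set" where
  "trees V = {T. rooted_tree T \<and> verts T = V}"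

lemma finite_trees: assumes "finite V" shows "finite (trees V)"
proof -
  have "trees V \<subseteq> (\<lambda>(E, r). RGraph V E r) ` (Pow (Pow V) \<times> V)"
  proof
    fix T assume "T \<in> trees V"
    then have T: "rooted_tree T" "verts T = V" by (auto simp: trees_def)
    then have "T = (\<lambda>(E, r). RGraph V E r) (edges T, rt T)" using rgraph_collapse[of T] by simp
    moreover have "(edges T, rt T) \<in> Pow (Pow V) \<times> V"
      using rooted_treeD(2,3)[OF T(1)] T(2) by auto
    ultimately show "T \<in> (\<lambda>(E, r). RGraph V E r) ` (Pow (Pow V) \<times> V)" by (rule image_eqI)
  qed
  then show ?thesis using assms by (meson finite_Pow_iff finite_SigmaI finite_imageI finite_subset)
qed

text \<open>Cutting one edge of a tree on \<open>V\<close> amounts to splitting \<open>V\<close> into two blocks, choosing a tree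
  on each block, and choosing the vertex at which they are joined.\<close>

lemma sum_trees_edges:
  fixes V :: "'v set" and f :: "'v rgraph \<Rightarrow> 'v rgraph \<Rightarrow> 'v rgraph \<Rightarrow> 'a::comm_monoid_add"
  assumes V: "finite V"
  shows "(\<Sum>U\<in>trees V. \<Sum>e\<in>edges U. f (branch_part U e) (root_part U e) U) =
    (\<Sum>B\<in>Pow V. \<Sum>S\<in>trees B. \<Sum>T\<in>trees (V - B). \<Sum>v\<in>V - B. f S T (graft T S v))"
proof -
  have fin: "finite (trees B)" "finite (trees (V - B))" if "B \<in> Pow V" for B
    using that V finite_subset by (auto intro!: finite_trees)
  have finE: "finite (edges U)" if "U \<in> trees V" for U
    using that rooted_treeD(7) by (auto simp: trees_def)
  define A where "A = (SIGMA U:trees V. edges U)"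
  define Z where "Z = (SIGMA B:Pow V. SIGMA S:trees B. SIGMA T:trees (V - B). V - B)"
  define h where "h = (\<lambda>(U, e). (verts (branch_part U e), branch_part U e, root_part U e,
    the_elem (e \<inter> verts (root_part U e))) :: 'v set \<times> 'v rgraph \<times> 'v rgraph \<times> 'v)"
  define h' where "h' = (\<lambda>(B :: 'v set, S :: 'v rgraph, T, v). (graft T S v, {v, rt S}))"
  have hA: "h p \<in> Z \<and> h' (h p) = p" if "p \<in> A" for p
  proof -
    obtain U e where p: "p = (U, e)" by (cases p)
    then have U: "rooted_tree U" "verts U = V" "e \<in> edges U" using that by (auto simp: A_def trees_def)
    let ?R = "root_part U e" and ?B = "branch_part U e"
    from graft_parts[OF U(1,3)] obtain v where gv: "graftable ?R ?B v" "U = graft ?R ?B v"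
      "e = {v, rt ?B}" .
    interpret graftable ?R ?B v by fact
    have "e \<inter> verts ?R = {v}" using gv(3) v rtS disj by blast
    then have "h p = (verts ?B, ?B, ?R, v)" by (simp add: h_def p)
    moreover have "V = verts ?R \<union> verts ?B" using verts_parts[OF U(1,3)] U(2) by simp
    ultimately show ?thesis
      using T S v disj gv(2,3) by (auto simp: h'_def Z_def trees_def p)
  qed
  have hZ: "h' z \<in> A \<and> h (h' z) = z" if "z \<in> Z" for z
  proof -
    obtain B S T v where z: "z = (B, S, T, v)" by (cases z)
    interpret graftable T S v
      by unfold_locales (use that z in \<open>auto simp: Z_def trees_def\<close>)
    have "{v, rt S} \<inter> verts T = {v}" using v rtS disj by blast
    then have "h (h' z) = (verts S, S, T, v)"
      unfolding h_def h'_def z by (simp add: root_part_graft branch_part_graft del: Int_insert_left)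
    moreover have "h' z \<in> A"
      using that rooted_tree_graft by (auto simp: z Z_def h'_def A_def trees_def)
    ultimately show ?thesis
      using that by (auto simp: z Z_def trees_def)
  qed
  have "(\<Sum>U\<in>trees V. \<Sum>e\<in>edges U. f (branch_part U e) (root_part U e) U) =
    (\<Sum>(U, e)\<in>A. f (branch_part U e) (root_part U e) U)"
    unfolding A_def by (rule sum.Sigma) (use V finite_trees finE in auto)
  also have "\<dots> = (\<Sum>(B, S, T, v)\<in>Z. f S T (graft T S v))"
    by (rule sum.reindex_bij_witness[where i = h' and j = h])
      (use hA hZ in \<open>auto simp: h_def h'_def\<close>)
  also have "\<dots> = (\<Sum>B\<in>Pow V. \<Sum>S\<in>trees B. \<Sum>T\<in>trees (V - B). \<Sum>v\<in>V - B. f S T (graft T S v))"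
    unfolding Z_def using V fin by (simp add: sum.Sigma)
  finally show ?thesis .
qed

lemma map_graph_trees:
  "T \<in> trees V \<Longrightarrow> inj_on g V \<Longrightarrow> map_graph g T \<in> trees (g ` V)"
  using rooted_tree_map_graph by (auto simp: trees_def)

text \<open>Together with invariance under relabelling, this makes sums over the trees on \<open>V\<close> depend only on the
  size of \<open>V\<close>.\<close>

lemma sum_trees_relabel:
  assumes g: "bij_betw g V W"
  shows "(\<Sum>T\<in>trees W. f T) = (\<Sum>T\<in>trees V. f (map_graph g T))"
proof -
  let ?h = "inv_into V g"
  have inj: "inj_on g V" "g ` V = W" using g by (auto simp: bij_betw_def)
  have h: "bij_betw ?h W V" using g by (rule bij_betw_inv_into)
  then have injh: "inj_on ?h W" "?h ` W = V" by (auto simp: bij_betw_def)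
  have inv: "map_graph g (map_graph ?h T) = T" if "T \<in> trees W" for T
    unfolding map_graph_comp
    by (rule map_graph_ident) (use that inj in \<open>auto simp: trees_def f_inv_into_f\<close>)
  show ?thesis
    by (rule sum.reindex_bij_witness[where i = "map_graph g" and j = "map_graph ?h"])
      (use map_graph_trees[of _ V g] map_graph_trees[of _ W ?h] inj injh inv map_graph_inv_into
        in \<open>auto simp: trees_def\<close>)
qed

section \<open>Counting isomorphisms\<close>

text \<open>Composition with one fixed bijection identifies the permutations of \<open>V\<close> with the bijections from
  \<open>V\<close> to \<open>W\<close>. Functions are normalised to be undefined outside \<open>V\<close>, so that each is counted once.\<close>

lemma card_bijections_Collect:
  assumes g0: "bij_betw g0 V W"
  shows "card {g \<in> extensional V. bij_betw g V W \<and> Q g} =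
    card {p. p permutes V \<and> Q (restrict (g0 \<circ> p) V)}"
proof -
  let ?h = "inv_into V g0"
  let ?F = "\<lambda>p. restrict (g0 \<circ> p) V" and ?G = "\<lambda>g x. if x \<in> V then ?h (g x) else x"
  have h: "bij_betw ?h W V" using g0 by (rule bij_betw_inv_into)
  have 1: "?F p \<in> extensional V \<and> bij_betw (?F p) V W \<and> ?G (?F p) = p" if "p permutes V" for p
  proof -
    have "bij_betw (g0 \<circ> p) V W" using permutes_imp_bij[OF that] g0 by (rule bij_betw_trans)
    then have "bij_betw (?F p) V W" by (subst bij_betw_restrict_eq)
    moreover have "?G (?F p) = p"
      using g0 that by (auto simp: fun_eq_iff permutes_in_image bij_betw_inv_into_left permutes_not_in)
    ultimately show ?thesis by simp
  qed
  have 2: "?G g permutes V \<and> ?F (?G g) = g" if "g \<in> extensional V" "bij_betw g V W" for g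
  proof -
    have "bij_betw (?h \<circ> g) V V" using that(2) h by (rule bij_betw_trans)
    then have "bij_betw (?G g) V V" by (rule bij_betw_cong[THEN iffD1, rotated]) simp
    then have "?G g permutes V" by (rule bij_imp_permutes) simp
    moreover have "?F (?G g) = g"
      using that g0 bij_betw_apply[OF that(2)]
      by (auto simp: fun_eq_iff extensional_def bij_betw_inv_into_right[OF g0])
    ultimately show ?thesis by blast
  qed
  have "bij_betw ?F {p. p permutes V \<and> Q (?F p)} {g \<in> extensional V. bij_betw g V W \<and> Q g}"
    by (rule bij_betw_byWitness[where f' = ?G]) (use 1 2 in auto)
  then show ?thesis by (simp add: bij_betw_same_card)
qed

definition isos :: "'v rgraph \<Rightarrow> 'w rgraph \<Rightarrow> ('v \<Rightarrow> 'w) set" where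
  "isos T T' = {g \<in> extensional (verts T). inj_on g (verts T) \<and> map_graph g T = T'}"

lemma isos_alt:
  "isos T T' = {g \<in> extensional (verts T). bij_betw g (verts T) (verts T') \<and> map_graph g T = T'}"
  by (auto simp: isos_def bij_betw_def)

lemma inj_on_map_graph_eq:
  assumes "rooted_tree T" "rooted_tree T'" "verts T \<subseteq> V" "verts T' \<subseteq> V" "inj_on g V"
    "map_graph g T = map_graph g T'"
  shows "T = T'"
proof -
  have inv: "map_graph (inv_into V g) (map_graph g S) = S" if "rooted_tree S" "verts S \<subseteq> V" for S
    unfolding map_graph_comp by (rule map_graph_ident) (use that assms(5) in auto)
  show ?thesis using inv[OF assms(1,3)] inv[OF assms(2,4)] unfolding assms(6) by (rule trans[OF sym])
qed

text \<open>The isomorphisms onto a fixed tree form a coset of the automorphism group.\<close>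

lemma card_isos:
  assumes T: "rooted_tree T"
  shows "card (isos T T') = (if tree_iso T T' then num_auts T else 0)"
proof (cases "tree_iso T T'")
  case True
  then obtain g0 where g0: "inj_on g0 (verts T)" "T' = map_graph g0 T" by (auto simp: tree_iso_iff)
  then have bij: "bij_betw g0 (verts T) (verts T')" by (auto simp: bij_betw_def)
  have eq: "map_graph (restrict (g0 \<circ> p) (verts T)) T = T' \<longleftrightarrow>
      (`) p ` edges T = edges T \<and> p (rt T) = rt T" if p: "p permutes verts T" for p
  proof -
    have pT: "rooted_tree (map_graph p T)" "verts (map_graph p T) = verts T"
      using rooted_tree_map_graph[OF T] permutes_inj_on[OF p] permutes_image[OF p] by auto
    have "map_graph (restrict (g0 \<circ> p) (verts T)) T = map_graph g0 (map_graph p T)"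
      unfolding map_graph_comp by (rule map_graph_cong[OF T]) auto
    then have "map_graph (restrict (g0 \<circ> p) (verts T)) T = T' \<longleftrightarrow> map_graph g0 (map_graph p T) = map_graph g0 T"
      using g0(2) by simp
    also have "\<dots> \<longleftrightarrow> map_graph p T = T"
      using inj_on_map_graph_eq[OF pT(1) T _ _ g0(1)] pT(2) by auto
    also have "\<dots> \<longleftrightarrow> (`) p ` edges T = edges T \<and> p (rt T) = rt T"
      using pT(2) by (metis map_graph_simps(2,3) rgraph.expand)
    finally show ?thesis .
  qed
  have "card (isos T T') = num_auts T"
    unfolding isos_alt card_bijections_Collect[OF bij] num_auts_def
    by (rule arg_cong[of _ _ card]) (use eq in auto)
  then show ?thesis using True by simp
next
  case False
  then have "isos T T' = {}" using T by (auto simp: isos_def tree_iso_iff)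
  then show ?thesis using False by simp
qed

lemma num_auts_pos: assumes T: "rooted_tree T" shows "num_auts T > 0"
proof -
  have "finite {p. p permutes verts T \<and> (`) p ` edges T = edges T \<and> p (rt T) = rt T}"
    using finite_permutations[OF rooted_treeD(1)[OF T]] by (rule rev_finite_subset) auto
  moreover have "id \<in> {p. p permutes verts T \<and> (`) p ` edges T = edges T \<and> p (rt T) = rt T}"
    by (auto simp: permutes_id)
  ultimately show ?thesis unfolding num_auts_def card_gt_0_iff by blast
qed

text \<open>Every bijection from the vertices of \<open>T\<close> to \<open>W\<close> is an isomorphism onto exactly one
  tree on \<open>W\<close>, and each copy of \<open>T\<close> is reached \<open>num_auts T\<close> times.\<close>

lemma card_labelled_copies:
  assumes T: "rooted_tree T" and W: "finite W" "card W = card (verts T)"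
  shows "card {T' \<in> trees W. tree_iso T T'} * num_auts T = fact (card W)"
proof -
  have fV: "finite (verts T)" using rooted_treeD(1)[OF T] .
  obtain g0 where g0: "bij_betw g0 (verts T) W"
    using finite_same_card_bij[OF fV W(1)] W(2) by auto
  have "{g \<in> extensional (verts T). bij_betw g (verts T) W} = (\<Union>T'\<in>{T' \<in> trees W. tree_iso T T'}. isos T T')"
    (is "?L = ?R")
  proof (intro equalityI subsetI)
    fix g assume "g \<in> ?L"
    then have "g \<in> isos T (map_graph g T)" "map_graph g T \<in> trees W" "tree_iso T (map_graph g T)"
      using T rooted_tree_map_graph[OF T, of g]
      by (auto simp: isos_def trees_def bij_betw_def tree_iso_iff)
    then show "g \<in> ?R" by blast
  qed (auto simp: isos_def trees_def bij_betw_def)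
  moreover have "card {g \<in> extensional (verts T). bij_betw g (verts T) W} = fact (card W)"
    using card_bijections_Collect[OF g0, of "\<lambda>_. True"] W fV by (simp add: card_permutations)
  moreover have "card (\<Union>T'\<in>{T' \<in> trees W. tree_iso T T'}. isos T T') =
      (\<Sum>T'\<in>{T' \<in> trees W. tree_iso T T'}. card (isos T T'))"
  proof (rule card_UN_disjoint)
    show "finite {T' \<in> trees W. tree_iso T T'}" using finite_trees[OF W(1)] by simp
    have "card (isos T T') > 0" if "tree_iso T T'" for T'
      using that card_isos[OF T, of T'] num_auts_pos[OF T] by simp
    then show "\<forall>T'\<in>{T' \<in> trees W. tree_iso T T'}. finite (isos T T')"
      using card_ge_0_finite by auto
  qed (auto simp: isos_def)
  moreover have "\<dots> = card {T' \<in> trees W. tree_iso T T'} * num_auts T"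
    by (simp add: card_isos[OF T])
  ultimately show ?thesis by simp
qed

lemma tree_iso_rep_rtree:
  assumes "rooted_tree T" shows "tree_iso (rep_rtree c) T \<longleftrightarrow> abs_rtree T = c"
  using abs_rtree_eq_iff[OF rooted_tree_rep_rtree assms, of c] by (auto simp: abs_rep_rtree)

lemma tree_iso_card: "tree_iso T T' \<Longrightarrow> card (verts T') = card (verts T)"
  by (auto simp: tree_iso_iff card_image)

lemma abs_rtree_trees:
  assumes "finite V"
  shows "abs_rtree ` trees V = {c. card (verts (rep_rtree c)) = card V}"
proof (intro equalityI subsetI)
  fix c assume "c \<in> abs_rtree ` trees V"
  then obtain T where T: "rooted_tree T" "verts T = V" "c = abs_rtree T" by (auto simp: trees_def)
  then have "tree_iso (rep_rtree c) T"
    using tree_iso_rep_rtree by metis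
  then show "c \<in> {c. card (verts (rep_rtree c)) = card V}"
    using tree_iso_card[of "rep_rtree c" T] T(2) by simp
next
  fix c assume "c \<in> {c. card (verts (rep_rtree c)) = card V}"
  then obtain g where g: "bij_betw g (verts (rep_rtree c)) V"
    using finite_same_card_bij[OF rooted_treeD(1)[OF rooted_tree_rep_rtree] assms] by auto
  let ?T = "map_graph g (rep_rtree c)"
  have "tree_iso (rep_rtree c) ?T"
    using g rooted_tree_rep_rtree by (auto simp: tree_iso_iff bij_betw_def)
  then have "c = abs_rtree ?T" "?T \<in> trees V"
    using abs_rtree_eq_iff[of "rep_rtree c" ?T] g
    by (auto simp: abs_rep_rtree tree_iso_def trees_def bij_betw_def)
  then show "c \<in> abs_rtree ` trees V" by blast
qed

text \<open>The passage between sums over labelled trees and sums over isomorphism classes; this is where the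
  symmetry factors come from.\<close>

lemma sum_trees_rtree:
  fixes y :: "nat rgraph \<Rightarrow> 'a::field_char_0"
  assumes y: "iso_invariant y" and V: "finite V"
  shows "(\<Sum>T\<in>trees V. y T) / fact (card V) =
    (\<Sum>c | card (verts (rep_rtree c)) = card V. y (rep_rtree c) / of_nat (num_auts (rep_rtree c)))"
proof -
  have "(\<Sum>T\<in>trees V. y T) = (\<Sum>c\<in>abs_rtree ` trees V. \<Sum>T\<in>{T \<in> trees V. abs_rtree T = c}. y T)"
    using finite_trees[OF V] by (rule sum.image_gen)
  also have "\<dots> = (\<Sum>c\<in>abs_rtree ` trees V. fact (card V) * (y (rep_rtree c) / of_nat (num_auts (rep_rtree c))))"
  proof (rule sum.cong)
    fix c assume "c \<in> abs_rtree ` trees V"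
    then have card: "card V = card (verts (rep_rtree c))" unfolding abs_rtree_trees[OF V] by simp
    have iff: "abs_rtree T = c \<longleftrightarrow> tree_iso (rep_rtree c) T" if "T \<in> trees V" for T
      using tree_iso_rep_rtree[of T c] that by (simp add: trees_def)
    then have eq: "{T \<in> trees V. abs_rtree T = c} = {T \<in> trees V. tree_iso (rep_rtree c) T}" by auto
    have "(\<Sum>T\<in>{T \<in> trees V. abs_rtree T = c}. y T) =
        of_nat (card {T \<in> trees V. tree_iso (rep_rtree c) T}) * y (rep_rtree c)"
      unfolding eq by (subst sum.cong[OF refl iso_invariant_tree_iso[OF y]]) auto
    moreover have "of_nat (card {T \<in> trees V. tree_iso (rep_rtree c) T}) * of_nat (num_auts (rep_rtree c)) =
        (fact (card V) :: 'a)"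
      using card_labelled_copies[OF rooted_tree_rep_rtree V card]
      by (metis of_nat_fact of_nat_mult)
    moreover have "(of_nat (num_auts (rep_rtree c)) :: 'a) \<noteq> 0"
      using num_auts_pos[OF rooted_tree_rep_rtree, of c] by simp
    ultimately show "(\<Sum>T\<in>{T \<in> trees V. abs_rtree T = c}. y T) =
        fact (card V) * (y (rep_rtree c) / of_nat (num_auts (rep_rtree c)))"
      by (simp add: field_simps)
  qed simp
  finally show ?thesis
    unfolding abs_rtree_trees[OF V] sum_distrib_left[symmetric] by simp
qed

lemma finite_rtree_card: "finite {c. card (verts (rep_rtree c)) = N}"
  using abs_rtree_trees[of "{..<N}"] finite_trees[of "{..<N}"] by (metis card_lessThan finite_imageI finite_lessThan)

lemma finite_rtree_card_le: "finite {c. card (verts (rep_rtree c)) \<le> d}"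
proof -
  have "{c. card (verts (rep_rtree c)) \<le> d} = (\<Union>N\<le>d. {c. card (verts (rep_rtree c)) = N})" by auto
  then show ?thesis using finite_rtree_card by simp
qed

section \<open>Differential algebra of power series\<close>

lemmas mcoeff_arith = plus_mfps.rep_eq minus_mfps.rep_eq uminus_mfps.rep_eq zero_mfps.rep_eq

lemma mcoeff_mderiv:
  "mcoeff (mderiv i f) m = of_nat (Poly_Mapping.lookup m i + 1) * mcoeff f (m + Poly_Mapping.single i 1)"
  by (simp add: mderiv_def Abs_mfps_inverse)

lemma mcoeff_mscale: "mcoeff (mscale c f) m = c * mcoeff f m"
  by (simp add: mscale_def Abs_mfps_inverse)

lemma mcoeff_mvar: "mcoeff (mvar i) m = (if m = Poly_Mapping.single i 1 then 1 else 0)"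
  by (simp add: mvar_def Abs_mfps_inverse)

lemma mcoeff_mmap: "mcoeff (mmap c f) m = c (mcoeff f m)"
  by (simp add: mmap_def Abs_mfps_inverse)

lemma mcoeff_msum: "mcoeff (msum f) m = Sum_any (\<lambda>x. mcoeff (f x) m)"
  by (simp add: msum_def Abs_mfps_inverse)

lemma mcoeff_sum: "mcoeff (sum f A) m = (\<Sum>x\<in>A. mcoeff (f x) m)"
  by (induction A rule: infinite_finite_induct) (simp_all add: mcoeff_arith)

lemma mcoeff_times: "mcoeff (f * g) m = (\<Sum>(a, b)\<in>{(a, b). a + b = m}. mcoeff f a * mcoeff g b)"
  by (simp add: times_mfps.rep_eq)

lemma mcoeff_times_nonzeroE:
  assumes "mcoeff (f * g) m \<noteq> 0"
  obtains a b where "m = a + b" "mcoeff f a \<noteq> 0" "mcoeff g b \<noteq> 0"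
proof -
  from assms obtain p where p: "p \<in> {(a, b). a + b = m}" "mcoeff f (fst p) * mcoeff g (snd p) \<noteq> 0"
    unfolding mcoeff_times by (auto elim!: sum.not_neutral_contains_not_neutral simp: case_prod_unfold)
  have "m = fst p + snd p" using p(1) by auto
  moreover have "mcoeff f (fst p) \<noteq> 0" "mcoeff g (snd p) \<noteq> 0" using p(2) by auto
  ultimately show thesis by (rule that)
qed

lemma mscale_add: "mscale c (f + g) = mscale c f + mscale c g"
  and mscale_mscale: "mscale c (mscale d f) = mscale (c * d) f"
  and mscale_add_left: "mscale (c + d) f = mscale c f + mscale d f"
  and mscale_one [simp]: "mscale 1 f = f"
  and mscale_0 [simp]: "mscale 0 f = 0"
  and mscale_zero [simp]: "mscale c 0 = 0"
  by (auto intro!: mfps_eqI simp: mcoeff_mscale mcoeff_arith algebra_simps)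

lemma mscale_sum: "mscale c (sum f A) = (\<Sum>x\<in>A. mscale c (f x))"
  by (auto intro!: mfps_eqI simp: mcoeff_mscale mcoeff_sum sum_distrib_left)

lemma mscale_mult_left: "mscale c f * g = mscale c (f * g)"
  by (auto intro!: mfps_eqI simp: mcoeff_mscale mcoeff_times sum_distrib_left case_prod_unfold mult.assoc)

lemma mscale_mult_right: "f * mscale c g = mscale c (f * g)"
  by (metis mscale_mult_left mult.commute)

lemma mderiv_add: "mderiv i (f + g) = mderiv i f + mderiv i g"
  and mderiv_diff: "mderiv i (f - g) = mderiv i f - mderiv i g"
  and mderiv_mscale: "mderiv i (mscale c f) = mscale c (mderiv i f)"
  and mderiv_0 [simp]: "mderiv i 0 = 0"
  by (auto intro!: mfps_eqI simp: mcoeff_mscale mcoeff_mderiv mcoeff_arith algebra_simps)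

lemma mderiv_sum: "mderiv i (sum f A) = (\<Sum>x\<in>A. mderiv i (f x))"
  by (induction A rule: infinite_finite_induct) (simp_all add: mderiv_add)

lemma lookup_pos_diff_single:
  "Poly_Mapping.lookup a i > 0 \<Longrightarrow> a - Poly_Mapping.single i (1::nat) + Poly_Mapping.single i 1 = a"
  by (rule poly_mapping_eqI) (auto simp: lookup_add lookup_minus lookup_single when_def)

text \<open>One half of the product rule. The weight vanishes where the index shift would leave the natural
  numbers.\<close>

lemma sum_splits_weighted:
  fixes f g :: "(nat \<Rightarrow>\<^sub>0 nat) \<Rightarrow> 'a::comm_ring_1"
  shows "(\<Sum>(a, b)\<in>{(a, b). a + b = m + Poly_Mapping.single i 1}. of_nat (Poly_Mapping.lookup a i) * (f a * g b)) =
    (\<Sum>(a, b)\<in>{(a, b). a + b = m}. of_nat (Poly_Mapping.lookup a i + 1) * f (a + Poly_Mapping.single i 1) * g b)"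
proof -
  let ?s = "Poly_Mapping.single i (1::nat)"
  have "(\<Sum>(a, b)\<in>{(a, b). a + b = m + ?s}. of_nat (Poly_Mapping.lookup a i) * (f a * g b)) =
    (\<Sum>(a, b)\<in>{(a, b). a + b = m + ?s \<and> Poly_Mapping.lookup a i > 0}. of_nat (Poly_Mapping.lookup a i) * (f a * g b))"
    by (rule sum.mono_neutral_right[OF finite_monomial_splits]) (auto intro!: Nat.gr0I)
  also have "\<dots> = (\<Sum>(a, b)\<in>{(a, b). a + b = m}. of_nat (Poly_Mapping.lookup a i + 1) * f (a + ?s) * g b)"
  proof (rule sum.reindex_bij_witness[where i = "\<lambda>(a, b). (a + ?s, b)" and j = "\<lambda>(a, b). (a - ?s, b)"])
    fix p assume "p \<in> {(a, b). a + b = m + ?s \<and> Poly_Mapping.lookup a i > 0}"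
    then obtain a b where p: "p = (a, b)" "a + b = m + ?s" "Poly_Mapping.lookup a i > 0" by auto
    have a: "a - ?s + ?s = a" using lookup_pos_diff_single[OF p(3)] .
    have "a - ?s + b + ?s = m + ?s" using a p(2) by (metis add.assoc add.commute)
    then have "a - ?s + b = m" by (rule add_right_imp_eq)
    then show "(case p of (a, b) \<Rightarrow> (a - ?s, b)) \<in> {(a, b). a + b = m}" using p(1) by simp
    show "(\<lambda>(a, b). (a + ?s, b)) (case p of (a, b) \<Rightarrow> (a - ?s, b)) = p" using a p(1) by simp
    show "(case (case p of (a, b) \<Rightarrow> (a - ?s, b)) of (a, b) \<Rightarrow> of_nat (Poly_Mapping.lookup a i + 1) * f (a + ?s) * g b) =
        (case p of (a, b) \<Rightarrow> of_nat (Poly_Mapping.lookup a i) * (f a * g b))"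
      using a p by (simp add: lookup_minus mult.assoc)
  next
    fix p assume "p \<in> {(a, b). a + b = m}"
    then show "(\<lambda>(a, b). (a - ?s, b)) (case p of (a, b) \<Rightarrow> (a + ?s, b)) = p"
      "(case p of (a, b) \<Rightarrow> (a + ?s, b)) \<in> {(a, b). a + b = m + ?s \<and> Poly_Mapping.lookup a i > 0}"
      by (auto simp: lookup_add add_ac)
  qed
  finally show ?thesis .
qed

lemma mderiv_mult: "mderiv i (f * g) = mderiv i f * g + f * mderiv i g"
proof (rule mfps_eqI)
  fix m
  let ?s = "Poly_Mapping.single i (1::nat)"
  let ?w = "\<lambda>a. of_nat (Poly_Mapping.lookup a i) :: 'a"
  have swap: "(\<Sum>(a, b)\<in>{(a, b). a + b = k}. F a b) = (\<Sum>(a, b)\<in>{(a, b). a + b = k}. F b a)"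
    for k :: "nat \<Rightarrow>\<^sub>0 nat" and F :: "_ \<Rightarrow> _ \<Rightarrow> 'a"
    by (rule sum.reindex_bij_witness[where i = prod.swap and j = prod.swap]) (auto simp: add.commute)
  have "mcoeff (mderiv i (f * g)) m =
      (\<Sum>(a, b)\<in>{(a, b). a + b = m + ?s}. ?w (m + ?s) * (mcoeff f a * mcoeff g b))"
    by (simp add: mcoeff_mderiv mcoeff_times sum_distrib_left case_prod_unfold lookup_add)
  also have "\<dots> = (\<Sum>(a, b)\<in>{(a, b). a + b = m + ?s}.
      ?w a * (mcoeff f a * mcoeff g b) + ?w b * (mcoeff g b * mcoeff f a))"
  proof (rule sum.cong)
    fix p assume "p \<in> {(a, b). a + b = m + ?s}"
    then obtain a b where p: "p = (a, b)" "m + ?s = a + b" by auto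
    show "(case p of (a, b) \<Rightarrow> ?w (m + ?s) * (mcoeff f a * mcoeff g b)) =
      (case p of (a, b) \<Rightarrow> ?w a * (mcoeff f a * mcoeff g b) + ?w b * (mcoeff g b * mcoeff f a))"
      unfolding p by (simp add: lookup_add algebra_simps)
  qed simp
  also have "\<dots> = (\<Sum>(a, b)\<in>{(a, b). a + b = m + ?s}. ?w a * (mcoeff f a * mcoeff g b)) +
      (\<Sum>(a, b)\<in>{(a, b). a + b = m + ?s}. ?w b * (mcoeff g b * mcoeff f a))"
    by (simp add: sum.distrib case_prod_unfold)
  also have "(\<Sum>(a, b)\<in>{(a, b). a + b = m + ?s}. ?w b * (mcoeff g b * mcoeff f a)) =
      (\<Sum>(a, b)\<in>{(a, b). a + b = m + ?s}. ?w a * (mcoeff g a * mcoeff f b))"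
    by (rule swap)
  also have "(\<Sum>(a, b)\<in>{(a, b). a + b = m + ?s}. ?w a * (mcoeff f a * mcoeff g b)) = mcoeff (mderiv i f * g) m"
    unfolding sum_splits_weighted by (simp add: mcoeff_times mcoeff_mderiv)
  also have "(\<Sum>(a, b)\<in>{(a, b). a + b = m + ?s}. ?w a * (mcoeff g a * mcoeff f b)) = mcoeff (mderiv i g * f) m"
    unfolding sum_splits_weighted by (simp add: mcoeff_times mcoeff_mderiv)
  finally show "mcoeff (mderiv i (f * g)) m = mcoeff (mderiv i f * g + f * mderiv i g) m"
    by (simp add: mcoeff_arith mult.commute)
qed

lemma mderiv_one [simp]: "mderiv i (1 :: 'a::comm_ring_1 mfps) = 0"
proof (rule mfps_eqI)
  fix m
  have "Poly_Mapping.lookup (m + Poly_Mapping.single i (1::nat)) i \<noteq> Poly_Mapping.lookup 0 i"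
    by (simp add: lookup_add)
  then have "m + Poly_Mapping.single i 1 \<noteq> 0" by metis
  then show "mcoeff (mderiv i (1 :: 'a mfps)) m = mcoeff 0 m"
    by (simp add: mcoeff_mderiv one_mfps.rep_eq zero_mfps.rep_eq)
qed

lemma mderiv_prod:
  assumes "finite A"
  shows "mderiv i (\<Prod>u\<in>A. f u) = (\<Sum>v\<in>A. \<Prod>u\<in>A. if u = v then mderiv i (f u) else f u)"
  using assms
proof (induction A rule: finite_induct)
  case (insert x A)
  have "(\<Prod>u\<in>A. if u = x then mderiv i (f u) else f u) = (\<Prod>u\<in>A. f u)"
    using insert(2) by (intro prod.cong) auto
  moreover have "(\<Sum>v\<in>A. \<Prod>u\<in>insert x A. if u = v then mderiv i (f u) else f u) =
      f x * (\<Sum>v\<in>A. \<Prod>u\<in>A. if u = v then mderiv i (f u) else f u)"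
    unfolding sum_distrib_left using insert by (intro sum.cong) auto
  ultimately show ?case using insert by (simp add: mderiv_mult)
qed simp

lemma mderiv_mvar: "mderiv i (mvar j) = (if i = j then 1 else 0 :: 'a::comm_ring_1 mfps)"
proof (rule mfps_eqI)
  fix m
  have "m + Poly_Mapping.single i (1::nat) = Poly_Mapping.single j 1 \<longleftrightarrow> i = j \<and> m = 0"
  proof
    assume h: "m + Poly_Mapping.single i (1::nat) = Poly_Mapping.single j 1"
    have "Poly_Mapping.lookup m i + 1 = Poly_Mapping.lookup (Poly_Mapping.single j (1::nat)) i"
      using arg_cong[OF h, of "\<lambda>m. Poly_Mapping.lookup m i"] by (simp add: lookup_add)
    then have "i = j" by (simp add: lookup_single when_def split: if_splits)
    then show "i = j \<and> m = 0" using h by simp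
  qed simp
  then show "mcoeff (mderiv i (mvar j)) m = mcoeff (if i = j then 1 else 0 :: 'a mfps) m"
    by (auto simp: mcoeff_mderiv mcoeff_mvar one_mfps.rep_eq zero_mfps.rep_eq)
qed

subsection \<open>Order of vanishing\<close>

lemma mdegree_alt: "finite K \<Longrightarrow> Poly_Mapping.keys m \<subseteq> K \<Longrightarrow> mdegree m = (\<Sum>i\<in>K. Poly_Mapping.lookup m i)"
  unfolding mdegree_def by (rule sum.mono_neutral_left) (auto simp: in_keys_iff)

lemma mdegree_add: "mdegree (a + b) = mdegree a + mdegree b"
proof -
  let ?K = "Poly_Mapping.keys a \<union> Poly_Mapping.keys b"
  have "Poly_Mapping.keys (a + b) \<subseteq> ?K" by (rule Poly_Mapping.keys_add)
  then show ?thesis by (simp add: mdegree_alt[of ?K] lookup_add sum.distrib)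
qed

lemma mdegree_single [simp]: "mdegree (Poly_Mapping.single i k) = k"
  by (simp add: mdegree_def)

definition order_ge :: "nat \<Rightarrow> 'a::comm_ring_1 mfps \<Rightarrow> bool" where
  "order_ge d f \<longleftrightarrow> (\<forall>m. mcoeff f m \<noteq> 0 \<longrightarrow> d \<le> mdegree m)"

lemma order_geD: "order_ge d f \<Longrightarrow> mdegree m < d \<Longrightarrow> mcoeff f m = 0"
  by (auto simp: order_ge_def)

lemma order_ge_trivial [simp]: "order_ge 0 f" by (simp add: order_ge_def)

lemma order_ge_0 [simp]: "order_ge d 0" by (simp add: order_ge_def mcoeff_arith)

lemma order_ge_mono: "order_ge d f \<Longrightarrow> d' \<le> d \<Longrightarrow> order_ge d' f"
  by (force simp: order_ge_def)

lemma order_ge_add: "order_ge d f \<Longrightarrow> order_ge d g \<Longrightarrow> order_ge d (f + g)"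
  by (force simp: order_ge_def mcoeff_arith)

lemma order_ge_diff: "order_ge d f \<Longrightarrow> order_ge d g \<Longrightarrow> order_ge d (f - g)"
  by (force simp: order_ge_def mcoeff_arith)

lemma order_ge_mscale: "order_ge d f \<Longrightarrow> order_ge d (mscale c f)"
  unfolding order_ge_def mcoeff_mscale by (metis mult_zero_right)

lemma order_ge_sum: "(\<And>x. x \<in> A \<Longrightarrow> order_ge d (f x)) \<Longrightarrow> order_ge d (sum f A)"
  by (induction A rule: infinite_finite_induct) (auto intro: order_ge_add)

lemma order_ge_mult: "order_ge c f \<Longrightarrow> order_ge d g \<Longrightarrow> order_ge (c + d) (f * g)"
  unfolding order_ge_def by (metis add_mono mcoeff_times_nonzeroE mdegree_add)

lemma order_ge_prod:
  "(\<And>x. x \<in> A \<Longrightarrow> order_ge (d x) (f x)) \<Longrightarrow> order_ge (\<Sum>x\<in>A. d x) (\<Prod>x\<in>A. f x)"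
  by (induction A rule: infinite_finite_induct) (auto intro: order_ge_mult)

lemma order_ge_mderiv:
  assumes "order_ge d f" shows "order_ge (d - 1) (mderiv i f)"
  unfolding order_ge_def
proof (intro allI impI)
  fix m assume "mcoeff (mderiv i f) m \<noteq> 0"
  then have "mcoeff f (m + Poly_Mapping.single i 1) \<noteq> 0" by (auto simp: mcoeff_mderiv)
  then have "d \<le> mdegree m + 1" using assms unfolding order_ge_def by (metis mdegree_add mdegree_single)
  then show "d - 1 \<le> mdegree m" by simp
qed

subsection \<open>Series in finitely many variables\<close>

lemma series_add: "f \<in> series n \<Longrightarrow> g \<in> series n \<Longrightarrow> f + g \<in> series n"
  by (force simp: series_def mcoeff_arith)

lemma series_mscale: "f \<in> series n \<Longrightarrow> mscale c f \<in> series n"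
  unfolding series_def mem_Collect_eq mcoeff_mscale by (metis mult_zero_right)

lemma series_0: "0 \<in> series n" by (auto simp: series_def mcoeff_arith)

lemma series_sum: "(\<And>x. x \<in> A \<Longrightarrow> f x \<in> series n) \<Longrightarrow> sum f A \<in> series n"
  by (induction A rule: infinite_finite_induct) (auto intro: series_add series_0)

lemma series_mult: assumes "f \<in> series n" "g \<in> series n" shows "f * g \<in> series n"
  unfolding series_def
proof (intro CollectI allI impI)
  fix m assume "mcoeff (f * g) m \<noteq> 0"
  then obtain a b where ab: "m = a + b" "mcoeff f a \<noteq> 0" "mcoeff g b \<noteq> 0"
    by (rule mcoeff_times_nonzeroE)
  then have "Poly_Mapping.keys a \<subseteq> {1..n}" "Poly_Mapping.keys b \<subseteq> {1..n}"
    using assms unfolding series_def by blast+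
  then show "Poly_Mapping.keys m \<subseteq> {1..n}" using Poly_Mapping.keys_add[of a b] ab(1) by blast
qed

lemma series_1: "1 \<in> series n" by (auto simp: series_def one_mfps.rep_eq)

lemma series_prod: "(\<And>x. x \<in> A \<Longrightarrow> f x \<in> series n) \<Longrightarrow> prod f A \<in> series n"
  by (induction A rule: infinite_finite_induct) (auto intro: series_mult series_1)

lemma series_mderiv: assumes "f \<in> series n" shows "mderiv i f \<in> series n"
  unfolding series_def
proof (intro CollectI allI impI subsetI)
  fix m j assume m: "mcoeff (mderiv i f) m \<noteq> 0" "j \<in> Poly_Mapping.keys m"
  from m(1) have "mcoeff f (m + Poly_Mapping.single i 1) \<noteq> 0" by (auto simp: mcoeff_mderiv)
  then have "Poly_Mapping.keys (m + Poly_Mapping.single i 1) \<subseteq> {1..n}"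
    using assms unfolding series_def by blast
  moreover have "j \<in> Poly_Mapping.keys (m + Poly_Mapping.single i 1)"
    using m(2) by (simp add: in_keys_iff lookup_add)
  ultimately show "j \<in> {1..n}" by blast
qed

lemma higher_alt: "higher n = {f \<in> series n. order_ge 2 f}"
  by (auto simp: higher_def order_ge_def)

subsection \<open>Derivations\<close>

lemma derivation_diff: "derivation n a (f - g) = derivation n a f - derivation n a g"
  and derivation_mscale: "derivation n a (mscale c f) = mscale c (derivation n a f)"
  and derivation_diff_left: "derivation n (\<lambda>j. a j - b j) f = derivation n a f - derivation n b f"
  and derivation_mscale_left: "derivation n (\<lambda>j. mscale c (a j)) f = mscale c (derivation n a f)"
  by (simp_all add: derivation_def mderiv_diff mderiv_mscale distrib_left right_diff_distrib
      left_diff_distrib sum.distrib sum_subtractf mscale_mult_right mscale_mult_left mscale_sum)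

lemma derivation_sum: "derivation n a (sum f A) = (\<Sum>x\<in>A. derivation n a (f x))"
  unfolding derivation_def mderiv_sum sum_distrib_left by (rule sum.swap)

lemma derivation_sum_left: "derivation n (\<lambda>j. \<Sum>x\<in>A. a x j) f = (\<Sum>x\<in>A. derivation n (a x) f)"
  unfolding derivation_def sum_distrib_right by (rule sum.swap)

lemma derivation_cong: "(\<And>j. j \<in> {1..n} \<Longrightarrow> a j = b j) \<Longrightarrow> derivation n a f = derivation n b f"
  unfolding derivation_def by (rule sum.cong) auto

lemma derivation_mvar: "i \<in> {1..n} \<Longrightarrow> derivation n a (mvar i) = a i"
  by (simp add: derivation_def mderiv_mvar if_distrib cong: if_cong)

text \<open>If the coefficients have order at least \<open>p + 1\<close>, then the derivation raises the order by \<open>p\<close>: the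
  factor contributes \<open>p + 1\<close>, and differentiation loses 1.\<close>

lemma order_ge_derivation:
  assumes "\<And>j. j \<in> {1..n} \<Longrightarrow> order_ge (p + 1) (a j)" "order_ge q f"
  shows "order_ge (p + q) (derivation n a f)"
  unfolding derivation_def
proof (rule order_ge_sum)
  fix j assume "j \<in> {1..n}"
  then have "order_ge (p + 1 + (q - 1)) (a j * mderiv j f)"
    by (intro order_ge_mult order_ge_mderiv assms)
  then show "order_ge (p + q) (a j * mderiv j f)" by (rule order_ge_mono) simp
qed

section \<open>Tree series\<close>

definition mderivs :: "('v \<Rightarrow> nat) \<Rightarrow> 'v set \<Rightarrow> 'a mfps \<Rightarrow> 'a::comm_ring_1 mfps" where
  "mderivs f A h = Finite_Set.fold (\<lambda>w. mderiv (f w)) h A"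

lemma mderivs_empty [simp]: "mderivs f {} h = h"
  by (simp add: mderivs_def)

lemma mderivs_insert:
  fixes h :: "'a::comm_ring_1 mfps"
  shows "finite A \<Longrightarrow> x \<notin> A \<Longrightarrow> mderivs f (insert x A) h = mderiv (f x) (mderivs f A h)"
proof -
  interpret comp_fun_commute "\<lambda>w. mderiv (f w) :: 'a mfps \<Rightarrow> 'a mfps"
    by unfold_locales (auto simp: fun_eq_iff mderiv_commute)
  show "finite A \<Longrightarrow> x \<notin> A \<Longrightarrow> mderivs f (insert x A) h = mderiv (f x) (mderivs f A h)"
    unfolding mderivs_def by (rule fold_insert)
qed

lemma mderivs_cong: "finite A \<Longrightarrow> (\<And>x. x \<in> A \<Longrightarrow> f x = g x) \<Longrightarrow> mderivs f A h = mderivs g A h"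
  by (induction A rule: finite_induct) (auto simp: mderivs_insert)

lemma mderivs_image: "finite A \<Longrightarrow> inj_on g A \<Longrightarrow> mderivs f (g ` A) h = mderivs (f \<circ> g) A h"
  by (induction A rule: finite_induct) (auto simp: mderivs_insert)

lemma order_ge_mderivs: "finite A \<Longrightarrow> order_ge d h \<Longrightarrow> order_ge (d - card A) (mderivs f A h)"
proof (induction A rule: finite_induct)
  case (insert x A)
  then have "order_ge (d - card A - 1) (mderiv (f x) (mderivs f A h))" by (intro order_ge_mderiv) auto
  then show ?case using insert by (simp add: mderivs_insert)
qed auto

lemma series_mderivs: "finite A \<Longrightarrow> h \<in> series n \<Longrightarrow> mderivs f A h \<in> series n"
  by (induction A rule: finite_induct) (auto simp: mderivs_insert series_mderiv)

lemma mderivs_0: "finite A \<Longrightarrow> mderivs f A 0 = 0"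
  by (induction A rule: finite_induct) (auto simp: mderivs_insert)

lemma finite_children: "rooted_tree T \<Longrightarrow> finite (children T u)"
  using rooted_treeD(1) children_subset finite_subset by metis

lemma labelled_series_alt:
  "labelled_series H T f = (\<Prod>u\<in>verts T. mderivs f (children T u) (H (f u)))"
  by (simp add: labelled_series_def mderivs_def)

lemma labelled_series_cong:
  assumes "rooted_tree T" "\<And>u. u \<in> verts T \<Longrightarrow> f u = g u"
  shows "labelled_series H T f = labelled_series H T g"
  unfolding labelled_series_alt
proof (rule prod.cong)
  fix u assume u: "u \<in> verts T"
  have "mderivs f (children T u) (H (f u)) = mderivs g (children T u) (H (f u))"
    using assms finite_children[OF assms(1)] children_subset[of T u] by (intro mderivs_cong) auto
  then show "mderivs f (children T u) (H (f u)) = mderivs g (children T u) (H (g u))"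
    using assms(2)[OF u] by simp
qed simp

lemma labelled_series_map_graph:
  assumes T: "rooted_tree T" and g: "inj_on g (verts T)"
  shows "labelled_series H (map_graph g T) f = labelled_series H T (f \<circ> g)"
proof -
  have "mderivs f (g ` children T u) (H (f (g u))) = mderivs (f \<circ> g) (children T u) (H (f (g u)))" for u
    by (rule mderivs_image[OF finite_children[OF T] inj_on_subset[OF g children_subset]])
  then show ?thesis
    unfolding labelled_series_alt map_graph_simps(1) prod.reindex[OF g]
    by (intro prod.cong) (simp_all add: children_map_graph[OF T g])
qed

lemma tree_series_map_graph:
  assumes T: "rooted_tree T" and g: "inj_on g (verts T)"
  shows "tree_series n H (map_graph g T) i = tree_series n H T i"
  unfolding tree_series_def
proof (rule sum.reindex_bij_witness[where
      i = "\<lambda>f. restrict (f \<circ> inv_into (verts T) g) (g ` verts T)" and j = "\<lambda>f. restrict (f \<circ> g) (verts T)"])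
  let ?h = "inv_into (verts T) g"
  note rt = rooted_treeD(2)[OF T]
  fix f assume "f \<in> {f \<in> verts (map_graph g T) \<rightarrow>\<^sub>E {1..n}. f (rt (map_graph g T)) = i}"
  then have f: "f \<in> g ` verts T \<rightarrow>\<^sub>E {1..n}" "f (g (rt T)) = i" by auto
  show "restrict (restrict (f \<circ> g) (verts T) \<circ> ?h) (g ` verts T) = f"
    using f(1) g by (auto simp: fun_eq_iff PiE_iff extensional_def f_inv_into_f inv_into_into)
  show "restrict (f \<circ> g) (verts T) \<in> {f \<in> verts T \<rightarrow>\<^sub>E {1..n}. f (rt T) = i}"
    using f rt by (auto simp: PiE_iff)
  have "labelled_series H T (restrict (f \<circ> g) (verts T)) = labelled_series H T (f \<circ> g)"
    by (rule labelled_series_cong[OF T]) simp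
  then show "labelled_series H T (restrict (f \<circ> g) (verts T)) = labelled_series H (map_graph g T) f"
    by (simp add: labelled_series_map_graph[OF T g])
next
  let ?h = "inv_into (verts T) g"
  fix f assume "f \<in> {f \<in> verts T \<rightarrow>\<^sub>E {1..n}. f (rt T) = i}"
  then have f: "f \<in> verts T \<rightarrow>\<^sub>E {1..n}" "f (rt T) = i" by auto
  show "restrict (restrict (f \<circ> ?h) (g ` verts T) \<circ> g) (verts T) = f"
    using f(1) g by (auto simp: fun_eq_iff PiE_iff extensional_def)
  show "restrict (f \<circ> ?h) (g ` verts T) \<in> {f \<in> verts (map_graph g T) \<rightarrow>\<^sub>E {1..n}. f (rt (map_graph g T)) = i}"
    using f rooted_treeD(2)[OF T] g by (auto simp: PiE_iff)
qed

subsection \<open>Order and variables\<close>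

lemma sum_card_children: "rooted_tree T \<Longrightarrow> (\<Sum>u\<in>verts T. card (children T u)) + 1 = card (verts T)"
proof (induction rule: rooted_tree_induct)
  case (single x)
  then show ?case by (simp add: children_single)
next
  case (graft T S v)
  interpret graftable T S v by fact
  note fin = rooted_treeD(1)[OF T] rooted_treeD(1)[OF S]
  have "(\<Sum>u\<in>verts T. card (children (graft T S v) u)) =
      (\<Sum>u\<in>verts T. card (children T u) + (if u = v then 1 else 0))"
  proof (rule sum.cong)
    fix u assume "u \<in> verts T"
    moreover have "rt S \<notin> children T v" using children_subset[of T v] rtS disj by auto
    ultimately show "card (children (graft T S v) u) = card (children T u) + (if u = v then 1 else 0)"
      using finite_children[OF T] by (simp add: children_graft_T)
  qed simp
  also have "\<dots> = (\<Sum>u\<in>verts T. card (children T u)) + 1"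
    using v fin by (simp add: sum.distrib)
  finally have "(\<Sum>u\<in>verts T. card (children (graft T S v) u)) = (\<Sum>u\<in>verts T. card (children T u)) + 1" .
  moreover have "(\<Sum>u\<in>verts S. card (children (graft T S v) u)) = (\<Sum>u\<in>verts S. card (children S u))"
    by (simp add: children_graft_S)
  ultimately show ?case
    using graft.IH fin disj by (simp add: sum.union_disjoint card_Un_disjoint)
qed

text \<open>Each vertex contributes a factor of order at least 2, from which every child takes away 1; and all
  vertices except the root are children.\<close>

lemma order_ge_labelled_series:
  assumes T: "rooted_tree T" and "\<And>u. u \<in> verts T \<Longrightarrow> order_ge 2 (H (f u))"
  shows "order_ge (card (verts T) + 1) (labelled_series H T f)"
proof -
  have "order_ge (\<Sum>u\<in>verts T. 2 - card (children T u)) (labelled_series H T f)"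
    unfolding labelled_series_alt
    by (intro order_ge_prod order_ge_mderivs finite_children assms)
  moreover have "(\<Sum>u\<in>verts T. 2) \<le> (\<Sum>u\<in>verts T. (2 - card (children T u)) + card (children T u))"
    by (rule sum_mono) simp
  then have "card (verts T) + 1 \<le> (\<Sum>u\<in>verts T. 2 - card (children T u))"
    using sum_card_children[OF T] by (simp add: sum.distrib)
  ultimately show ?thesis by (rule order_ge_mono)
qed

lemma order_ge_tree_series:
  assumes "rooted_tree T" "H \<in> {1..n} \<rightarrow> higher n"
  shows "order_ge (card (verts T) + 1) (tree_series n H T i)"
  unfolding tree_series_def
  by (intro order_ge_sum order_ge_labelled_series assms)
    (use assms(2) in \<open>auto simp: higher_alt PiE_iff Pi_iff\<close>)

lemma series_tree_series:
  assumes "rooted_tree T" "H \<in> {1..n} \<rightarrow> higher n"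
  shows "tree_series n H T i \<in> series n"
  unfolding tree_series_def labelled_series_alt
  by (intro series_sum series_prod series_mderivs finite_children assms)
    (use assms(2) in \<open>auto simp: higher_alt PiE_iff Pi_iff\<close>)

subsection \<open>Grafting and derivations\<close>

context graftable
begin

lemma labelled_series_graft:
  "labelled_series H (graft T S v) f = labelled_series H S f *
    (\<Prod>u\<in>verts T. if u = v then mderiv (f (rt S)) (mderivs f (children T u) (H (f u)))
      else mderivs f (children T u) (H (f u)))"
proof -
  have "rt S \<notin> children T v" using children_subset[of T v] rtS disj by auto
  then have "(\<Prod>u\<in>verts T. mderivs f (children (graft T S v) u) (H (f u))) =
    (\<Prod>u\<in>verts T. if u = v then mderiv (f (rt S)) (mderivs f (children T u) (H (f u)))
      else mderivs f (children T u) (H (f u)))"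
    using finite_children[OF T] by (intro prod.cong) (simp_all add: children_graft_T mderivs_insert)
  moreover have "(\<Prod>u\<in>verts S. mderivs f (children (graft T S v) u) (H (f u))) = labelled_series H S f"
    unfolding labelled_series_alt by (intro prod.cong) (simp_all add: children_graft_S)
  ultimately show ?thesis
    unfolding labelled_series_alt[of H "graft T S v"] graft_simps
    using rooted_treeD(1)[OF T] rooted_treeD(1)[OF S] disj
    by (simp add: prod.union_disjoint mult.commute)
qed

end

lemma sum_PiE_union:
  assumes "A \<inter> B = {}" "r \<in> A"
    and "\<And>f g h. (\<And>x. x \<in> A \<Longrightarrow> h x = f x) \<Longrightarrow> (\<And>x. x \<in> B \<Longrightarrow> h x = g x) \<Longrightarrow> F h = G f g"
  shows "(\<Sum>h | h \<in> A \<union> B \<rightarrow>\<^sub>E K \<and> h r = i. F h) =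
    (\<Sum>f | f \<in> A \<rightarrow>\<^sub>E K \<and> f r = i. \<Sum>g\<in>B \<rightarrow>\<^sub>E K. G f g)"
proof -
  have F: "F h = G (restrict h A) (restrict h B)" for h by (rule assms(3)) simp_all
  have "(\<Sum>h | h \<in> A \<union> B \<rightarrow>\<^sub>E K \<and> h r = i. F h) =
    (\<Sum>(f, g)\<in>{f. f \<in> A \<rightarrow>\<^sub>E K \<and> f r = i} \<times> (B \<rightarrow>\<^sub>E K). G f g)"
    by (rule sum.reindex_bij_witness[where j = "\<lambda>h. (restrict h A, restrict h B)" and
          i = "\<lambda>(f, g) x. if x \<in> A then f x else if x \<in> B then g x else undefined"])
      (use assms(1,2) in \<open>auto simp: F fun_eq_iff PiE_iff extensional_def split: if_splits\<close>)
  then show ?thesis by (simp add: sum.cartesian_product)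
qed

text \<open>By the product rule, applying the derivation with coefficients \<open>P\<^sub>S\<close> to \<open>P\<^sub>T\<close> differentiates
  the factor of one vertex \<open>v\<close> of \<open>T\<close> at a time, which makes the root of \<open>S\<close> a child of \<open>v\<close>.\<close>

lemma derivation_tree_series:
  assumes T: "rooted_tree T" and S: "rooted_tree S" and disj: "verts T \<inter> verts S = {}"
  shows "derivation n (tree_series n H S) (tree_series n H T i) =
    (\<Sum>v\<in>verts T. tree_series n H (graft T S v) i)"
proof -
  note fin = rooted_treeD(1)[OF T] rooted_treeD(1)[OF S]
  let ?FT = "{f. f \<in> verts T \<rightarrow>\<^sub>E {1..n} \<and> f (rt T) = i}" and ?FS = "verts S \<rightarrow>\<^sub>E {1..n}"
  \<comment> \<open>the labelled series of \<open>T\<close> with the factor of \<open>v\<close> differentiated once more\<close>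
  define X where "X v j f = (\<Prod>u\<in>verts T. if u = v then mderiv j (mderivs f (children T u) (H (f u)))
      else mderivs f (children T u) (H (f u)))" for v j f
  have finF: "finite ?FT" "finite ?FS"
    using fin by (auto intro!: finite_PiE finite_subset[of ?FT "verts T \<rightarrow>\<^sub>E {1..n}"])
  have X_cong: "X v j f = X v j f'" if "\<And>u. u \<in> verts T \<Longrightarrow> f u = f' u" for v j f f'
    unfolding X_def
  proof (rule prod.cong)
    fix u assume u: "u \<in> verts T"
    have "mderivs f (children T u) (H (f u)) = mderivs f' (children T u) (H (f u))"
      using that finite_children[OF T] children_subset[of T u] by (intro mderivs_cong) auto
    then show "(if u = v then mderiv j (mderivs f (children T u) (H (f u))) else mderivs f (children T u) (H (f u))) =
        (if u = v then mderiv j (mderivs f' (children T u) (H (f' u))) else mderivs f' (children T u) (H (f' u)))"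
      using that[OF u] by auto
  qed simp
  have graft: "tree_series n H (graft T S v) i = (\<Sum>f\<in>?FT. \<Sum>h\<in>?FS. labelled_series H S h * X v (h (rt S)) f)"
    if v: "v \<in> verts T" for v
  proof -
    interpret graftable T S v by unfold_locales fact+
    show ?thesis
      unfolding tree_series_def graft_simps
    proof (rule sum_PiE_union[OF disj rtT])
      fix f h and k :: "'a \<Rightarrow> nat" assume k: "\<And>x. x \<in> verts T \<Longrightarrow> k x = f x" "\<And>x. x \<in> verts S \<Longrightarrow> k x = h x"
      have "labelled_series H S k = labelled_series H S h" using k(2) by (rule labelled_series_cong[OF S])
      moreover have "X v (k (rt S)) k = X v (k (rt S)) f" using k(1) by (rule X_cong)
      ultimately show "labelled_series H (graft T S v) k = labelled_series H S h * X v (h (rt S)) f"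
        unfolding labelled_series_graft X_def[symmetric] k(2)[OF rtS] by simp
    qed
  qed
  have D: "mderiv j (labelled_series H T f) = (\<Sum>v\<in>verts T. X v j f)" for j f
    unfolding labelled_series_alt X_def using fin(1) by (rule mderiv_prod)
  have "(\<Sum>v\<in>verts T. tree_series n H (graft T S v) i) =
      (\<Sum>v\<in>verts T. \<Sum>f\<in>?FT. \<Sum>h\<in>?FS. labelled_series H S h * X v (h (rt S)) f)"
    using graft by (rule sum.cong[OF refl])
  also have "\<dots> = (\<Sum>h\<in>?FS. \<Sum>f\<in>?FT. \<Sum>v\<in>verts T. labelled_series H S h * X v (h (rt S)) f)"
    by (subst sum.swap, subst (2) sum.swap, subst sum.swap, rule refl)
  also have "\<dots> = (\<Sum>h\<in>?FS. labelled_series H S h * mderiv (h (rt S)) (tree_series n H T i))"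
    by (simp add: sum_distrib_left[symmetric] D[symmetric] mderiv_sum[symmetric] tree_series_def)
  also have "\<dots> = (\<Sum>j\<in>{1..n}. \<Sum>h | h \<in> ?FS \<and> h (rt S) = j. labelled_series H S h * mderiv (h (rt S)) (tree_series n H T i))"
    by (rule sum.group[symmetric]) (use finF rooted_treeD(2)[OF S] in \<open>auto simp: PiE_iff\<close>)
  also have "\<dots> = (\<Sum>j\<in>{1..n}. tree_series n H S j * mderiv j (tree_series n H T i))"
    unfolding tree_series_def[of n H S] sum_distrib_right by (intro sum.cong) auto
  finally show ?thesis by (simp add: derivation_def)
qed

section \<open>Weighted sums of tree series\<close>

text \<open>For invariant \<open>w\<close>, the sum of \<open>w T / \<alpha>\<^sub>T \<cdot> P\<^sub>T\<close> over the isomorphism classes of trees with \<open>N\<close> vertices, written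
  as a sum over labelled trees: an isomorphism class has \<open>N! / \<alpha>\<^sub>T\<close> members on a given vertex
  set. This form has no symmetry factors, so edges can be cut and joined freely.\<close>

definition tree_sum ::
  "nat \<Rightarrow> (nat \<Rightarrow> complex mfps) \<Rightarrow> (nat rgraph \<Rightarrow> complex) \<Rightarrow> nat \<Rightarrow> nat \<Rightarrow> complex mfps" where
  "tree_sum n H w N i = mscale (1 / fact N) (\<Sum>T\<in>trees {..<N}. mscale (w T) (tree_series n H T i))"

lemma tree_sum_eq:
  assumes w: "iso_invariant w" and V: "finite V"
  shows "(\<Sum>T\<in>trees V. mscale (w T) (tree_series n H T i)) = mscale (fact (card V)) (tree_sum n H w (card V) i)"
proof -
  obtain g where g: "bij_betw g {..<card V} V"
    using finite_same_card_bij[of "{..<card V}" V] V by auto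
  have "(\<Sum>T\<in>trees V. mscale (w T) (tree_series n H T i)) =
      (\<Sum>T\<in>trees {..<card V}. mscale (w (map_graph g T)) (tree_series n H (map_graph g T) i))"
    using g by (rule sum_trees_relabel)
  also have "\<dots> = (\<Sum>T\<in>trees {..<card V}. mscale (w T) (tree_series n H T i))"
    by (rule sum.cong)
      (use bij_betw_imp_inj_on[OF g] iso_invariantD[OF w] in \<open>auto simp: trees_def tree_series_map_graph\<close>)
  finally show ?thesis by (simp add: tree_sum_def mscale_mscale)
qed

text \<open>Grafting and cutting are inverse to each other. On the right, a tree with \<open>M\<close> vertices is grafted
  onto one with \<open>K - M\<close> vertices; on the left, an edge of a tree on \<open>K\<close> vertices is cut, which splits
  the vertex set. The binomial coefficient that counts the splittings is absorbed by the
  normalisation of \<open>tree_sum\<close>.\<close>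

lemma tree_sum_cut_conv:
  assumes w: "iso_invariant w" and x: "iso_invariant x"
  shows "tree_sum n H (cut_conv w x) K i =
    (\<Sum>M\<le>K. derivation n (tree_sum n H w M) (tree_sum n H x (K - M) i))"
proof -
  let ?P = "\<lambda>T. tree_series n H T i" and ?V = "{..<K}"
  let ?D = "\<lambda>M. derivation n (tree_sum n H w M) (tree_sum n H x (K - M) i)"
  have fin: "finite B" if "B \<in> Pow ?V" for B using that finite_subset by auto
  have "(\<Sum>U\<in>trees ?V. mscale (cut_conv w x U) (?P U)) =
      (\<Sum>U\<in>trees ?V. \<Sum>e\<in>edges U. mscale (w (branch_part U e) * x (root_part U e)) (?P U))"
  proof (rule sum.cong)
    fix U assume "U \<in> trees ?V"
    have "mscale (sum c A) f = (\<Sum>a\<in>A. mscale (c a) f)" for c :: "nat set \<Rightarrow> complex" and A f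
      by (induction A rule: infinite_finite_induct) (simp_all add: mscale_add_left)
    then show "mscale (cut_conv w x U) (?P U) =
        (\<Sum>e\<in>edges U. mscale (w (branch_part U e) * x (root_part U e)) (?P U))"
      by (simp add: cut_conv_def)
  qed simp
  also have "\<dots> = (\<Sum>B\<in>Pow ?V. \<Sum>S\<in>trees B. \<Sum>T\<in>trees (?V - B). \<Sum>v\<in>?V - B.
      mscale (w S * x T) (?P (graft T S v)))"
    using sum_trees_edges[of ?V "\<lambda>S T U. mscale (w S * x T) (?P U)"] by simp
  also have "\<dots> = (\<Sum>B\<in>Pow ?V. mscale (fact (card B) * fact (K - card B)) (?D (card B)))"
  proof (rule sum.cong)
    fix B assume B: "B \<in> Pow ?V"
    have card: "card (?V - B) = K - card B" using B fin by (simp add: card_Diff_subset)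
    have "(\<Sum>S\<in>trees B. \<Sum>T\<in>trees (?V - B). \<Sum>v\<in>?V - B. mscale (w S * x T) (?P (graft T S v))) =
        (\<Sum>S\<in>trees B. \<Sum>T\<in>trees (?V - B). derivation n (\<lambda>j. mscale (w S) (tree_series n H S j)) (mscale (x T) (?P T)))"
    proof (intro sum.cong refl)
      fix S T assume "S \<in> trees B" "T \<in> trees (?V - B)"
      then have ST: "rooted_tree T" "rooted_tree S" "verts T \<inter> verts S = {}" "verts T = ?V - B" by (auto simp: trees_def)
      show "(\<Sum>v\<in>?V - B. mscale (w S * x T) (?P (graft T S v))) =
          derivation n (\<lambda>j. mscale (w S) (tree_series n H S j)) (mscale (x T) (?P T))"
        using derivation_tree_series[OF ST(1-3), of n H i] unfolding ST(4)
        by (simp add: derivation_mscale derivation_mscale_left mscale_mscale mscale_sum mult.commute)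
    qed
    also have "\<dots> = derivation n (\<lambda>j. \<Sum>S\<in>trees B. mscale (w S) (tree_series n H S j)) (\<Sum>T\<in>trees (?V - B). mscale (x T) (?P T))"
      unfolding derivation_sum_left derivation_sum ..
    also have "\<dots> = mscale (fact (card B) * fact (K - card B)) (?D (card B))"
      unfolding tree_sum_eq[OF w fin[OF B]] tree_sum_eq[OF x, of "?V - B", simplified] card
      by (simp add: derivation_mscale derivation_mscale_left mscale_mscale mult.commute)
    finally show "(\<Sum>S\<in>trees B. \<Sum>T\<in>trees (?V - B). \<Sum>v\<in>?V - B. mscale (w S * x T) (?P (graft T S v))) =
        mscale (fact (card B) * fact (K - card B)) (?D (card B))" .
  qed simp
  also have "\<dots> = (\<Sum>M\<le>K. \<Sum>B | B \<in> Pow ?V \<and> card B = M. mscale (fact (card B) * fact (K - card B)) (?D (card B)))"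
    by (rule sum.group[symmetric]) (auto dest: card_mono[rotated])
  also have "\<dots> = (\<Sum>M\<le>K. mscale (fact K) (?D M))"
  proof (rule sum.cong)
    fix M assume M: "M \<in> {..K}"
    have "(\<Sum>B | B \<in> Pow ?V \<and> card B = M. mscale (fact (card B) * fact (K - card B)) (?D (card B))) =
        of_nat (K choose M) * mscale (fact M * fact (K - M)) (?D M)"
      using n_subsets[of ?V M] by simp
    also have "\<dots> = mscale (of_nat (K choose M) * (fact M * fact (K - M))) (?D M)"
    proof -
      have "of_nat c * f = mscale (of_nat c) f" for c and f :: "complex mfps"
        by (induction c) (simp_all add: mscale_add_left distrib_right)
      then show ?thesis by (simp add: mscale_mscale)
    qed
    also have "of_nat (K choose M) * (fact M * fact (K - M)) = (fact K :: complex)"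
      using M binomial_fact_lemma[of M K] by (metis atMost_iff mult.commute of_nat_fact of_nat_mult)
    finally show "(\<Sum>B | B \<in> Pow ?V \<and> card B = M. mscale (fact (card B) * fact (K - card B)) (?D (card B))) =
        mscale (fact K) (?D M)" .
  qed simp
  finally show ?thesis
    by (simp add: tree_sum_def[of n H "cut_conv w x"] mscale_sum mscale_mscale)
qed

lemma order_ge_tree_sum:
  assumes "H \<in> {1..n} \<rightarrow> higher n" shows "order_ge (N + 1) (tree_sum n H w N i)"
  unfolding tree_sum_def
  by (intro order_ge_mscale order_ge_sum) (use order_ge_tree_series[OF _ assms] in \<open>fastforce simp: trees_def\<close>)

lemma series_tree_sum:
  assumes "H \<in> {1..n} \<rightarrow> higher n" shows "tree_sum n H w N i \<in> series n"
  unfolding tree_sum_def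
  by (intro series_mscale series_sum) (use series_tree_series[OF _ assms] in \<open>auto simp: trees_def\<close>)

section \<open>Graded sums\<close>

text \<open>If the \<open>N\<close>-th term has order at least \<open>N\<close>, every coefficient of the infinite sum is a finite sum.\<close>

lemma mcoeff_msum_graded:
  assumes "\<And>N. order_ge N (u N)" "mdegree m \<le> d"
  shows "mcoeff (msum u) m = (\<Sum>N\<le>d. mcoeff (u N) m)"
  unfolding mcoeff_msum
proof (rule Sum_any.expand_superset)
  show "{N. mcoeff (u N) m \<noteq> 0} \<subseteq> {..d}"
  proof
    fix N assume "N \<in> {N. mcoeff (u N) m \<noteq> 0}"
    then have "N \<le> mdegree m" using assms(1)[of N] by (auto simp: order_ge_def)
    then show "N \<in> {..d}" using assms(2) by simp
  qed
qed simp

lemma order_ge_msum: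
  assumes "\<And>N. order_ge d (u N)" shows "order_ge d (msum u)"
  unfolding order_ge_def
proof (intro allI impI)
  fix m assume "mcoeff (msum u) m \<noteq> 0"
  then obtain N where "mcoeff (u N) m \<noteq> 0"
    unfolding mcoeff_msum by (rule Sum_any.not_neutral_obtains_not_neutral)
  then show "d \<le> mdegree m" using assms[of N] by (auto simp: order_ge_def)
qed

lemma series_msum:
  assumes "\<And>N. u N \<in> series n" shows "msum u \<in> series n"
  unfolding series_def
proof (intro CollectI allI impI)
  fix m assume "mcoeff (msum u) m \<noteq> 0"
  then obtain N where "mcoeff (u N) m \<noteq> 0"
    unfolding mcoeff_msum by (rule Sum_any.not_neutral_obtains_not_neutral)
  then show "Poly_Mapping.keys m \<subseteq> {1..n}" using assms[of N] by (auto simp: series_def)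
qed

text \<open>The orders rise fast enough that, up to any given degree, only finitely many terms of each of the two
  series matter. The finite sums multiply out, and are regrouped along the diagonals.\<close>

lemma derivation_msum:
  assumes u: "\<And>M j. j \<in> {1..n} \<Longrightarrow> order_ge (M + 1) (u M j)"
    and v: "\<And>N. order_ge (N + 1) (v N)"
  shows "derivation n (\<lambda>j. msum (\<lambda>M. u M j)) (msum v) =
    msum (\<lambda>K. \<Sum>M\<le>K. derivation n (u M) (v (K - M)))"
proof (rule mfps_eqI)
  fix m
  define d where "d = mdegree m"
  \<comment> \<open>truncations that agree with the infinite sums up to the degree of \<open>m\<close>\<close>
  define a where "a j = msum (\<lambda>M. u M j)" for j
  define a' where "a' j = (\<Sum>M\<le>d. u M j)" for j
  define g' where "g' = (\<Sum>N\<le>d. v N)"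
  have u': "order_ge M (u M j)" if "j \<in> {1..n}" for M j using order_ge_mono[OF u[OF that]] by simp
  have v': "order_ge N (v N)" for N using order_ge_mono[OF v] by simp
  have a: "order_ge 1 (a j)" "order_ge (d + 1) (a j - a' j)" if "j \<in> {1..n}" for j
  proof -
    show "order_ge 1 (a j)" unfolding a_def by (rule order_ge_msum) (rule order_ge_mono[OF u[OF that]], simp)
    show "order_ge (d + 1) (a j - a' j)"
      unfolding order_ge_def
    proof (intro allI impI, rule ccontr)
      fix k assume k: "mcoeff (a j - a' j) k \<noteq> 0" "\<not> d + 1 \<le> mdegree k"
      then have "mcoeff (a j) k = mcoeff (a' j) k"
        unfolding a_def a'_def mcoeff_sum by (intro mcoeff_msum_graded u' that) simp
      then show False using k(1) by (simp add: mcoeff_arith)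
    qed
  qed
  have g: "order_ge (d + 1) (msum v - g')"
    unfolding order_ge_def
  proof (intro allI impI, rule ccontr)
    fix k assume k: "mcoeff (msum v - g') k \<noteq> 0" "\<not> d + 1 \<le> mdegree k"
    then have "mcoeff (msum v) k = mcoeff g' k"
      unfolding g'_def mcoeff_sum by (intro mcoeff_msum_graded v') simp
    then show False using k(1) by (simp add: mcoeff_arith)
  qed
  have g': "order_ge 1 g'"
    unfolding g'_def by (rule order_ge_sum) (rule order_ge_mono[OF v], simp)
  have "derivation n a (msum v) - derivation n a' g' =
      derivation n a (msum v - g') + derivation n (\<lambda>j. a j - a' j) g'"
    by (simp add: derivation_diff derivation_diff_left)
  moreover have "order_ge (0 + (d + 1)) (derivation n a (msum v - g'))"
    by (rule order_ge_derivation[OF _ g]) (use a in simp)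
  moreover have "order_ge (d + 1) (derivation n (\<lambda>j. a j - a' j) g')"
    by (rule order_ge_derivation[OF _ g']) (use a in simp)
  ultimately have "order_ge (d + 1) (derivation n a (msum v) - derivation n a' g')"
    by (simp add: order_ge_add)
  then have "mcoeff (derivation n a (msum v)) m = mcoeff (derivation n a' g') m"
    using order_geD[of "d + 1" _ m] by (fastforce simp: d_def mcoeff_arith)
  also have "\<dots> = (\<Sum>M\<le>d. \<Sum>N\<le>d. mcoeff (derivation n (u M) (v N)) m)"
    unfolding a'_def g'_def derivation_sum_left derivation_sum mcoeff_sum by (rule sum.swap)
  also have "\<dots> = (\<Sum>(M, N)\<in>{..d} \<times> {..d}. mcoeff (derivation n (u M) (v N)) m)"
    by (rule sum.cartesian_product)
  also have "\<dots> = (\<Sum>(M, N)\<in>{(M, N). M + N \<le> d}. mcoeff (derivation n (u M) (v N)) m)"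
  proof (rule sum.mono_neutral_right)
    show "\<forall>p\<in>{..d} \<times> {..d} - {(M, N). M + N \<le> d}. (case p of (M, N) \<Rightarrow> mcoeff (derivation n (u M) (v N)) m) = 0"
    proof
      fix p assume "p \<in> {..d} \<times> {..d} - {(M, N). M + N \<le> d}"
      then obtain M N where p: "p = (M, N)" and "\<not> M + N \<le> d" by auto
      moreover have "order_ge (M + (N + 1)) (derivation n (u M) (v N))"
        by (rule order_ge_derivation) (use u v in auto)
      ultimately have "mcoeff (derivation n (u M) (v N)) m = 0"
        by (intro order_geD) (auto simp: d_def)
      then show "(case p of (M, N) \<Rightarrow> mcoeff (derivation n (u M) (v N)) m) = 0" by (simp add: p)
    qed
  qed auto
  also have "\<dots> = (\<Sum>K\<le>d. \<Sum>M\<le>K. mcoeff (derivation n (u M) (v (K - M))) m)"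
    by (rule sum.triangle_reindex_eq)
  also have "\<dots> = (\<Sum>K\<le>d. mcoeff (\<Sum>M\<le>K. derivation n (u M) (v (K - M))) m)"
    by (simp only: mcoeff_sum)
  also have "\<dots> = mcoeff (msum (\<lambda>K. \<Sum>M\<le>K. derivation n (u M) (v (K - M)))) m"
  proof (rule mcoeff_msum_graded[symmetric])
    fix K
    have "order_ge (M + (K - M + 1)) (derivation n (u M) (v (K - M)))" for M
      by (rule order_ge_derivation) (use u v in auto)
    then show "order_ge K (\<Sum>M\<le>K. derivation n (u M) (v (K - M)))"
      by (intro order_ge_sum) (rule order_ge_mono, auto)
  qed (simp add: d_def)
  finally show "mcoeff (derivation n (\<lambda>j. msum (\<lambda>M. u M j)) (msum v)) m =
      mcoeff (msum (\<lambda>K. \<Sum>M\<le>K. derivation n (u M) (v (K - M)))) m"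
    by (simp add: a_def[abs_def])
qed

section \<open>Uniqueness of the D-Log\<close>

lemma order_ge_derivation_power:
  assumes "\<And>j. j \<in> {1..n} \<Longrightarrow> order_ge 2 (a j)"
  shows "order_ge (k + 1) ((derivation n a ^^ k) (mvar i))"
proof (induction k)
  case 0
  show ?case by (auto simp: order_ge_def mcoeff_mvar)
next
  case (Suc k)
  have "order_ge (1 + (k + 1)) (derivation n a ((derivation n a ^^ k) (mvar i)))"
    by (rule order_ge_derivation[OF _ Suc]) (use assms in \<open>simp add: numeral_2_eq_2\<close>)
  then show ?case by simp
qed

lemma mcoeff_exp_derivation:
  fixes a :: "nat \<Rightarrow> complex mfps"
  assumes "\<And>j. j \<in> {1..n} \<Longrightarrow> order_ge 2 (a j)" "mdegree m \<le> d"
  shows "mcoeff (exp_derivation n a (mvar i)) m =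
    (\<Sum>k\<le>d. 1 / fact k * mcoeff ((derivation n a ^^ k) (mvar i)) m)"
proof -
  have "order_ge k (mscale (1 / fact k) ((derivation n a ^^ k) (mvar i)))" for k
    by (intro order_ge_mscale) (rule order_ge_mono[OF order_ge_derivation_power[OF assms(1)]], simp_all)
  then show ?thesis
    unfolding exp_derivation_def by (subst mcoeff_msum_graded[OF _ assms(2)]) (simp_all add: mcoeff_mscale)
qed

text \<open>If \<open>a\<close> and \<open>b\<close> agree below degree \<open>d\<close>, then \<open>A\<^sup>k z\<close> and \<open>B\<^sup>k z\<close> agree up to degree \<open>d\<close>
  for \<open>k \<ge> 2\<close>, so that the terms of degree \<open>d\<close> of \<open>a\<close> and \<open>b\<close> can be read off from the
  exponentials.\<close>

lemma exp_derivation_inj: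
  fixes a b :: "nat \<Rightarrow> complex mfps"
  assumes a: "\<And>j. j \<in> {1..n} \<Longrightarrow> order_ge 2 (a j)" and b: "\<And>j. j \<in> {1..n} \<Longrightarrow> order_ge 2 (b j)"
    and eq: "\<And>i. i \<in> {1..n} \<Longrightarrow> exp_derivation n a (mvar i) = exp_derivation n b (mvar i)"
    and i: "i \<in> {1..n}"
  shows "a i = b i"
proof -
  have step: "order_ge (d + 1) (a i - b i)" if d: "d \<ge> 2" and i: "i \<in> {1..n}"
    and IH: "\<And>j. j \<in> {1..n} \<Longrightarrow> order_ge d (a j - b j)" for d i
  proof -
    let ?A = "\<lambda>k. (derivation n a ^^ k) (mvar i)" and ?B = "\<lambda>k. (derivation n b ^^ k) (mvar i)"
    have diff: "order_ge (d + (if k = 0 then 0 else 1)) (?A (Suc k) - ?B (Suc k))" for k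
    proof (induction k)
      case 0
      show ?case using IH[OF i] by (simp add: derivation_mvar[OF i])
    next
      case (Suc k)
      have "?A (Suc (Suc k)) - ?B (Suc (Suc k)) =
          derivation n a (?A (Suc k) - ?B (Suc k)) + derivation n (\<lambda>j. a j - b j) (?B (Suc k))"
        by (simp add: derivation_diff derivation_diff_left)
      \<comment> \<open>\<open>A\<close> raises the order of the old difference by 1\<close>
      moreover have "order_ge (1 + (d + (if k = 0 then 0 else 1))) (derivation n a (?A (Suc k) - ?B (Suc k)))"
        by (rule order_ge_derivation[OF _ Suc]) (use a in \<open>simp add: numeral_2_eq_2\<close>)
      then have "order_ge (d + 1) (derivation n a (?A (Suc k) - ?B (Suc k)))"
        by (rule order_ge_mono) simp
      \<comment> \<open>\<open>A - B\<close> raises the order by \<open>d - 1\<close>, and \<open>B\<^sup>k z\<close> has order at least \<open>k + 1 \<ge> 2\<close>\<close>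
      moreover have "order_ge ((d - 1) + (Suc k + 1)) (derivation n (\<lambda>j. a j - b j) (?B (Suc k)))"
        by (rule order_ge_derivation[OF _ order_ge_derivation_power[OF b]]) (use IH d in simp_all)
      then have "order_ge (d + 1) (derivation n (\<lambda>j. a j - b j) (?B (Suc k)))"
        by (rule order_ge_mono) (use d in simp)
      ultimately show ?case by (simp add: order_ge_add)
    qed
    show ?thesis
      unfolding order_ge_def
    proof (intro allI impI, rule ccontr)
      fix m assume m: "mcoeff (a i - b i) m \<noteq> 0" "\<not> d + 1 \<le> mdegree m"
      have "mcoeff (?A k) m = mcoeff (?B k) m" if "k \<noteq> 1" for k
      proof (cases k)
        case (Suc k')
        then have "order_ge (d + 1) (?A k - ?B k)" using diff[of k'] that by simp
        then show ?thesis using m(2) order_geD[of "d + 1" "?A k - ?B k" m] by (simp add: mcoeff_arith)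
      qed simp
      then have "(\<Sum>k\<in>{..d} - {1}. 1 / fact k * mcoeff (?A k) m) = (\<Sum>k\<in>{..d} - {1}. 1 / fact k * mcoeff (?B k) m)"
        by (intro sum.cong) auto
      moreover have "(\<Sum>k\<le>d. 1 / fact k * mcoeff (?A k) m) = (\<Sum>k\<le>d. 1 / fact k * mcoeff (?B k) m)"
        using eq[OF i] mcoeff_exp_derivation[where n = n and a = a and m = m and d = d and i = i, OF a]
          mcoeff_exp_derivation[where n = n and a = b and m = m and d = d and i = i, OF b] m(2) by simp
      ultimately have "mcoeff (?A 1) m = mcoeff (?B 1) m"
        using d sum.remove[of "{..d}" 1 "\<lambda>k. 1 / fact k * mcoeff (?A k) m"]
          sum.remove[of "{..d}" 1 "\<lambda>k. 1 / fact k * mcoeff (?B k) m"] by simp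
      then show False using m(1) by (simp add: derivation_mvar[OF i] mcoeff_arith)
    qed
  qed
  have "\<forall>j\<in>{1..n}. order_ge (d + 2) (a j - b j)" for d
  proof (induction d)
    case 0
    show ?case unfolding add_0 using order_ge_diff[OF a b] by blast
  next
    case (Suc d)
    then show ?case using step[of "d + 2"] by simp
  qed
  then have "mcoeff (a i - b i) m = 0" for m
    using i order_geD[of "mdegree m + 2" "a i - b i" m] by auto
  then show ?thesis by (intro mfps_eqI) (simp add: mcoeff_arith)
qed

section \<open>The D-Log as a sum over trees\<close>

lemma of_rat_fact: "of_rat (fact k) = (fact k :: 'a::field_char_0)"
  by (metis of_nat_fact of_rat_of_nat_eq)

lemma cut_sum_of_rat:
  "cut_sum (\<lambda>T. of_rat (w T) :: 'a::field_char_0) r T = of_rat (cut_sum w r T)"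
  by (induction r arbitrary: T) (simp_all add: cut_sum_Suc cut_conv_def of_rat_sum of_rat_mult)

lemma tree_sum_cong:
  assumes "\<And>T. rooted_tree T \<Longrightarrow> card (verts T) = N \<Longrightarrow> w T = x T"
  shows "tree_sum n H w N i = tree_sum n H x N i"
proof -
  have "w T = x T" if "T \<in> trees {..<N}" for T
    using that by (intro assms) (auto simp: trees_def)
  then show ?thesis unfolding tree_sum_def by (metis (mono_tags, lifting) sum.cong)
qed

lemma tree_sum_0: "tree_sum n H (\<lambda>_. 0) N i = 0"
  by (simp add: tree_sum_def)

lemma tree_sum_linear:
  "tree_sum n H (\<lambda>T. \<Sum>k\<in>A. c k * w k T) N i = (\<Sum>k\<in>A. mscale (c k) (tree_sum n H (w k) N i))"
  by (induction A rule: infinite_finite_induct)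
    (simp_all add: tree_sum_def mscale_add_left mscale_sum mscale_add sum.distrib mscale_mscale mult.left_commute)

lemma tree_sum_single_vertex:
  assumes "i \<in> {1..n}"
  shows "tree_sum n H (\<lambda>T. if card (verts T) = 1 then 1 else 0) N i = (if N = 1 then H i else 0)"
proof (cases "N = 1")
  case True
  let ?T = "RGraph {0} {} (0 :: nat)"
  have "T = ?T" if T: "T \<in> trees {0 :: nat}" for T
  proof -
    have T': "rooted_tree T" "verts T = {0}" using T by (auto simp: trees_def)
    have "edges T = {}"
    proof (rule ccontr)
      assume "edges T \<noteq> {}"
      then obtain e where "e \<in> edges T" by blast
      then have e: "e \<subseteq> {0}" "card e = 2" using rooted_treeD(3,4)[OF T'(1), of e] T'(2) by auto
      then have "card e \<le> 1" using card_mono[of "{0}" e] by simp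
      then show False using e(2) by simp
    qed
    moreover have "rt T = 0" using rooted_treeD(2)[OF T'(1)] T'(2) by simp
    ultimately show ?thesis using T'(2) by (intro rgraph.expand) simp
  qed
  then have "trees {0 :: nat} = {?T}" using rooted_tree_singleton[of 0] by (auto simp: trees_def)
  moreover have "tree_series n H ?T i = H i"
  proof -
    have "{f \<in> {0 :: nat} \<rightarrow>\<^sub>E {1..n}. f 0 = i} = {\<lambda>x. if x = 0 then i else undefined}"
      using assms by (auto simp: fun_eq_iff PiE_iff extensional_def)
    then show ?thesis by (simp add: tree_series_def labelled_series_alt children_single)
  qed
  ultimately show ?thesis using True by (simp add: tree_sum_def lessThan_Suc)
next
  case False
  then have "tree_sum n H (\<lambda>T. if card (verts T) = 1 then 1 else 0) N i = tree_sum n H (\<lambda>_. 0) N i"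
    by (intro tree_sum_cong) simp
  then show ?thesis using False by (simp add: tree_sum_0)
qed

abbreviation cphi :: "nat rgraph \<Rightarrow> complex" where
  "cphi \<equiv> \<lambda>T. of_rat (phi T)"

lemma iso_invariant_cut_sum_cphi: "iso_invariant (cut_sum cphi k)"
  by (rule iso_invariant_cut_sum) (simp add: iso_invariant_def phi_map_graph)

lemma tree_sum_cut_sum_eq_0: "N \<le> k \<Longrightarrow> tree_sum n H (cut_sum w k) N i = 0"
  using tree_sum_cong[of N "cut_sum w k" "\<lambda>_. 0" n H i] by (simp add: cut_sum_eq_0 tree_sum_0)

text \<open>The candidate for the D-Log, \<open>\<Sum>\<^sub>T \<phi>\<^sub>T \<P>\<^sub>T\<close>, collected by the number of vertices.\<close>

definition tree_log :: "nat \<Rightarrow> (nat \<Rightarrow> complex mfps) \<Rightarrow> nat \<Rightarrow> complex mfps" where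
  "tree_log n H = (\<lambda>i\<in>{1..n}. msum (\<lambda>N. tree_sum n H cphi N i))"

context
  fixes n and H :: "nat \<Rightarrow> complex mfps"
  assumes H: "H \<in> {1..n} \<rightarrow> higher n"
begin

lemma tree_log_higher: "tree_log n H \<in> {1..n} \<rightarrow>\<^sub>E higher n"
proof -
  have "msum (\<lambda>N. tree_sum n H cphi N i) \<in> higher n" for i
  proof -
    have "order_ge 2 (tree_sum n H cphi N i)" for N
    proof (cases "N = 0")
      case True
      then show ?thesis using tree_sum_cut_sum_eq_0[of 0 0 n H cphi i] by simp
    next
      case False
      then show ?thesis using order_ge_mono[OF order_ge_tree_sum[OF H, of N cphi i], of 2] by simp
    qed
    then show ?thesis
      unfolding higher_alt using series_tree_sum[OF H] by (auto intro: order_ge_msum series_msum)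
  qed
  then show ?thesis by (auto simp: tree_log_def)
qed

lemma order_ge_tree_log: "j \<in> {1..n} \<Longrightarrow> order_ge 2 (tree_log n H j)"
  using tree_log_higher by (auto simp: higher_alt PiE_iff)

text \<open>Each application of the derivation grafts one more tree, that is, adds one more cut to the sequences.\<close>

lemma derivation_power_tree_log:
  assumes i: "i \<in> {1..n}"
  shows "(derivation n (tree_log n H) ^^ Suc k) (mvar i) = msum (\<lambda>N. tree_sum n H (cut_sum cphi k) N i)"
proof (induction k)
  case 0
  show ?case using i by (simp add: derivation_mvar tree_log_def)
next
  case (Suc k)
  have "(derivation n (tree_log n H) ^^ Suc (Suc k)) (mvar i) =
      derivation n (tree_log n H) (msum (\<lambda>N. tree_sum n H (cut_sum cphi k) N i))"
    using Suc by simp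
  also have "\<dots> = derivation n (\<lambda>j. msum (\<lambda>N. tree_sum n H cphi N j)) (msum (\<lambda>N. tree_sum n H (cut_sum cphi k) N i))"
    by (rule derivation_cong) (simp add: tree_log_def)
  also have "\<dots> = msum (\<lambda>N. tree_sum n H (cut_sum cphi (Suc k)) N i)"
    unfolding cut_sum_Suc
      tree_sum_cut_conv[OF iso_invariant_cut_sum_cphi[of 0, unfolded cut_sum_0] iso_invariant_cut_sum_cphi]
    by (rule derivation_msum) (rule order_ge_tree_sum[OF H])+
  finally show ?case .
qed

lemma mcoeff_derivation_power_tree_log:
  assumes i: "i \<in> {1..n}" and d: "mdegree m \<le> d"
  shows "mcoeff ((derivation n (tree_log n H) ^^ Suc k) (mvar i)) m =
    (\<Sum>N\<le>d. mcoeff (tree_sum n H (cut_sum cphi k) N i) m)"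
  unfolding derivation_power_tree_log[OF i]
  by (rule mcoeff_msum_graded[OF _ d]) (rule order_ge_mono[OF order_ge_tree_sum[OF H]], simp)

text \<open>Summing over the powers first, the weight of every tree with at least two vertices cancels by
  \<open>sum_cut_sum_phi\<close>, and the tree with one vertex contributes \<open>H\<close>.\<close>

lemma exp_tree_log:
  assumes i: "i \<in> {1..n}"
  shows "exp_derivation n (tree_log n H) (mvar i) = mvar i + H i"
proof (rule mfps_eqI)
  fix m
  \<comment> \<open>at least 1, so that the sums up to \<open>d\<close> include the tree with one vertex\<close>
  define d where "d = Suc (mdegree m)"
  have d: "mdegree m \<le> d" by (simp add: d_def)
  let ?w = "\<lambda>T. \<Sum>k\<le>d. 1 / fact (Suc k) * cut_sum cphi k T"
  have w: "?w T = (if card (verts T) = 1 then 1 else 0)" if T: "rooted_tree T" "card (verts T) \<le> d" for T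
  proof -
    have "?w T = (\<Sum>k<card (verts T). 1 / fact (Suc k) * cut_sum cphi k T)"
      by (rule sum.mono_neutral_right) (use T in \<open>auto simp: cut_sum_eq_0\<close>)
    also have "\<dots> = of_rat (\<Sum>k<card (verts T). 1 / fact (Suc k) * cut_sum phi k T)"
      by (simp add: cut_sum_of_rat of_rat_sum of_rat_mult of_rat_divide of_rat_fact del: fact_Suc)
    also have "(\<Sum>k<card (verts T). 1 / fact (Suc k) * cut_sum phi k T) = (\<Sum>k = 1..card (verts T). 1 / fact k * cut_sum phi (k - 1) T)"
      by (rule sum.reindex_bij_witness[where i = "\<lambda>k. k - 1" and j = Suc]) auto
    finally show ?thesis using sum_cut_sum_phi[OF T(1)] by simp
  qed
  have "mcoeff (exp_derivation n (tree_log n H) (mvar i)) m =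
      (\<Sum>k\<le>Suc d. 1 / fact k * mcoeff ((derivation n (tree_log n H) ^^ k) (mvar i)) m)"
    by (rule mcoeff_exp_derivation) (use order_ge_tree_log d in auto)
  also have "\<dots> = mcoeff (mvar i) m + (\<Sum>k\<le>d. 1 / fact (Suc k) * mcoeff ((derivation n (tree_log n H) ^^ Suc k) (mvar i)) m)"
    by (subst sum.atMost_Suc_shift) (simp del: fact_Suc funpow.simps(2))
  also have "(\<Sum>k\<le>d. 1 / fact (Suc k) * mcoeff ((derivation n (tree_log n H) ^^ Suc k) (mvar i)) m) =
      (\<Sum>N\<le>d. mcoeff (\<Sum>k\<le>d. mscale (1 / fact (Suc k)) (tree_sum n H (cut_sum cphi k) N i)) m)"
    unfolding mcoeff_derivation_power_tree_log[OF i d] mcoeff_sum mcoeff_mscale sum_distrib_left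
    by (rule sum.swap)
  also have "\<dots> = (\<Sum>N\<le>d. mcoeff (if N = 1 then H i else 0) m)"
    unfolding tree_sum_linear[symmetric] tree_sum_single_vertex[OF i, symmetric]
    by (intro sum.cong refl arg_cong[where f = "\<lambda>f. mcoeff f m"] tree_sum_cong) (use w in auto)
  also have "\<dots> = mcoeff (H i) m"
    by (simp add: if_distrib[of "\<lambda>f. mcoeff f m"] mcoeff_arith d_def cong: if_cong)
  finally show "mcoeff (exp_derivation n (tree_log n H) (mvar i)) m = mcoeff (mvar i + H i) m"
    by (simp add: mcoeff_arith)
qed

lemma D_Log_eq_tree_log: "D_Log n (\<lambda>j. mvar j + H j) = tree_log n H"
  unfolding D_Log_def
proof (rule the_equality)
  show "tree_log n H \<in> {1..n} \<rightarrow>\<^sub>E higher n \<and>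
      (\<forall>i\<in>{1..n}. exp_derivation n (tree_log n H) (mvar i) = mvar i + H i)"
    using tree_log_higher exp_tree_log by blast
next
  fix a assume a: "a \<in> {1..n} \<rightarrow>\<^sub>E higher n \<and> (\<forall>i\<in>{1..n}. exp_derivation n a (mvar i) = mvar i + H i)"
  show "a = tree_log n H"
  proof (rule PiE_ext[of _ _ "\<lambda>_. higher n"])
    fix i assume i: "i \<in> {1..n}"
    show "a i = tree_log n H i"
      by (rule exp_derivation_inj[OF _ order_ge_tree_log _ i])
        (use a exp_tree_log in \<open>auto simp: higher_alt PiE_iff\<close>)
  qed (use a tree_log_higher in auto)
qed

end

section \<open>The formal flow\<close>

lemma mcoeff_const_t: "mcoeff (const_t f) m = [:mcoeff f m:]"
  by (simp add: const_t_def mcoeff_mmap)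

lemma pCons_sum: "[:\<Sum>x\<in>A. f x:] = (\<Sum>x\<in>A. [:f x:])"
proof (induction A rule: infinite_finite_induct)
  case (insert x A)
  have "[:f x + sum f A:] = [:f x:] + [:sum f A:]" by simp
  then show ?case using insert by simp
qed simp_all

lemma const_t_times: "const_t (f * g) = const_t f * const_t g"
  by (rule mfps_eqI) (simp add: mcoeff_const_t mcoeff_times pCons_sum case_prod_unfold mult.commute)

lemma const_t_sum: "const_t (sum f A) = (\<Sum>x\<in>A. const_t (f x))"
  by (rule mfps_eqI) (simp add: mcoeff_const_t mcoeff_sum pCons_sum)

lemma const_t_mderiv: "const_t (mderiv i f) = mderiv i (const_t f)"
proof (rule mfps_eqI)
  fix m
  show "mcoeff (const_t (mderiv i f)) m = mcoeff (mderiv i (const_t f)) m"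
    unfolding mcoeff_const_t mcoeff_mderiv of_nat_poly by simp
qed

lemma const_t_mvar: "const_t (mvar i) = mvar i"
  by (rule mfps_eqI) (simp add: mcoeff_const_t mcoeff_mvar)

text \<open>The indeterminate \<open>t\<close> is a constant for all partial derivatives, so \<open>(t A)\<^sup>k = t\<^sup>k A\<^sup>k\<close>.\<close>

lemma derivation_power_const_t:
  "(derivation n (\<lambda>j. mscale [:0, 1:] (const_t (a j))) ^^ k) (const_t g) =
    mscale (monom 1 k) (const_t ((derivation n a ^^ k) g))"
proof (induction k)
  case (Suc k)
  have "monom 1 (Suc k) = (monom 1 k * [:0, 1:] :: complex poly)" by (simp add: monom_Suc)
  moreover have "derivation n (\<lambda>j. const_t (a j)) (const_t f) = const_t (derivation n a f)" for f
    by (simp add: derivation_def const_t_sum const_t_times const_t_mderiv)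
  ultimately show ?case
    using Suc by (simp add: derivation_mscale derivation_mscale_left mscale_mscale)
qed simp

lemma coeff_flow:
  assumes H: "H \<in> {1..n} \<rightarrow> higher n"
  shows "coeff (mcoeff (flow n (\<lambda>j. mvar j + H j) i) m) k =
    mcoeff ((derivation n (tree_log n H) ^^ k) (mvar i)) m / fact k"
proof -
  let ?A = "\<lambda>k. (derivation n (tree_log n H) ^^ k) (mvar i)"
  let ?d = "max k (mdegree m)"
  have "flow n (\<lambda>j. mvar j + H j) i = msum (\<lambda>k. mscale (monom (1 / fact k) k) (const_t (?A k)))"
    unfolding flow_def exp_derivation_def D_Log_eq_tree_log[OF H]
      const_t_mvar[symmetric, of i] derivation_power_const_t one_div_fact_complex_poly mscale_mscale
    by (simp add: const_t_mvar smult_monom)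
  also have "mcoeff \<dots> m = (\<Sum>l\<le>?d. mcoeff (mscale (monom (1 / fact l) l) (const_t (?A l))) m)"
  proof (rule mcoeff_msum_graded)
    fix l
    have "order_ge l (?A l)"
      by (rule order_ge_mono[OF order_ge_derivation_power]) (use order_ge_tree_log[OF H] in auto)
    then have "order_ge l (const_t (?A l))" by (simp add: order_ge_def mcoeff_const_t)
    then show "order_ge l (mscale (monom (1 / fact l) l) (const_t (?A l)))" by (rule order_ge_mscale)
  qed simp
  also have "\<dots> = (\<Sum>l\<le>?d. monom (mcoeff (?A l) m / fact l) l)"
    by (simp add: mcoeff_mscale mcoeff_const_t smult_monom)
  finally show ?thesis by (simp add: coeff_sum)
qed

text \<open>Only trees with at most \<open>d\<close> vertices contribute in degree \<open>d\<close>, so the sum over all trees is finite.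
  The formula serves both the existence and the uniqueness of the expansion.\<close>

lemma coeff_tree_expansion:
  fixes \<psi> :: "rtree \<Rightarrow> rat poly"
  assumes H: "H \<in> {1..n} \<rightarrow> higher n" and d: "mdegree m \<le> d"
  shows "coeff (mcoeff (msum (\<lambda>T. mscale (map_poly of_rat (\<psi> T))
      (const_t (norm_tree_series n H (rep_rtree T) i)))) m) k =
    (\<Sum>T | card (verts (rep_rtree T)) \<le> d. of_rat (coeff (\<psi> T) k) *
      (mcoeff (tree_series n H (rep_rtree T) i) m / of_nat (num_auts (rep_rtree T))))"
proof -
  let ?C = "{T. card (verts (rep_rtree T)) \<le> d}"
  have fin: "finite ?C" by (rule finite_rtree_card_le)
  have "mcoeff (msum (\<lambda>T. mscale (map_poly of_rat (\<psi> T)) (const_t (norm_tree_series n H (rep_rtree T) i)))) m =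
    (\<Sum>T\<in>?C. mcoeff (mscale (map_poly of_rat (\<psi> T)) (const_t (norm_tree_series n H (rep_rtree T) i))) m)"
    unfolding mcoeff_msum
  proof (rule Sum_any.expand_superset[OF fin])
    show "{T. mcoeff (mscale (map_poly of_rat (\<psi> T)) (const_t (norm_tree_series n H (rep_rtree T) i))) m \<noteq> 0} \<subseteq> ?C"
    proof
      fix T assume "T \<in> {T. mcoeff (mscale (map_poly of_rat (\<psi> T)) (const_t (norm_tree_series n H (rep_rtree T) i))) m \<noteq> 0}"
      then have "mcoeff (tree_series n H (rep_rtree T) i) m \<noteq> 0"
        by (auto simp: mcoeff_mscale mcoeff_const_t norm_tree_series_def)
      then have "card (verts (rep_rtree T)) + 1 \<le> mdegree m"
        using order_ge_tree_series[OF rooted_tree_rep_rtree H, of T i] unfolding order_ge_def by blast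
      then show "T \<in> ?C" using d by simp
    qed
  qed
  then show ?thesis
    by (simp add: coeff_sum mcoeff_mscale mcoeff_const_t norm_tree_series_def coeff_map_poly mult.commute)
qed

definition flow_poly :: "'v rgraph \<Rightarrow> rat poly" where
  "flow_poly T = (\<Sum>k = 1..card (verts T). monom (1 / fact k * cut_sum phi (k - 1) T) k)"

lemma coeff_flow_poly:
  assumes "rooted_tree T"
  shows "coeff (flow_poly T) k = (if k = 0 then 0 else 1 / fact k * cut_sum phi (k - 1) T)"
proof -
  have "coeff (flow_poly T) k = (if k \<in> {1..card (verts T)} then 1 / fact k * cut_sum phi (k - 1) T else 0)"
    unfolding flow_poly_def by (simp add: coeff_sum)
  then show ?thesis using cut_sum_eq_0[OF assms, of "k - 1" phi] by auto
qed

lemma flow_expansion_flow_poly: "flow_expansion (\<lambda>T. flow_poly (rep_rtree T))"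
  unfolding flow_expansion_def
proof (intro allI impI ballI)
  fix n :: nat and H :: "nat \<Rightarrow> complex mfps" and i
  assume n: "1 \<le> n" and H: "H \<in> {1..n} \<rightarrow> higher n" and i: "i \<in> {1..n}"
  let ?R = "msum (\<lambda>T. mscale (map_poly of_rat (flow_poly (rep_rtree T)))
      (const_t (norm_tree_series n H (rep_rtree T) i)))"
  show "flow n (\<lambda>j. mvar j + H j) i = mvar i + ?R"
  proof (intro mfps_eqI poly_eqI)
    fix m k
    define d where "d = mdegree m"
    let ?y = "\<lambda>T. of_rat (coeff (flow_poly T) k) * mcoeff (tree_series n H T i) m"
    have R: "coeff (mcoeff ?R m) k = (\<Sum>T | card (verts (rep_rtree T)) \<le> d. ?y (rep_rtree T) / of_nat (num_auts (rep_rtree T)))"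
      unfolding coeff_tree_expansion[OF H order_refl] d_def by simp
    show "coeff (mcoeff (flow n (\<lambda>j. mvar j + H j) i) m) k = coeff (mcoeff (mvar i + ?R) m) k"
    proof (cases k)
      case 0
      have "coeff (mcoeff ?R m) k = 0"
        unfolding R using 0 by (simp add: coeff_flow_poly rooted_tree_rep_rtree)
      then show ?thesis
        using 0 by (simp add: coeff_flow[OF H] mcoeff_arith mcoeff_mvar)
    next
      case (Suc l)
      have y: "?y T = 1 / fact k * (cut_sum cphi l T * mcoeff (tree_series n H T i) m)" if "rooted_tree T" for T
        using that Suc by (simp add: coeff_flow_poly cut_sum_of_rat of_rat_mult of_rat_divide of_rat_fact del: fact_Suc)
      have inv: "iso_invariant (\<lambda>T. cut_sum cphi l T * mcoeff (tree_series n H T i) m)"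
        unfolding iso_invariant_def
        using iso_invariant_cut_sum_cphi[of l] by (simp add: iso_invariant_def tree_series_map_graph)
      have "coeff (mcoeff ?R m) k = (\<Sum>N\<le>d. \<Sum>T | card (verts (rep_rtree T)) = N. ?y (rep_rtree T) / of_nat (num_auts (rep_rtree T)))"
      proof -
        have "{T. card (verts (rep_rtree T)) \<le> d} = (\<Union>N\<le>d. {T. card (verts (rep_rtree T)) = N})" by auto
        then show ?thesis
          unfolding R by (simp only:) (rule sum.UNION_disjoint, auto simp: finite_rtree_card)
      qed
      also have "\<dots> = (\<Sum>N\<le>d. 1 / fact k * mcoeff (tree_sum n H (cut_sum cphi l) N i) m)"
      proof (rule sum.cong)
        fix N
        have "(\<Sum>T | card (verts (rep_rtree T)) = N. ?y (rep_rtree T) / of_nat (num_auts (rep_rtree T))) =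
            1 / fact k * (\<Sum>T | card (verts (rep_rtree T)) = N.
              cut_sum cphi l (rep_rtree T) * mcoeff (tree_series n H (rep_rtree T) i) m / of_nat (num_auts (rep_rtree T)))"
          unfolding sum_distrib_left by (rule sum.cong) (simp_all add: y[OF rooted_tree_rep_rtree])
        also have "\<dots> = 1 / fact k * ((\<Sum>T\<in>trees {..<N}. cut_sum cphi l T * mcoeff (tree_series n H T i) m) / fact N)"
          using sum_trees_rtree[OF inv, of "{..<N}"] by simp
        finally show "(\<Sum>T | card (verts (rep_rtree T)) = N. ?y (rep_rtree T) / of_nat (num_auts (rep_rtree T))) =
            1 / fact k * mcoeff (tree_sum n H (cut_sum cphi l) N i) m"
          by (simp add: tree_sum_def mcoeff_mscale mcoeff_sum)
      qed simp
      also have "\<dots> = coeff (mcoeff (flow n (\<lambda>j. mvar j + H j) i) m) k"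
        unfolding coeff_flow[OF H] Suc mcoeff_derivation_power_tree_log[OF H i order_refl] d_def
        by (simp add: sum_divide_distrib)
      finally show ?thesis using Suc by (simp add: mcoeff_arith mcoeff_mvar)
    qed
  qed
qed

section \<open>Isomorphisms and children\<close>

lemma verts_subset_if_children_closed:
  "rooted_tree T \<Longrightarrow> rt T \<in> A \<Longrightarrow> (\<And>u. u \<in> verts T \<Longrightarrow> u \<in> A \<Longrightarrow> children T u \<subseteq> A) \<Longrightarrow> verts T \<subseteq> A"
proof (induction rule: rooted_tree_induct)
  case (graft T S v)
  interpret graftable T S v by fact
  have closedT: "children T u \<subseteq> A" if "u \<in> verts T" "u \<in> A" for u
    using graft.prems(2)[of u] that by (auto simp: children_graft_T split: if_splits)
  then have VT: "verts T \<subseteq> A" using graft.IH(1) graft.prems(1) by simp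
  then have "rt S \<in> A" using graft.prems(2)[of v] v by (auto simp: children_graft_T)
  moreover have "children S u \<subseteq> A" if "u \<in> verts S" "u \<in> A" for u
    using graft.prems(2)[of u] that by (simp add: children_graft_S)
  ultimately have "verts S \<subseteq> A" by (rule graft.IH(2))
  then show ?case using VT by simp
qed simp

lemma edge_is_child:
  assumes "rooted_tree T" "e \<in> edges T"
  obtains u w where "e = {u, w}" "u \<in> verts T" "w \<in> children T u"
proof -
  from graft_parts[OF assms] obtain v where gv: "graftable (root_part T e) (branch_part T e) v"
    "e = {v, rt (branch_part T e)}" .
  have "v \<in> verts (root_part T e)" by (rule graftable.v[OF gv(1)])
  then have r: "reach (edges T - {e}) (rt T) v" by (simp add: root_part_def component_def Let_def)
  have "rt (branch_part T e) \<in> children T v"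
    unfolding children_iff[OF assms(1)] gv(2)[symmetric] using r assms(2) by simp
  moreover have "v \<in> verts T" using rooted_treeD(3)[OF assms] gv(2) by auto
  ultimately show thesis using that gv(2) by blast
qed

lemma child_is_edge: "w \<in> children T u \<Longrightarrow> {u, w} \<in> edges T"
  by (simp add: children_def)

text \<open>A map that sends the root to the root and the children of each vertex bijectively to the children of
  its image is onto, as the image contains the root and is closed under children. If the numbers of
  vertices agree, it is therefore an isomorphism.\<close>

lemma isos_iff_children:
  assumes T: "rooted_tree T" and T0: "rooted_tree T0"
  shows "f \<in> isos T T0 \<longleftrightarrow> f \<in> extensional (verts T) \<and> f ` verts T \<subseteq> verts T0 \<and> f (rt T) = rt T0 \<and>
    card (verts T) = card (verts T0) \<and>
    (\<forall>u\<in>verts T. inj_on f (children T u) \<and> f ` children T u = children T0 (f u))"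
    (is "_ \<longleftrightarrow> ?R")
proof
  assume f: "f \<in> isos T T0"
  then have f': "inj_on f (verts T)" "map_graph f T = T0" "f \<in> extensional (verts T)" by (auto simp: isos_def)
  have "inj_on f (children T u)" for u using f'(1) children_subset by (rule inj_on_subset)
  then show ?R
    using f' children_map_graph[OF T f'(1)] card_image[OF f'(1)] by auto
next
  assume R: ?R
  have ch: "f ` children T u = children T0 (f u)" if "u \<in> verts T" for u using R that by blast
  have "verts T0 \<subseteq> f ` verts T"
  proof (rule verts_subset_if_children_closed[OF T0])
    show "rt T0 \<in> f ` verts T" using R rooted_treeD(2)[OF T] by force
    fix x assume "x \<in> f ` verts T"
    then obtain u where u: "u \<in> verts T" "x = f u" by blast
    have "children T0 x = f ` children T u" using ch[OF u(1)] u(2) by simp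
    then show "children T0 x \<subseteq> f ` verts T" using children_subset[of T u] by (simp add: image_mono)
  qed
  then have img: "f ` verts T = verts T0" using R by blast
  have inj: "inj_on f (verts T)"
    by (rule eq_card_imp_inj_on[OF rooted_treeD(1)[OF T]]) (use img R in simp)
  have "(`) f ` edges T = edges T0"
  proof (intro equalityI subsetI)
    fix d assume "d \<in> (`) f ` edges T"
    then obtain e where e: "e \<in> edges T" "d = f ` e" by blast
    from T e(1) obtain u w where uw: "e = {u, w}" "u \<in> verts T" "w \<in> children T u"
      by (rule edge_is_child)
    have "f w \<in> children T0 (f u)" using ch[OF uw(2)] uw(3) by blast
    then show "d \<in> edges T0" using child_is_edge[of "f w" T0 "f u"] e(2) uw(1) by simp
  next
    fix d assume "d \<in> edges T0"
    with T0 obtain x y where xy: "d = {x, y}" "x \<in> verts T0" "y \<in> children T0 x"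
      by (rule edge_is_child)
    then obtain u where u: "u \<in> verts T" "x = f u" using img by blast
    then obtain w where w: "w \<in> children T u" "y = f w" using xy(3) ch[OF u(1)] by blast
    have "d = f ` {u, w}" using xy(1) u(2) w(2) by simp
    then show "d \<in> (`) f ` edges T" using child_is_edge[OF w(1)] by blast
  qed
  then have "map_graph f T = T0" using img R by (intro rgraph.expand) simp
  then show "f \<in> isos T T0" using inj R by (simp add: isos_def)
qed

section \<open>Monomials\<close>

definition mmonom :: "(nat \<Rightarrow>\<^sub>0 nat) \<Rightarrow> 'a::comm_ring_1 mfps" where
  "mmonom m = Abs_mfps (\<lambda>k. if k = m then 1 else 0)"

lemma mcoeff_mmonom: "mcoeff (mmonom m) k = (if k = m then 1 else 0)"
  by (simp add: mmonom_def Abs_mfps_inverse)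

lemma mmonom_mult: "mmonom a * mmonom b = (mmonom (a + b) :: 'a::comm_ring_1 mfps)"
proof (rule mfps_eqI)
  fix m
  have "mcoeff (mmonom a * mmonom b :: 'a mfps) m =
      (\<Sum>p\<in>{(x, y). x + y = m}. if p = (a, b) then 1 else 0)"
    unfolding mcoeff_times by (rule sum.cong) (auto simp: mcoeff_mmonom split: if_splits)
  also have "\<dots> = mcoeff (mmonom (a + b)) m"
    using finite_monomial_splits[of m] by (auto simp: mcoeff_mmonom)
  finally show "mcoeff (mmonom a * mmonom b :: 'a mfps) m = mcoeff (mmonom (a + b)) m" .
qed

lemma mmonom_0: "mmonom 0 = 1"
  by (rule mfps_eqI) (simp add: mcoeff_mmonom one_mfps.rep_eq)

lemma mmonom_prod: "(\<Prod>x\<in>A. mmonom (f x)) = mmonom (\<Sum>x\<in>A. f x)"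
  by (induction A rule: infinite_finite_induct) (simp_all add: mmonom_0 mmonom_mult)

lemma mderiv_mmonom_add_single:
  assumes "Poly_Mapping.lookup m i = 0"
  shows "mderiv i (mmonom (m + Poly_Mapping.single i 1)) = mmonom m"
  by (rule mfps_eqI) (simp add: mcoeff_mderiv mcoeff_mmonom assms)

lemma mderiv_mmonom_0:
  assumes "Poly_Mapping.lookup m i = 0"
  shows "mderiv i (mmonom m) = 0"
proof (rule mfps_eqI)
  fix k
  have "Poly_Mapping.lookup (k + Poly_Mapping.single i (1::nat)) i \<noteq> Poly_Mapping.lookup m i"
    using assms by (simp add: lookup_add)
  then have "k + Poly_Mapping.single i 1 \<noteq> m" by metis
  then show "mcoeff (mderiv i (mmonom m)) k = mcoeff 0 k"
    by (simp add: mcoeff_mderiv mcoeff_mmonom zero_mfps.rep_eq)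
qed

definition vars :: "nat set \<Rightarrow> nat \<Rightarrow>\<^sub>0 nat" where
  "vars C = (\<Sum>x\<in>C. Poly_Mapping.single x 1)"

lemma lookup_sum: "Poly_Mapping.lookup (sum f A) i = (\<Sum>x\<in>A. Poly_Mapping.lookup (f x) i)"
  by (induction A rule: infinite_finite_induct) (simp_all add: lookup_add)

lemma lookup_vars: "finite C \<Longrightarrow> Poly_Mapping.lookup (vars C) i = (if i \<in> C then 1 else 0)"
  unfolding vars_def lookup_sum by (simp add: lookup_single when_def)

text \<open>Differentiating a squarefree product of variables removes a variable, and gives 0 if that variable is
  absent; so the result is nonzero only if the labels are distinct and among the variables in \<open>C\<close>.\<close>

lemma mderivs_mmonom:
  fixes f :: "'v \<Rightarrow> nat"
  assumes "finite A" "finite C" "\<And>w. w \<in> A \<Longrightarrow> Poly_Mapping.lookup s (f w) = 0"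
  shows "(mderivs f A (mmonom (s + vars C)) :: 'a::comm_ring_1 mfps) =
    (if inj_on f A \<and> f ` A \<subseteq> C then mmonom (s + vars (C - f ` A)) else 0)"
  using assms
proof (induction A rule: finite_induct)
  case (insert w A)
  have IH: "(mderivs f A (mmonom (s + vars C)) :: 'a mfps) =
    (if inj_on f A \<and> f ` A \<subseteq> C then mmonom (s + vars (C - f ` A)) else 0)"
    by (rule insert.IH) (use insert.prems in auto)
  have s: "Poly_Mapping.lookup s (f w) = 0" using insert.prems by simp
  show ?case
  proof (cases "inj_on f A \<and> f ` A \<subseteq> C")
    case True
    show ?thesis
    proof (cases "f w \<in> C - f ` A")
      case in_C: True
      have "vars (C - f ` A) = vars (C - f ` insert w A) + Poly_Mapping.single (f w) 1"
      proof -
        have "C - f ` insert w A = C - f ` A - {f w}" by auto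
        then show ?thesis
          using in_C insert.prems(1) sum.remove[of "C - f ` A" "f w" "\<lambda>x. Poly_Mapping.single x (1::nat)"]
          by (simp only: vars_def add.commute finite_Diff)
      qed
      then have "s + vars (C - f ` A) = (s + vars (C - f ` insert w A)) + Poly_Mapping.single (f w) 1"
        by (simp add: add.assoc)
      moreover have "Poly_Mapping.lookup (s + vars (C - f ` insert w A)) (f w) = 0"
        using s insert.prems(1) by (simp add: lookup_add lookup_vars)
      ultimately have D: "(mderiv (f w) (mmonom (s + vars (C - f ` A))) :: 'a mfps) = mmonom (s + vars (C - f ` insert w A))"
        using mderiv_mmonom_add_single by metis
      have p: "inj_on f (insert w A) \<and> f ` insert w A \<subseteq> C" using True in_C insert(2) by auto
      show ?thesis by (simp only: mderivs_insert[OF insert(1,2)] IH if_P[OF True] if_P[OF p] D)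
    next
      case False
      then have "Poly_Mapping.lookup (s + vars (C - f ` A)) (f w) = 0"
        using s insert.prems(1) by (simp add: lookup_add lookup_vars)
      then have D: "(mderiv (f w) (mmonom (s + vars (C - f ` A))) :: 'a mfps) = 0" by (rule mderiv_mmonom_0)
      have n: "\<not> (inj_on f (insert w A) \<and> f ` insert w A \<subseteq> C)" using False insert(2) by auto
      show ?thesis by (simp only: mderivs_insert[OF insert(1,2)] IH if_P[OF True] if_not_P[OF n] D)
    qed
  next
    case False
    then have n: "\<not> (inj_on f (insert w A) \<and> f ` insert w A \<subseteq> C)" by auto
    show ?thesis by (simp only: mderivs_insert[OF insert(1,2)] IH if_not_P[OF False] if_not_P[OF n] mderiv_0)
  qed
qed simp

section \<open>A system that isolates one tree\<close>

text \<open>For a vertex \<open>j\<close> of \<open>T0\<close>, the series \<open>H\<^sub>j\<close> is the product of the variables of the children of \<open>j\<close>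
  and the square of an additional variable. The factor of a vertex labelled \<open>j\<close> is then nonzero only
  if its children carry distinct labels from among the children of \<open>j\<close>. The square makes the order at
  least 2, and the exponent of the additional variable counts vertices. The additional component of the system is 0, which excludes trees that use its label.\<close>

definition tree_system :: "nat rgraph \<Rightarrow> nat \<Rightarrow> nat \<Rightarrow> complex mfps" where
  "tree_system T0 N j = (if j \<in> {1..N} then mmonom (Poly_Mapping.single (Suc N) 2 + vars (children T0 j)) else 0)"

context
  fixes T0 :: "nat rgraph" and N :: nat
  assumes T0: "rooted_tree T0" and verts: "verts T0 = {1..N}"
begin

lemma children_T0: "children T0 j \<subseteq> {1..N}" "finite (children T0 j)"
  using children_subset[of T0 j] finite_children[OF T0] verts by auto

lemma tree_system_higher: "tree_system T0 N \<in> {1..Suc N} \<rightarrow> higher (Suc N)"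
proof
  fix j assume "j \<in> {1..Suc N}"
  let ?m = "Poly_Mapping.single (Suc N) 2 + vars (children T0 j)"
  have "Poly_Mapping.keys ?m \<subseteq> {1..Suc N}"
    using children_T0(1)[of j] children_T0(2)[of j] by (auto simp: in_keys_iff lookup_add lookup_vars lookup_single when_def split: if_splits)
  moreover have "2 \<le> mdegree ?m" by (simp add: mdegree_add)
  ultimately show "tree_system T0 N j \<in> higher (Suc N)"
    by (auto simp: tree_system_def higher_def series_def mcoeff_mmonom mcoeff_arith split: if_splits)
qed

text \<open>The factor of a vertex \<open>u\<close> is 0 or \<open>z\<^sup>2\<close>, with \<open>z\<close> the additional variable, times the variables of
  those children of \<open>f u\<close> that are not labels of children of \<open>u\<close>. A pure power of \<open>z\<close> arises if there
  are none left at any vertex, and the exponent \<open>2 N\<close> fixes the number of vertices.\<close>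

lemma mcoeff_labelled_series_tree_system:
  assumes T: "rooted_tree T" and f: "f \<in> verts T \<rightarrow>\<^sub>E {1..Suc N}" and rt: "f (rt T) = rt T0"
  shows "mcoeff (labelled_series (tree_system T0 N) T f) (Poly_Mapping.single (Suc N) (2 * N)) =
    (if f \<in> isos T T0 then 1 else 0)"
proof (cases "f ` verts T \<subseteq> {1..N}")
  case False
  then obtain u where u: "u \<in> verts T" "f u \<notin> {1..N}" by blast
  have "tree_system T0 N (f u) = 0" using u(2) unfolding tree_system_def by (rule if_not_P)
  then have "mderivs f (children T u) (tree_system T0 N (f u)) = 0"
    by (simp add: mderivs_0 finite_children[OF T])
  then have "labelled_series (tree_system T0 N) T f = 0"
    unfolding labelled_series_alt using u(1) rooted_treeD(1)[OF T] by (intro prod_zero) auto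
  moreover have "f \<notin> isos T T0" using False isos_iff_children[OF T T0] verts by blast
  ultimately show ?thesis by (simp add: mcoeff_arith)
next
  case True
  let ?s = "Poly_Mapping.single (Suc N) (2::nat)"
  let ?ok = "\<lambda>u. inj_on f (children T u) \<and> f ` children T u \<subseteq> children T0 (f u)"
  have factor: "mderivs f (children T u) (tree_system T0 N (f u)) =
      (if ?ok u then mmonom (?s + vars (children T0 (f u) - f ` children T u)) else 0)" if u: "u \<in> verts T" for u
  proof -
    have "f u \<in> {1..N}" using True u by blast
    then have "tree_system T0 N (f u) = mmonom (?s + vars (children T0 (f u)))" by (simp add: tree_system_def)
    moreover have "Poly_Mapping.lookup ?s (f w) = 0" if "w \<in> children T u" for w
    proof -
      have "f w \<in> {1..N}" using that children_subset[of T u] True by blast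
      then show ?thesis by (auto simp: lookup_single when_def)
    qed
    ultimately show ?thesis
      using mderivs_mmonom[OF finite_children[OF T] children_T0(2), of u ?s f "f u"] by simp
  qed
  show ?thesis
  proof (cases "\<forall>u\<in>verts T. ?ok u")
    case False
    then obtain u where u: "u \<in> verts T" "\<not> ?ok u" by blast
    have "mderivs f (children T u) (tree_system T0 N (f u)) = 0"
      unfolding factor[OF u(1)] using u(2) by (rule if_not_P)
    then have "labelled_series (tree_system T0 N) T f = 0"
      unfolding labelled_series_alt using u(1) rooted_treeD(1)[OF T] by (intro prod_zero) auto
    moreover have "f \<notin> isos T T0" using u isos_iff_children[OF T T0] by blast
    ultimately show ?thesis by (simp add: mcoeff_arith)
  next
    case ok: True
    let ?m = "\<Sum>u\<in>verts T. ?s + vars (children T0 (f u) - f ` children T u)"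
    have "labelled_series (tree_system T0 N) T f = mmonom ?m"
      unfolding labelled_series_alt mmonom_prod[symmetric] using factor ok by (intro prod.cong) auto
    moreover have "Poly_Mapping.single (Suc N) (2 * N) = ?m \<longleftrightarrow> f \<in> isos T T0"
    proof -
      have lookup: "Poly_Mapping.lookup ?m i = (\<Sum>u\<in>verts T. (if i = Suc N then 2 else 0) +
          (if i \<in> children T0 (f u) - f ` children T u then 1 else 0))" for i
        unfolding lookup_sum lookup_add using children_T0
        by (intro sum.cong) (auto simp: lookup_vars lookup_single when_def)
      have "Suc N \<notin> children T0 j" for j using children_T0(1)[of j] by auto
      then have lookup_N: "Poly_Mapping.lookup ?m (Suc N) = 2 * card (verts T)"
        unfolding lookup by simp
      have iso: "f \<in> isos T T0 \<longleftrightarrow> card (verts T) = N \<and> (\<forall>u\<in>verts T. children T0 (f u) - f ` children T u = {})"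
        unfolding isos_iff_children[OF T T0] using f rt True ok verts by (auto simp: PiE_iff)
      show ?thesis
        unfolding iso
      proof
        assume eq: "Poly_Mapping.single (Suc N) (2 * N) = ?m"
        have "2 * N = 2 * card (verts T)" using lookup_N by (simp flip: eq)
        moreover have "x \<notin> children T0 (f u) - f ` children T u" if u: "u \<in> verts T" for u x
        proof
          assume x: "x \<in> children T0 (f u) - f ` children T u"
          then have "x \<noteq> Suc N" using children_T0(1)[of "f u"] by auto
          then have "Poly_Mapping.lookup ?m x = 0" by (simp flip: eq add: lookup_single when_def)
          then show False using lookup[of x] x u rooted_treeD(1)[OF T] by auto
        qed
        ultimately show "card (verts T) = N \<and> (\<forall>u\<in>verts T. children T0 (f u) - f ` children T u = {})" by auto
      next
        assume R: "card (verts T) = N \<and> (\<forall>u\<in>verts T. children T0 (f u) - f ` children T u = {})"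
        show "Poly_Mapping.single (Suc N) (2 * N) = ?m"
        proof (rule poly_mapping_eqI)
          fix i
          have "Poly_Mapping.lookup ?m i = (\<Sum>u\<in>verts T. if i = Suc N then 2 else 0)"
            unfolding lookup using R by (intro sum.cong) auto
          moreover have "(\<Sum>u\<in>verts T. if i = Suc N then 2 else 0) = (if i = Suc N then 2 * N else 0)"
            using R by simp
          moreover have "Poly_Mapping.lookup (Poly_Mapping.single (Suc N) (2 * N)) i = (if i = Suc N then 2 * N else 0)"
            by (simp add: lookup_single when_def)
          ultimately show "Poly_Mapping.lookup (Poly_Mapping.single (Suc N) (2 * N)) i = Poly_Mapping.lookup ?m i"
            by (simp only:)
        qed
      qed
    qed
    ultimately show ?thesis by (simp add: mcoeff_mmonom)
  qed
qed

lemma mcoeff_tree_series_tree_system: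
  assumes T: "rooted_tree T"
  shows "mcoeff (tree_series (Suc N) (tree_system T0 N) T (rt T0)) (Poly_Mapping.single (Suc N) (2 * N)) =
    (if tree_iso T T0 then of_nat (num_auts T) else 0)"
proof -
  let ?F = "{f \<in> verts T \<rightarrow>\<^sub>E {1..Suc N}. f (rt T) = rt T0}"
  have fin: "finite ?F"
    by (rule finite_subset[of _ "verts T \<rightarrow>\<^sub>E {1..Suc N}"]) (auto intro!: finite_PiE rooted_treeD(1)[OF T])
  have sub: "isos T T0 \<subseteq> ?F"
  proof
    fix f assume "f \<in> isos T T0"
    then have "f \<in> extensional (verts T)" "f ` verts T \<subseteq> {1..N}" "f (rt T) = rt T0"
      unfolding isos_iff_children[OF T T0] verts by auto
    then show "f \<in> ?F" by (auto simp: PiE_iff image_subset_iff le_Suc_eq)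
  qed
  have "mcoeff (tree_series (Suc N) (tree_system T0 N) T (rt T0)) (Poly_Mapping.single (Suc N) (2 * N)) =
      (\<Sum>f\<in>?F. if f \<in> isos T T0 then 1 else 0)"
    unfolding tree_series_def mcoeff_sum
    by (rule sum.cong) (simp_all add: mcoeff_labelled_series_tree_system[OF T])
  also have "\<dots> = of_nat (card (isos T T0))"
    using sub fin by (simp add: sum.inter_restrict[symmetric] Int_absorb1)
  finally show ?thesis by (simp add: card_isos[OF T])
qed

end

text \<open>The right-hand side does not involve \<open>\<psi>\<close>, so an expansion of the flow determines all coefficients of
  its polynomials.\<close>

lemma flow_expansion_coeff:
  assumes \<psi>: "flow_expansion \<psi>" and T0: "rooted_tree T0" and verts: "verts T0 = {1..N}"
  shows "of_rat (coeff (\<psi> (abs_rtree T0)) k) = coeff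
    (mcoeff (flow (Suc N) (\<lambda>j. mvar j + tree_system T0 N j) (rt T0)) (Poly_Mapping.single (Suc N) (2 * N)) -
      mcoeff (mvar (rt T0)) (Poly_Mapping.single (Suc N) (2 * N))) k"
proof -
  let ?m = "Poly_Mapping.single (Suc N) (2 * N)" and ?c0 = "abs_rtree T0"
  let ?R = "msum (\<lambda>T. mscale (map_poly of_rat (\<psi> T))
      (const_t (norm_tree_series (Suc N) (tree_system T0 N) (rep_rtree T) (rt T0))))"
  note H = tree_system_higher[OF T0 verts]
  have deg: "mdegree ?m \<le> 2 * N" by simp
  have rt: "rt T0 \<in> {1..N}" using rooted_treeD(2)[OF T0] verts by simp
  have flow: "flow (Suc N) (\<lambda>j. mvar j + tree_system T0 N j) (rt T0) = mvar (rt T0) + ?R"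
    using \<psi> H rt unfolding flow_expansion_def by simp
  have iso0: "tree_iso (rep_rtree ?c0) T0"
    using tree_iso_rep_rtree[OF T0] by simp
  have iso: "tree_iso (rep_rtree T) T0 \<longleftrightarrow> T = ?c0" for T
    using tree_iso_rep_rtree[OF T0] by auto
  have fin: "finite {T. card (verts (rep_rtree T)) \<le> 2 * N}" by (rule finite_rtree_card_le)
  have "coeff (mcoeff ?R ?m) k = (\<Sum>T | card (verts (rep_rtree T)) \<le> 2 * N.
      if T = ?c0 then of_rat (coeff (\<psi> ?c0) k) else 0)"
    unfolding coeff_tree_expansion[OF H deg]
  proof (rule sum.cong)
    fix T
    have "num_auts (rep_rtree T) > 0" by (rule num_auts_pos[OF rooted_tree_rep_rtree])
    then show "of_rat (coeff (\<psi> T) k) * (mcoeff (tree_series (Suc N) (tree_system T0 N) (rep_rtree T) (rt T0)) ?m /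
        of_nat (num_auts (rep_rtree T))) = (if T = ?c0 then of_rat (coeff (\<psi> ?c0) k) else 0)"
      unfolding mcoeff_tree_series_tree_system[OF T0 verts rooted_tree_rep_rtree] iso
      by (cases "T = ?c0") auto
  qed simp
  also have "\<dots> = of_rat (coeff (\<psi> ?c0) k)"
    using fin tree_iso_card[OF iso0] verts by simp
  finally show ?thesis unfolding flow by (simp add: mcoeff_arith)
qed

lemma flow_expansion_unique:
  assumes "flow_expansion \<psi>" "flow_expansion \<chi>"
  shows "\<psi> = \<chi>"
proof (intro ext poly_eqI)
  fix c k
  let ?N = "card (verts (rep_rtree c))"
  obtain g where g: "bij_betw g (verts (rep_rtree c)) {1..?N}"
    using finite_same_card_bij[OF rooted_treeD(1)[OF rooted_tree_rep_rtree], of "{1..?N}" c] by auto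
  let ?T0 = "map_graph g (rep_rtree c)"
  have T0: "rooted_tree ?T0" "verts ?T0 = {1..?N}"
    using g rooted_tree_map_graph[OF rooted_tree_rep_rtree, of g c] by (auto simp: bij_betw_def)
  have "tree_iso (rep_rtree c) ?T0"
    using g rooted_tree_rep_rtree by (auto simp: tree_iso_iff bij_betw_def)
  then have "abs_rtree ?T0 = c"
    using tree_iso_rep_rtree[OF T0(1)] by simp
  then have "(of_rat (coeff (\<psi> c) k) :: complex) = of_rat (coeff (\<chi> c) k)"
    using flow_expansion_coeff[OF assms(1) T0, of k] flow_expansion_coeff[OF assms(2) T0, of k] by simp
  then show "coeff (\<psi> c) k = coeff (\<chi> c) k" by simp
qed

lemma flow_poly_abs_rtree:
  fixes T :: "nat rgraph"
  assumes T: "rooted_tree T" shows "flow_poly (rep_rtree (abs_rtree T)) = flow_poly T"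
proof -
  have iso: "tree_iso (rep_rtree (abs_rtree T)) T"
    using tree_iso_rep_rtree[OF T] by simp
  have inv: "iso_invariant (cut_sum phi k)" for k
    by (rule iso_invariant_cut_sum) (simp add: iso_invariant_def phi_map_graph)
  show ?thesis
    unfolding flow_poly_def tree_iso_card[OF iso] iso_invariant_tree_iso[OF inv iso] ..
qed

theorem theorem3p8:
  shows "(\<exists>!\<psi> :: rtree \<Rightarrow> rat poly. flow_expansion \<psi>) \<and>
    (\<forall>\<psi>. flow_expansion \<psi> \<longrightarrow>
      (\<forall>T :: nat rgraph. rooted_tree T \<longrightarrow>
        \<psi> (abs_rtree T) =
          (\<Sum>k = 1..card (verts T).
             monom (1 / fact k * (\<Sum>es \<in> cut_seqs T (k - 1). prod_list (map phi (pieces T es)))) k)))"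
proof (intro conjI allI impI)
  show "\<exists>!\<psi>. flow_expansion \<psi>"
    using flow_expansion_flow_poly flow_expansion_unique by blast
next
  fix \<psi> and T :: "nat rgraph" assume \<psi>: "flow_expansion \<psi>" and T: "rooted_tree T"
  have "\<psi> (abs_rtree T) = flow_poly T"
    using flow_expansion_unique[OF \<psi> flow_expansion_flow_poly] flow_poly_abs_rtree[OF T] by simp
  then show "\<psi> (abs_rtree T) = (\<Sum>k = 1..card (verts T).
      monom (1 / fact k * (\<Sum>es \<in> cut_seqs T (k - 1). prod_list (map phi (pieces T es)))) k)"
    by (simp add: flow_poly_def sum_cut_seqs[OF T])
qed

end
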